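(* Let $R$ be a commutative ring, let $F$ be a formal group law over $R$ such that $[n]_F(t)\in R[[t]]$ is not a zero-divisor for any $n>0$, and let $p$ be a prime. Let $\hat{\mathbf{G}}=\mathrm{Spf}\,R[[t]]$ denote the associated formal group over $R$. Then: (1) Let $R[[t]]\langle x\rangle_F=R[[t]]\bigl[x,\frac{x^n}{n!_F}\bigr]_{n\ge 0}$. The cohomology of the complex $F\Omega_{\mathbf{A}^1}\otimes_{R[[t]][x]}R[[t]]\langle x\rangle_F$, i.e. of $\nabla_F:R[[t]]\langle x\rangle_F\to R[[t]]\langle x\rangle_F\,dx$, is concentrated in degree zero, where it is isomorphic to $R[[t]]$. (2) There is a canonical isomorphism $$F\Omega^i_{\mathbf{A}^{1,(p)}}\otimes_{R[[t]]}R[[t]]/\langle p\rangle_F\cong\mathrm{H}^i\bigl(F\Omega_{\mathbf{A}^1}\otimes_{R[[t]]}R[[t]]/\langle p\rangle_F\bigr)$$ sending $(x^p)^n\mapsto x^{np}$ in degree zero and $(x^p)^nd(x^p)\mapsto[x^{np}x^{p-1}dx]$ in degree one. (Note that $\mathrm{Spf}\,R[[t]]/[p]_F\cong\hat{\mathbf{G}}[p]$.) (3) Replace $R[[t]]$ with its $\langle p\rangle_F$-adic completion. Let $\varphi:R[[t]]\to R[[t]]$ denote the $R$-algebra map sending $t\mapsto[p]_F(t)$, i.e. the map on rings induced by multiplication by $p$ on $\hat{\mathbf{G}}$. Then there is a quasi-isomorphism $\varphi^*F\Omega_{\mathbf{A}^{1,(p)}}\xrightarrow{\ \sim\ }\eta_{\langle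 p\rangle_F}F\Omega_{\mathbf{A}^1}$. (4) Replace $R[[t]]$ by its $(p,\langle p\rangle_F)$-adic completion, with $\varphi$ as in (3) the map $t\mapsto[p]_F(t)$, and suppose that for any $n\ge 0$, $\varphi(n!_F)$ is a non-zero-divisor in $R[[t]]/\langle p\rangle_F$. Let $A$ be a $\langle p\rangle_F$-completely flat $R[[t]]$-algebra equipped with an $R[[t]]$-linear multiplicative map $\phi:\varphi^*A\to A$ (equivalently, a $\varphi$-semilinear multiplicative map $\phi:A\to A$). If $x\in A$ is an element such that $\phi(x)=x^p$ and $\langle p\rangle_F\mid\phi(x)$, then $\frac{x^n}{n!_F}\in A$ for all $n\ge 0$, i.e. $n!_F$ divides $x^n$ in $A$.
   Context: A (one-dimensional) formal group law over $R$ is $F(x,y)=x+_Fy\in R[[x,y]]$ with $F(F(x,y),z)=F(x,F(y,z))$ and $F(x,y)\equiv x+y\pmod{(x,y)^2}$. For $n\ge 0$, $[n]_F(t)=t+_F\cdots+_Ft$ ($n$ times), $\langle n\rangle_F=[n]_F(t)/t\in R[[t]]$, and $n!_F=\prod_{i=1}^n\langle i\rangle_F$. The $F$-de Rham complex of $\mathbf{A}^1=\mathrm{Spec}\,R[x]$ is the two-term complex (degrees $0,1$) $F\Omega_{\mathbf{A}^1}=\bigl(R[[t]][x]\xrightarrow{\nabla_F}R[[t]][x]\,dx\bigr)$, where $\nabla_F$ is $R[[t]]$-linear with $\nabla_F(x^n)=\langle n\rangle_Fx^{n-1}dx$ (and $\nabla_F(x^n/n!_F)=\frac{x^{n-1}}{(n-1)!_F}dx$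 on $R[[t]]\langle x\rangle_F$). $F\Omega_{\mathbf{A}^{1,(p)}}$ is the same complex in the variable $x^p$: $R[[t]][x^p]\to R[[t]][x^p]\,d(x^p)$, $(x^p)^n\mapsto\langle n\rangle_F(x^p)^{n-1}d(x^p)$. $\varphi^*$ denotes base change along $\varphi$. For a non-zero-divisor $f$ and a termwise $f$-torsionfree complex $M^\bullet$, $\eta_fM^\bullet\subseteq M^\bullet[1/f]$ is the subcomplex $(\eta_fM)^i=\{z\in f^iM^i:dz\in f^{i+1}M^{i+1}\}$. The map in (3) is induced by $\varphi$ on coefficients, $x^p\mapsto x^p$, and $d(x^p)\mapsto\langle p\rangle_Fx^{p-1}dx$. An algebra $A$ over a ring $B$ is $f$-completely flat if $A\otimes^{L}_BB/f$ is concentrated in degree $0$ and flat over $B/f$. *)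

theory Defs
  imports
    "HOL-Computational_Algebra.Formal_Power_Series"
    "HOL-Algebra.UnivPoly"
    "HOL-Algebra.QuotRing"
    "HOL-Algebra.Ideal_Product"
    "HOL-Algebra.Generated_Rings"
    "HOL-Algebra.Algebraic_Closure_Type"
begin

section \<open>Formal group laws\<close>

text \<open>
  An element of \<open>R[[x,y]]\<close> is a term \<open>F :: 'a fps fps\<close>, the coefficient of \<open>x^i y^j\<close> being
  \<open>F $ j $ i\<close>; an element of \<open>R[[x,y,z]]\<close> is a term of type \<open>'a fps fps fps\<close>, the coefficient of
  \<open>x^a y^b z^c\<close> being \<open>h $ c $ b $ a\<close>.

  The substitution \<open>F(g,h) = (\<Sum>i j. F_ij g^i h^j)\<close> is used only for \<open>g\<close>, \<open>h\<close> without constant term.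
  Then \<open>g^i h^j\<close> has no terms of total degree below \<open>i + j\<close>, so that the sums below are complete.
\<close>

definition subst1 :: "'a::comm_ring_1 fps fps \<Rightarrow> 'a fps \<Rightarrow> 'a fps \<Rightarrow> 'a fps" where
  "subst1 F g h = Abs_fps (\<lambda>n. \<Sum>i\<le>n. \<Sum>j\<le>n. F $ j $ i * (g ^ i * h ^ j) $ n)"

definition subst3 ::
  "'a::comm_ring_1 fps fps \<Rightarrow> 'a fps fps fps \<Rightarrow> 'a fps fps fps \<Rightarrow> 'a fps fps fps" where
  "subst3 F g h = Abs_fps (\<lambda>c. Abs_fps (\<lambda>b. Abs_fps (\<lambda>a.
     \<Sum>i\<le>a+b+c. \<Sum>j\<le>a+b+c. F $ j $ i * (g ^ i * h ^ j) $ c $ b $ a)))"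

abbreviation var_x :: "'a::comm_ring_1 fps fps fps" where "var_x \<equiv> fps_const (fps_const fps_X)"
abbreviation var_y :: "'a::comm_ring_1 fps fps fps" where "var_y \<equiv> fps_const fps_X"
abbreviation var_z :: "'a::comm_ring_1 fps fps fps" where "var_z \<equiv> fps_X"

definition formal_group_law :: "'a::comm_ring_1 fps fps \<Rightarrow> bool" where
  "formal_group_law F \<longleftrightarrow>
     F $ 0 $ 0 = 0 \<and> F $ 0 $ 1 = 1 \<and> F $ 1 $ 0 = 1 \<and>
     subst3 F (subst3 F var_x var_y) var_z = subst3 F var_x (subst3 F var_y var_z)"

primrec nseries :: "'a::comm_ring_1 fps fps \<Rightarrow> nat \<Rightarrow> 'a fps" where
  "nseries F 0 = 0"
| "nseries F (Suc n) = subst1 F (nseries F n) fps_X"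

definition bracket :: "'a::comm_ring_1 fps fps \<Rightarrow> nat \<Rightarrow> 'a fps" where
  "bracket F n = fps_shift 1 (nseries F n)"

definition bracket_fact :: "'a::comm_ring_1 fps fps \<Rightarrow> nat \<Rightarrow> 'a fps" where
  "bracket_fact F n = (\<Prod>i=1..n. bracket F i)"

text \<open>The \<open>R\<close>-algebra endomorphism \<open>t \<mapsto> [p](t)\<close> of \<open>R[[t]]\<close>.\<close>

definition frob :: "'a::comm_ring_1 fps fps \<Rightarrow> nat \<Rightarrow> 'a fps \<Rightarrow> 'a fps" where
  "frob F p g = g oo nseries F p"

abbreviation pseries_ring :: "'a::comm_ring_1 fps ring" where
  "pseries_ring \<equiv> ring_of_type_algebra"

definition non_zero_divisor :: "('b, 'm) ring_scheme \<Rightarrow> 'b \<Rightarrow> bool" where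
  "non_zero_divisor B a \<longleftrightarrow>
     a \<in> carrier B \<and> (\<forall>b\<in>carrier B. a \<otimes>\<^bsub>B\<^esub> b = \<zero>\<^bsub>B\<^esub> \<longrightarrow> b = \<zero>\<^bsub>B\<^esub>)"


section \<open>The total ring of fractions\<close>

definition regular :: "'a::comm_ring_1 \<Rightarrow> bool" where
  "regular s \<longleftrightarrow> (\<forall>a. s * a = 0 \<longrightarrow> a = 0)"

lemma regular_1 [simp]: "regular 1"
  by (simp add: regular_def)

lemma regular_mult [simp]: "regular s \<Longrightarrow> regular u \<Longrightarrow> regular (s * u)"
  unfolding regular_def by (metis mult.assoc)

lemma regular_cancel: "regular s \<Longrightarrow> s * a = s * b \<Longrightarrow> a = b"
  by (metis regular_def eq_iff_diff_eq_0 right_diff_distrib)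

definition tfracrel :: "'a::comm_ring_1 \<times> 'a \<Rightarrow> 'a \<times> 'a \<Rightarrow> bool" where
  "tfracrel = (\<lambda>x y. regular (snd x) \<and> regular (snd y) \<and> fst x * snd y = fst y * snd x)"

lemma part_equivp_tfracrel: "part_equivp (tfracrel :: 'a::comm_ring_1 \<times> 'a \<Rightarrow> _)"
proof (rule part_equivpI)
  show "\<exists>x :: 'a \<times> 'a. tfracrel x x"
    by (rule exI[where x = "(0, 1)"]) (simp add: tfracrel_def)
  show "symp (tfracrel :: 'a \<times> 'a \<Rightarrow> _)"
    by (auto simp: symp_def tfracrel_def)
  show "transp (tfracrel :: 'a \<times> 'a \<Rightarrow> _)"
  proof (rule transpI, unfold split_paired_all)
    fix a b a' b' a'' b'' :: 'a
    assume A: "tfracrel (a, b) (a', b')" and B: "tfracrel (a', b') (a'', b'')"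
    have "b' * (a * b'') = b'' * (a * b')" by (simp add: ac_simps)
    also have "a * b' = a' * b" using A by (simp add: tfracrel_def)
    also have "b'' * (a' * b) = b * (a' * b'')" by (simp add: ac_simps)
    also have "a' * b'' = a'' * b'" using B by (simp add: tfracrel_def)
    also have "b * (a'' * b') = b' * (a'' * b)" by (simp add: ac_simps)
    finally have "b' * (a * b'') = b' * (a'' * b)" .
    moreover have "regular b'" using A by (simp add: tfracrel_def)
    ultimately have "a * b'' = a'' * b" using regular_cancel by blast
    with A B show "tfracrel (a, b) (a'', b'')"
      by (simp add: tfracrel_def)
  qed
qed

quotient_type (overloaded) 'a tfrac = "'a::comm_ring_1 \<times> 'a" / partial: tfracrel
  by (rule part_equivp_tfracrel)

text \<open>\<open>Tfrac a s\<close> is the fraction \<open>a / s\<close> if \<open>s\<close> is a non-zero-divisor, and a dummy otherwise.\<close>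

lift_definition Tfrac :: "'a::comm_ring_1 \<Rightarrow> 'a \<Rightarrow> 'a tfrac"
  is "\<lambda>a s. if regular s then (a, s) else (0, 1)"
  by (simp add: tfracrel_def)

lemma Tfrac_cases [cases type: tfrac]:
  obtains (Tfrac) a s where "q = Tfrac a s" "regular s"
  by transfer (auto simp: tfracrel_def)

lemma eq_Tfrac:
  "regular s \<Longrightarrow> regular u \<Longrightarrow> Tfrac a s = Tfrac b u \<longleftrightarrow> a * u = b * s"
  by transfer (simp add: tfracrel_def)

instantiation tfrac :: (comm_ring_1) comm_ring_1
begin

lift_definition zero_tfrac :: "'a tfrac" is "(0, 1)" by (simp add: tfracrel_def)

lift_definition one_tfrac :: "'a tfrac" is "(1, 1)" by (simp add: tfracrel_def)

lift_definition plus_tfrac :: "'a tfrac \<Rightarrow> 'a tfrac \<Rightarrow> 'a tfrac"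
  is "\<lambda>q r. (fst q * snd r + fst r * snd q, snd q * snd r)"
proof -
  fix q q' r r' :: "'a \<times> 'a"
  assume q: "tfracrel q q'" and r: "tfracrel r r'"
  have "(fst q * snd r + fst r * snd q) * (snd q' * snd r')
      = (fst q * snd q') * (snd r * snd r') + (fst r * snd r') * (snd q * snd q')"
    by (simp add: algebra_simps)
  also have "\<dots> = (fst q' * snd q) * (snd r * snd r') + (fst r' * snd r) * (snd q * snd q')"
    using q r by (simp add: tfracrel_def)
  also have "\<dots> = (fst q' * snd r' + fst r' * snd q') * (snd q * snd r)"
    by (simp add: algebra_simps)
  finally show "tfracrel (fst q * snd r + fst r * snd q, snd q * snd r)
      (fst q' * snd r' + fst r' * snd q', snd q' * snd r')"
    using q r by (simp add: tfracrel_def)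
qed

lift_definition uminus_tfrac :: "'a tfrac \<Rightarrow> 'a tfrac" is "\<lambda>q. (- fst q, snd q)"
  by (simp add: tfracrel_def)

definition minus_tfrac :: "'a tfrac \<Rightarrow> 'a tfrac \<Rightarrow> 'a tfrac" where
  "minus_tfrac q r = q + - r"

lift_definition times_tfrac :: "'a tfrac \<Rightarrow> 'a tfrac \<Rightarrow> 'a tfrac"
  is "\<lambda>q r. (fst q * fst r, snd q * snd r)"
proof -
  fix q q' r r' :: "'a \<times> 'a"
  assume q: "tfracrel q q'" and r: "tfracrel r r'"
  have "(fst q * fst r) * (snd q' * snd r') = (fst q * snd q') * (fst r * snd r')"
    by (simp add: algebra_simps)
  also have "\<dots> = (fst q' * snd q) * (fst r' * snd r)"
    using q r by (simp add: tfracrel_def)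
  also have "\<dots> = (fst q' * fst r') * (snd q * snd r)"
    by (simp add: algebra_simps)
  finally show "tfracrel (fst q * fst r, snd q * snd r) (fst q' * fst r', snd q' * snd r')"
    using q r by (simp add: tfracrel_def)
qed

lemma Zero_tfrac: "0 = Tfrac 0 1"
  by transfer (simp add: tfracrel_def)

lemma One_tfrac: "1 = Tfrac 1 1"
  by transfer (simp add: tfracrel_def)

lemma add_Tfrac [simp]:
  "regular s \<Longrightarrow> regular u \<Longrightarrow> Tfrac a s + Tfrac b u = Tfrac (a * u + b * s) (s * u)"
  by transfer (simp add: tfracrel_def)

lemma uminus_Tfrac [simp]: "regular s \<Longrightarrow> - Tfrac a s = Tfrac (- a) s"
  by transfer (simp add: tfracrel_def)

lemma mult_Tfrac [simp]:
  "regular s \<Longrightarrow> regular u \<Longrightarrow> Tfrac a s * Tfrac b u = Tfrac (a * b) (s * u)"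
  by transfer (simp add: tfracrel_def)

instance
proof
  fix q r s :: "'a tfrac"
  obtain a b c x y z where
    *: "q = Tfrac a x" "r = Tfrac b y" "s = Tfrac c z" "regular x" "regular y" "regular z"
    by (metis Tfrac_cases)
  show "(q * r) * s = q * (r * s)"
    using * by (simp add: mult.assoc)
  show "q * r = r * q"
    using * by (simp add: mult.commute)
  show "1 * q = q"
    using * by (simp add: One_tfrac)
  show "(q + r) + s = q + (r + s)"
    using * by (simp add: algebra_simps)
  show "q + r = r + q"
    using * by (simp add: mult.commute add.commute)
  show "0 + q = q"
    using * by (simp add: Zero_tfrac)
  show "- q + q = 0"
    using * by (simp add: Zero_tfrac eq_Tfrac)
  show "q - r = q + - r"
    by (simp add: minus_tfrac_def)
  have "(q + r) * s = Tfrac ((a * y + b * x) * c) ((x * y) * z)"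
    using * by simp
  also have "\<dots> = Tfrac ((a * c) * (y * z) + (b * c) * (x * z)) ((x * z) * (y * z))"
    using *(4-6) by (subst eq_Tfrac) (auto simp: algebra_simps)
  also have "\<dots> = q * s + r * s"
    using * by simp
  finally show "(q + r) * s = q * s + r * s" .
  show "(0::'a tfrac) \<noteq> 1"
    by (simp add: Zero_tfrac One_tfrac eq_Tfrac)
qed

end

definition to_tfrac :: "'a::comm_ring_1 \<Rightarrow> 'a tfrac" where
  "to_tfrac a = Tfrac a 1"


section \<open>Modules\<close>

text \<open>The multiplicative part of a module record is irrelevant for a module.\<close>

definition mod_hom ::
  "('b, 'k) ring_scheme \<Rightarrow> ('b, 'm) module \<Rightarrow> ('b, 'n) module \<Rightarrow> ('m \<Rightarrow> 'n) set" where
  "mod_hom B M N = {h \<in> carrier M \<rightarrow> carrier N.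
     (\<forall>x\<in>carrier M. \<forall>y\<in>carrier M. h (x \<oplus>\<^bsub>M\<^esub> y) = h x \<oplus>\<^bsub>N\<^esub> h y) \<and>
     (\<forall>r\<in>carrier B. \<forall>x\<in>carrier M. h (r \<odot>\<^bsub>M\<^esub> x) = r \<odot>\<^bsub>N\<^esub> h x)}"

definition mod_iso ::
  "('b, 'k) ring_scheme \<Rightarrow> ('b, 'm) module \<Rightarrow> ('b, 'n) module \<Rightarrow> ('m \<Rightarrow> 'n) set" where
  "mod_iso B M N = {h \<in> mod_hom B M N. bij_betw h (carrier M) (carrier N)}"

definition self_module :: "'b ring \<Rightarrow> ('b, 'b) module" where
  "self_module B = \<lparr>carrier = carrier B, monoid.mult = monoid.mult B, one = one B,
     zero = zero B, add = add B, module.smult = monoid.mult B\<rparr>"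

definition poly_module :: "('b, 'k) ring_scheme \<Rightarrow> ('b, nat \<Rightarrow> 'b) module" where
  "poly_module B = module.truncate (UP B)"

abbreviation xpow :: "('b, 'k) ring_scheme \<Rightarrow> 'b \<Rightarrow> nat \<Rightarrow> nat \<Rightarrow> 'b" where
  "xpow B b n \<equiv> up_ring.monom (UP B) b n"

definition quot_module :: "('b, 'm) module \<Rightarrow> 'm set \<Rightarrow> ('b, 'm set) module" where
  "quot_module M N = \<lparr>carrier = a_rcosets\<^bsub>M\<^esub> N, monoid.mult = undefined, one = undefined, zero = N,
     add = set_add M, module.smult = (\<lambda>r U. \<Union>x\<in>U. N +>\<^bsub>M\<^esub> (r \<odot>\<^bsub>M\<^esub> x))\<rparr>"

definition multiples :: "'b \<Rightarrow> ('b, 'm) module \<Rightarrow> 'm set" where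
  "multiples f M = (\<lambda>m. f \<odot>\<^bsub>M\<^esub> m) ` carrier M"

text \<open>\<open>M \<otimes>\<^sub>B B/f = M/fM\<close>, a module over \<open>B/f\<close>.\<close>

definition mod_reduction :: "'b \<Rightarrow> ('b, 'm) module \<Rightarrow> ('b set, 'm set) module" where
  "mod_reduction f M = \<lparr>carrier = a_rcosets\<^bsub>M\<^esub> (multiples f M), monoid.mult = undefined, one = undefined,
     zero = multiples f M, add = set_add M,
     module.smult = (\<lambda>Q U. \<Union>q\<in>Q. \<Union>x\<in>U. multiples f M +>\<^bsub>M\<^esub> (q \<odot>\<^bsub>M\<^esub> x))\<rparr>"

definition map_reduction :: "'b \<Rightarrow> ('b, 'n) module \<Rightarrow> ('m \<Rightarrow> 'n) \<Rightarrow> 'm set \<Rightarrow> 'n set" where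
  "map_reduction f N h U = (\<Union>x\<in>U. multiples f N +>\<^bsub>N\<^esub> h x)"


section \<open>Cochain complexes in non-negative degrees\<close>

record ('b, 'm) cochain =
  cmod :: "nat \<Rightarrow> ('b, 'm) module"
  cdiff :: "nat \<Rightarrow> 'm \<Rightarrow> 'm"

definition cocycles :: "('b, 'm) cochain \<Rightarrow> nat \<Rightarrow> 'm set" where
  "cocycles C i = {z \<in> carrier (cmod C i). cdiff C i z = \<zero>\<^bsub>cmod C (Suc i)\<^esub>}"

definition coboundaries :: "('b, 'm) cochain \<Rightarrow> nat \<Rightarrow> 'm set" where
  "coboundaries C i = (case i of 0 \<Rightarrow> {\<zero>\<^bsub>cmod C 0\<^esub>} | Suc j \<Rightarrow> cdiff C j ` carrier (cmod C j))"

definition cohomology :: "('b, 'm) cochain \<Rightarrow> nat \<Rightarrow> ('b, 'm set) module" where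
  "cohomology C i = quot_module ((cmod C i)\<lparr>carrier := cocycles C i\<rparr>) (coboundaries C i)"

definition cohom_class :: "('b, 'm) cochain \<Rightarrow> nat \<Rightarrow> 'm \<Rightarrow> 'm set" where
  "cohom_class C i z = coboundaries C i +>\<^bsub>cmod C i\<^esub> z"

definition cochain_map ::
  "('b, 'k) ring_scheme \<Rightarrow> ('b, 'm) cochain \<Rightarrow> ('b, 'n) cochain \<Rightarrow> (nat \<Rightarrow> 'm \<Rightarrow> 'n) \<Rightarrow> bool" where
  "cochain_map B C D u \<longleftrightarrow> (\<forall>i. u i \<in> mod_hom B (cmod C i) (cmod D i) \<and>
     (\<forall>z\<in>carrier (cmod C i). u (Suc i) (cdiff C i z) = cdiff D i (u i z)))"

definition cohom_map :: "('b, 'n) cochain \<Rightarrow> (nat \<Rightarrow> 'm \<Rightarrow> 'n) \<Rightarrow> nat \<Rightarrow> 'm set \<Rightarrow> 'n set" where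
  "cohom_map D u i U = (\<Union>z\<in>U. cohom_class D i (u i z))"

definition quasi_iso ::
  "('b, 'k) ring_scheme \<Rightarrow> ('b, 'm) cochain \<Rightarrow> ('b, 'n) cochain \<Rightarrow> (nat \<Rightarrow> 'm \<Rightarrow> 'n) \<Rightarrow> bool" where
  "quasi_iso B C D u \<longleftrightarrow> cochain_map B C D u \<and>
     (\<forall>i. bij_betw (cohom_map D u i) (carrier (cohomology C i)) (carrier (cohomology D i)))"

text \<open>
  As all degrees are non-negative and \<open>C\<close> is termwise \<open>f\<close>-torsionfree, \<open>f^i C^i\<close> lies in
  \<open>C^i \<subseteq> C^i[1/f]\<close>, and the localization need not be mentioned.
\<close>

definition eta :: "('b, 'k) ring_scheme \<Rightarrow> 'b \<Rightarrow> ('b, 'm) cochain \<Rightarrow> ('b, 'm) cochain" where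
  "eta B f C = \<lparr>
     cmod = (\<lambda>i. (cmod C i)\<lparr>carrier :=
       {z \<in> multiples (f [^]\<^bsub>B\<^esub> i) (cmod C i).
          cdiff C i z \<in> multiples (f [^]\<^bsub>B\<^esub> Suc i) (cmod C (Suc i))}\<rparr>),
     cdiff = cdiff C\<rparr>"


section \<open>The de Rham complex of the affine line attached to a formal group law\<close>

text \<open>
  The linear map \<open>x^n \<mapsto> c n * x^(n-1)\<close> on polynomials over \<open>B\<close>; the elements of \<^term>\<open>UP B\<close> are the
  coefficient functions.
\<close>

definition weighted_deriv ::
  "('b, 'k) ring_scheme \<Rightarrow> (nat \<Rightarrow> 'b) \<Rightarrow> (nat \<Rightarrow> 'b) \<Rightarrow> nat \<Rightarrow> 'b" where
  "weighted_deriv B c g = (\<lambda>n. c (Suc n) \<otimes>\<^bsub>B\<^esub> g (Suc n))"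

lemma (in cring) weighted_deriv_monom:
  assumes "a \<in> carrier R" "\<And>n. c n \<in> carrier R"
  shows "weighted_deriv R c (xpow R a n) =
    (if n = 0 then \<zero>\<^bsub>UP R\<^esub> else xpow R (c n \<otimes> a) (n - 1))"
  using assms by (cases n) (auto simp: weighted_deriv_def UP_def fun_eq_iff)

text \<open>
  \<open>FOmega F B \<psi>\<close> is the base change of the complex \<open>R[[t]][x] \<rightarrow> R[[t]][x] dx\<close> along a ring
  homomorphism \<open>\<psi>: R[[t]] \<rightarrow> B\<close>, that is, \<open>B[x] \<rightarrow> B[x] dx\<close> with \<open>x^n \<mapsto> \<psi>(\<langle>n\<rangle>) x^(n-1) dx\<close>. A form
  \<open>g dx\<close> is represented by its coefficient \<open>g\<close>. The variable has no name, so this is also the complex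
  in the variable \<open>x^p\<close>, where \<open>(x^p)^n\<close> and \<open>(x^p)^n d(x^p)\<close> are both the monomial of degree \<open>n\<close>.
  Further base change along \<open>\<chi>: B \<rightarrow> B'\<close> amounts to replacing \<open>\<psi>\<close> by \<open>\<chi> \<circ> \<psi>\<close>.
\<close>

definition FOmega ::
  "'a::comm_ring_1 fps fps \<Rightarrow> ('b, 'k) ring_scheme \<Rightarrow> ('a fps \<Rightarrow> 'b) \<Rightarrow> ('b, nat \<Rightarrow> 'b) cochain" where
  "FOmega F B \<psi> = \<lparr>
     cmod = (\<lambda>i. if i \<le> 1 then poly_module B
                 else (poly_module B)\<lparr>carrier := {\<zero>\<^bsub>UP B\<^esub>}\<rparr>),
     cdiff = (\<lambda>i. if i = 0 then weighted_deriv B (\<lambda>n. \<psi> (bracket F n)) else (\<lambda>_. \<zero>\<^bsub>UP B\<^esub>))\<rparr>"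

lemma FOmega_base_change:
  assumes "ring_hom_ring B B' \<chi>" "\<And>s. \<psi> s \<in> carrier B" "g \<in> carrier (UP B)"
  shows "\<chi> \<circ> cdiff (FOmega F B \<psi>) 0 g = cdiff (FOmega F B' (\<chi> \<circ> \<psi>)) 0 (\<chi> \<circ> g)"
proof -
  interpret ring_hom_ring B B' \<chi> by fact
  have "g n \<in> carrier B" for n
    using assms(3) by (auto simp: UP_def)
  with assms(2) show ?thesis
    by (simp add: FOmega_def weighted_deriv_def fun_eq_iff)
qed

text \<open>The subring \<open>R[[t]]\<langle>x\<rangle>\<close> of \<open>K[x]\<close>, \<open>K\<close> being the total ring of fractions of \<open>R[[t]]\<close>.
  The differential of \<open>FOmega_divided\<close> is the restriction of the \<open>K\<close>-linear one, so that
  \<open>x^n/n!\<close> is sent to \<open>x^(n-1)/(n-1)! dx\<close>.\<close>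

abbreviation frac_ring :: "'a::comm_ring_1 fps tfrac ring" where
  "frac_ring \<equiv> ring_of_type_algebra"

definition divided_polys :: "'a::comm_ring_1 fps fps \<Rightarrow> (nat \<Rightarrow> 'a fps tfrac) set" where
  "divided_polys F = generate_ring (UP frac_ring)
     (range (\<lambda>s. xpow frac_ring (to_tfrac s) 0) \<union> {xpow frac_ring 1 1} \<union>
      range (\<lambda>n. xpow frac_ring (Tfrac 1 (bracket_fact F n)) n))"

definition divided_module :: "'a::comm_ring_1 fps fps \<Rightarrow> ('a fps, nat \<Rightarrow> 'a fps tfrac) module" where
  "divided_module F = \<lparr>carrier = divided_polys F, monoid.mult = monoid.mult (UP frac_ring),
     one = one (UP frac_ring), zero = zero (UP frac_ring), add = add (UP frac_ring),
     module.smult = (\<lambda>s g. to_tfrac s \<odot>\<^bsub>UP frac_ring\<^esub> g)\<rparr>"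

definition FOmega_divided ::
  "'a::comm_ring_1 fps fps \<Rightarrow> ('a fps, nat \<Rightarrow> 'a fps tfrac) cochain" where
  "FOmega_divided F = \<lparr>
     cmod = (\<lambda>i. if i \<le> 1 then divided_module F
                 else (divided_module F)\<lparr>carrier := {\<zero>\<^bsub>UP frac_ring\<^esub>}\<rparr>),
     cdiff = cdiff (FOmega F frac_ring to_tfrac)\<rparr>"


section \<open>Quotients and completions\<close>

text \<open>
  \<open>lim B/I^n\<close>: a point is a sequence of cosets \<open>U n\<close> of \<open>I^n\<close>, and \<open>U (Suc n) \<subseteq> U n\<close> says that
  \<open>U (Suc n)\<close> maps to \<open>U n\<close>.
\<close>

abbreviation ideal_power :: "('b, 'k) ring_scheme \<Rightarrow> 'b set \<Rightarrow> nat \<Rightarrow> 'b set" where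
  "ideal_power B I n \<equiv> I [^]\<^bsub>ideals_set B\<^esub> n"

definition adic_completion :: "('b, 'k) ring_scheme \<Rightarrow> 'b set \<Rightarrow> (nat \<Rightarrow> 'b set) ring" where
  "adic_completion B I = \<lparr>
     carrier = {U. \<forall>n. U n \<in> carrier (B Quot ideal_power B I n) \<and> U (Suc n) \<subseteq> U n},
     monoid.mult = (\<lambda>U V n. U n \<otimes>\<^bsub>B Quot ideal_power B I n\<^esub> V n),
     one = (\<lambda>n. \<one>\<^bsub>B Quot ideal_power B I n\<^esub>),
     zero = (\<lambda>n. \<zero>\<^bsub>B Quot ideal_power B I n\<^esub>),
     add = (\<lambda>U V n. U n \<oplus>\<^bsub>B Quot ideal_power B I n\<^esub> V n)\<rparr>"

definition completion_map :: "('b, 'k) ring_scheme \<Rightarrow> 'b set \<Rightarrow> 'b \<Rightarrow> nat \<Rightarrow> 'b set" where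
  "completion_map B I b = (\<lambda>n. ideal_power B I n +>\<^bsub>B\<^esub> b)"

definition mod_elem :: "('b, 'k) ring_scheme \<Rightarrow> 'b \<Rightarrow> 'b set ring" where
  "mod_elem B f = B Quot (PIdl\<^bsub>B\<^esub> f)"

definition mod_elem_map :: "('b, 'k) ring_scheme \<Rightarrow> 'b \<Rightarrow> 'b \<Rightarrow> 'b set" where
  "mod_elem_map B f b = PIdl\<^bsub>B\<^esub> f +>\<^bsub>B\<^esub> b"

definition bracket_ideal :: "'a::comm_ring_1 fps fps \<Rightarrow> nat \<Rightarrow> 'a fps set" where
  "bracket_ideal F p = Idl\<^bsub>pseries_ring\<^esub> {bracket F p}"

definition p_bracket_ideal :: "'a::comm_ring_1 fps fps \<Rightarrow> nat \<Rightarrow> 'a fps set" where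
  "p_bracket_ideal F p = Idl\<^bsub>pseries_ring\<^esub> {of_nat p, bracket F p}"

text \<open>Ring endomorphisms of the \<open>I\<close>-adic completion of \<open>R[[t]]\<close> which extend \<open>t \<mapsto> [p](t)\<close>.\<close>

definition frob_extensions ::
  "'a::comm_ring_1 fps fps \<Rightarrow> nat \<Rightarrow> 'a fps set \<Rightarrow> ((nat \<Rightarrow> 'a fps set) \<Rightarrow> nat \<Rightarrow> 'a fps set) set" where
  "frob_extensions F p I =
     {\<Phi> \<in> ring_hom (adic_completion pseries_ring I) (adic_completion pseries_ring I).
        \<Phi> \<circ> completion_map pseries_ring I = completion_map pseries_ring I \<circ> frob F p}"


section \<open>Complete flatness\<close>

text \<open>
  Elements of \<open>M \<otimes> N\<close> are represented by finite formal sums of pairs; \<open>tensor_eq B M N xs ys\<close> says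
  that \<open>xs\<close> and \<open>ys\<close> represent the same element.
\<close>

inductive tensor_eq ::
  "('b, 'k) ring_scheme \<Rightarrow> ('b, 'm) module \<Rightarrow> ('b, 'n) module \<Rightarrow>
     ('m \<times> 'n) list \<Rightarrow> ('m \<times> 'n) list \<Rightarrow> bool"
  for B M N where
  refl: "set xs \<subseteq> carrier M \<times> carrier N \<Longrightarrow> tensor_eq B M N xs xs"
| sym: "tensor_eq B M N xs ys \<Longrightarrow> tensor_eq B M N ys xs"
| trans: "tensor_eq B M N xs ys \<Longrightarrow> tensor_eq B M N ys zs \<Longrightarrow> tensor_eq B M N xs zs"
| append: "tensor_eq B M N xs xs' \<Longrightarrow> tensor_eq B M N ys ys' \<Longrightarrow>
    tensor_eq B M N (xs @ ys) (xs' @ ys')"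
| commute: "set xs \<subseteq> carrier M \<times> carrier N \<Longrightarrow> set ys \<subseteq> carrier M \<times> carrier N \<Longrightarrow>
    tensor_eq B M N (xs @ ys) (ys @ xs)"
| zero: "n \<in> carrier N \<Longrightarrow> tensor_eq B M N [(\<zero>\<^bsub>M\<^esub>, n)] []"
| add_left: "m \<in> carrier M \<Longrightarrow> m' \<in> carrier M \<Longrightarrow> n \<in> carrier N \<Longrightarrow>
    tensor_eq B M N [(m \<oplus>\<^bsub>M\<^esub> m', n)] [(m, n), (m', n)]"
| add_right: "m \<in> carrier M \<Longrightarrow> n \<in> carrier N \<Longrightarrow> n' \<in> carrier N \<Longrightarrow>
    tensor_eq B M N [(m, n \<oplus>\<^bsub>N\<^esub> n')] [(m, n), (m, n')]"
| balanced: "r \<in> carrier B \<Longrightarrow> m \<in> carrier M \<Longrightarrow> n \<in> carrier N \<Longrightarrow>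
    tensor_eq B M N [(r \<odot>\<^bsub>M\<^esub> m, n)] [(m, r \<odot>\<^bsub>N\<^esub> n)]"

text \<open>
  Tensoring with \<open>M\<close> preserves injections. A definition cannot quantify over types, so the test
  modules have elements of the same type as the ring; by the ideal criterion for flatness, this
  class is large enough, since it contains all inclusions of ideals into the ring.
\<close>

definition flat_module :: "'b ring \<Rightarrow> ('b, 'm) module \<Rightarrow> bool" where
  "flat_module B M \<longleftrightarrow> module B M \<and>
     (\<forall>(N :: ('b, 'b) module) (N' :: ('b, 'b) module) g.
        module B N \<and> module B N' \<and> g \<in> mod_hom B N N' \<and> inj_on g (carrier N) \<longrightarrow>
        (\<forall>xs. set xs \<subseteq> carrier M \<times> carrier N \<and>
              tensor_eq B M N' (map (map_prod id g) xs) [] \<longrightarrow> tensor_eq B M N xs []))"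

definition free_module :: "('b, 'k) ring_scheme \<Rightarrow> 'i set \<Rightarrow> ('b, 'i \<Rightarrow> 'b) module" where
  "free_module B J = \<lparr>
     carrier = {v. (\<forall>j. v j \<in> carrier B) \<and> (\<forall>j. j \<notin> J \<longrightarrow> v j = \<zero>\<^bsub>B\<^esub>) \<and> finite {j. v j \<noteq> \<zero>\<^bsub>B\<^esub>}},
     monoid.mult = undefined, one = undefined, zero = (\<lambda>_. \<zero>\<^bsub>B\<^esub>),
     add = (\<lambda>v w j. v j \<oplus>\<^bsub>B\<^esub> w j), module.smult = (\<lambda>r v j. r \<otimes>\<^bsub>B\<^esub> v j)\<rparr>"

text \<open>
  A free resolution \<open>\<dots> \<rightarrow> P 1 \<rightarrow> P 0 \<rightarrow> A \<rightarrow> 0\<close>, where \<open>P i\<close> is free on \<open>J i\<close>, with augmentation \<open>e\<close>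
  and differentials \<open>d i : P (Suc i) \<rightarrow> P i\<close>.
\<close>

definition free_resolution ::
  "('b, 'k) ring_scheme \<Rightarrow> ('b, 'c) module \<Rightarrow> (nat \<Rightarrow> 'i set) \<Rightarrow>
     (('i \<Rightarrow> 'b) \<Rightarrow> 'c) \<Rightarrow> (nat \<Rightarrow> ('i \<Rightarrow> 'b) \<Rightarrow> 'i \<Rightarrow> 'b) \<Rightarrow> bool" where
  "free_resolution B A J e d \<longleftrightarrow>
     e \<in> mod_hom B (free_module B (J 0)) A \<and>
     e ` carrier (free_module B (J 0)) = carrier A \<and>
     (\<forall>i. d i \<in> mod_hom B (free_module B (J (Suc i))) (free_module B (J i))) \<and>
     d 0 ` carrier (free_module B (J 1)) = {v \<in> carrier (free_module B (J 0)). e v = \<zero>\<^bsub>A\<^esub>} \<and>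
     (\<forall>i. d (Suc i) ` carrier (free_module B (J (Suc (Suc i)))) =
        {v \<in> carrier (free_module B (J (Suc i))). d i v = \<zero>\<^bsub>free_module B (J i)\<^esub>})"

text \<open>
  \<open>A \<otimes>\<^sup>L B/f\<close> is concentrated in degree 0: for a free resolution \<open>P\<close> of \<open>A\<close>, the complex \<open>P/fP\<close> is
  exact in positive degrees. The index type is large enough for every \<open>A\<close> to have a free resolution.
\<close>

definition tor_vanishes :: "'b ring \<Rightarrow> 'b \<Rightarrow> ('b, 'c) module \<Rightarrow> bool" where
  "tor_vanishes B f A \<longleftrightarrow>
     (\<exists>(J :: nat \<Rightarrow> (nat + 'b + 'c) set) e d. free_resolution B A J e d \<and>
        (\<forall>i. map_reduction f (free_module B (J (Suc i))) (d (Suc i)) `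
                carrier (mod_reduction f (free_module B (J (Suc (Suc i))))) =
             {U \<in> carrier (mod_reduction f (free_module B (J (Suc i)))).
                map_reduction f (free_module B (J i)) (d i) U =
                  \<zero>\<^bsub>mod_reduction f (free_module B (J i))\<^esub>}))"

definition completely_flat :: "'b ring \<Rightarrow> 'b \<Rightarrow> ('b, 'c) module \<Rightarrow> bool" where
  "completely_flat B f A \<longleftrightarrow>
     tor_vanishes B f A \<and> flat_module (mod_elem B f) (mod_reduction f A)"

text \<open>Preservation of the unit is not required.\<close>

definition semilinear_multiplicative ::
  "'b ring \<Rightarrow> ('b \<Rightarrow> 'b) \<Rightarrow> ('b, 'c) module \<Rightarrow> ('c \<Rightarrow> 'c) \<Rightarrow> bool" where
  "semilinear_multiplicative B \<Phi> A \<phi> \<longleftrightarrow>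
     \<phi> \<in> carrier A \<rightarrow> carrier A \<and>
     (\<forall>x\<in>carrier A. \<forall>y\<in>carrier A. \<phi> (x \<oplus>\<^bsub>A\<^esub> y) = \<phi> x \<oplus>\<^bsub>A\<^esub> \<phi> y) \<and>
     (\<forall>x\<in>carrier A. \<forall>y\<in>carrier A. \<phi> (x \<otimes>\<^bsub>A\<^esub> y) = \<phi> x \<otimes>\<^bsub>A\<^esub> \<phi> y) \<and>
     (\<forall>b\<in>carrier B. \<forall>x\<in>carrier A. \<phi> (b \<odot>\<^bsub>A\<^esub> x) = \<Phi> b \<odot>\<^bsub>A\<^esub> \<phi> x)"

end

theory Submission
  imports Defs
begin

text \<open>
  Everything rests on the arithmetic of the brackets \<open>\<langle>n\<rangle>\<close>. Associativity forces \<open>F(x,0) = x\<close>, so that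
  \<open>F(x,y) = x + y G(x,y)\<close> and \<open>\<langle>m + n\<rangle> = \<langle>m\<rangle> + \<langle>n\<rangle> G\<close> (\<open>bracket_add\<close>); together with \<open>[mn] = [m] o [n]\<close>
  this gives \<open>\<langle>np\<rangle> = \<langle>p\<rangle> \<phi>(\<langle>n\<rangle>)\<close> (\<open>bracket_mult\<close>). Hence, modulo \<open>\<langle>p\<rangle>\<close>, the bracket \<open>\<langle>n\<rangle>\<close> is zero if \<open>p\<close>
  divides \<open>n\<close>, and otherwise it is a unit, since \<open>nx \<equiv> 1\<close> modulo \<open>p\<close> implies \<open>\<langle>nx\<rangle> \<equiv> \<langle>1\<rangle> = 1\<close>
  (\<open>bracket_coprime_unit\<close>). The formula for \<open>\<langle>m + n\<rangle>\<close> is also a Pascal recursion, which shows that \<open>m! n!\<close>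
  divides \<open>(m + n)!\<close> for the bracket factorials (\<open>bracket_fact_mult_dvd\<close>).

  By this divisibility, \<open>R[[t]]\<langle>x\<rangle>_F\<close> consists of the polynomials whose coefficient of \<open>x^n\<close> is in
  \<open>R[[t]] 1/n!\<close>, and \<open>\<nabla>\<close> shifts the basis of the \<open>x^n/n!\<close>: this element goes to
  \<open>x^(n-1)/(n-1)! dx\<close>. So \<open>\<nabla>\<close> is onto, with the constants as its kernel (\<open>divided_cohomology\<close>).

  Modulo \<open>\<langle>p\<rangle>\<close>, \<open>\<nabla>\<close> kills the \<open>x^(np)\<close> and maps every other \<open>x^n\<close> to a unit multiple of \<open>x^(n-1) dx\<close>. What
  survives are the \<open>x^(np)\<close> and the \<open>x^(np+p-1) dx\<close> (\<open>FOmega_mod_iso\<close>). In the \<open>\<langle>p\<rangle>\<close>-adic completion the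
  same brackets are units, and \<open>\<langle>p\<rangle>\<close> is regular. In the complex of \<open>\<eta>_f\<close> the exponents prime to \<open>p\<close>
  then form an acyclic part, while \<open>\<nabla>(x^(np)) = \<langle>p\<rangle> \<phi>(\<langle>n\<rangle>) x^(np-1) dx\<close> is \<open>\<phi>^*\<close> of the differential in
  the variable \<open>x^p\<close>, up to the factor \<open>\<langle>p\<rangle>\<close> that the map in degree one carries (\<open>FOmega_eta_quasi_iso\<close>).

  For the divided powers, write \<open>k\<close> for \<open>n div p\<close>. Then \<open>n!\<close> is a unit times \<open>\<langle>p\<rangle>^k \<phi>(k!)\<close>, and
  \<open>x^(pk) = \<phi>(x)^k = \<phi>(x^k)\<close> is divisible by \<open>\<langle>p\<rangle>^k\<close> because \<open>\<phi>(x)\<close> is divisible by \<open>\<langle>p\<rangle>\<close>, and by \<open>\<phi>(k!)\<close>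
  by induction. It is divisible by the product, because \<open>\<phi>(k!)\<close> is regular on \<open>A/\<langle>p\<rangle>\<close> by flatness and \<open>A\<close>
  has no \<open>\<langle>p\<rangle>\<close>-torsion (\<open>divided_powers_exist\<close>). The absence of torsion follows from the vanishing of the
  higher Tor once \<open>\<langle>p\<rangle>\<close> is regular in the \<open>(p,\<langle>p\<rangle>)\<close>-adic completion. Adic completion need not
  preserve regularity; here it does. As \<open>\<phi>(\<langle>p\<rangle>) \<equiv> p\<close> modulo \<open>\<langle>p\<rangle>\<close>, the hypothesis on \<open>\<phi>(p!)\<close> makes \<open>p\<close>
  regular modulo \<open>\<langle>p\<rangle>\<close>. And as \<open>p \<equiv> - t g\<close> modulo \<open>\<langle>p\<rangle>\<close>, \<open>t\<close>-adic convergence in \<open>R[[t]]\<close> shows that a sequence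
  with \<open>y_i \<equiv> p y_(i+1)\<close> modulo \<open>\<langle>p\<rangle>\<close> consists of multiples of \<open>\<langle>p\<rangle>\<close> (\<open>p_completion_regular\<close>).
\<close>

section \<open>Power series and their evaluation\<close>

definition ring_map :: "('r::comm_ring_1 \<Rightarrow> 's::comm_ring_1) \<Rightarrow> bool" where
  "ring_map f \<longleftrightarrow> f 1 = 1 \<and> (\<forall>a b. f (a + b) = f a + f b) \<and> (\<forall>a b. f (a * b) = f a * f b)"

lemma ring_mapD:
  assumes "ring_map f"
  shows "f 1 = 1" "f (a + b) = f a + f b" "f (a * b) = f a * f b" "f 0 = 0"
    "f (- a) = - f a" "f (a - b) = f a - f b" "f (a ^ n) = f a ^ n"
    "f (\<Sum>i\<in>A. g i) = (\<Sum>i\<in>A. f (g i))" "f (\<Prod>i\<in>A. g i) = (\<Prod>i\<in>A. f (g i))"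
proof -
  show 1: "f 1 = 1" and a: "\<And>a b. f (a + b) = f a + f b" and m: "\<And>a b. f (a * b) = f a * f b"
    using assms by (auto simp: ring_map_def)
  show z: "f 0 = 0" using a[of 0 0] by simp
  show n: "\<And>a. f (- a) = - f a" using a[of _ "- _"] z by (metis add.right_inverse minus_unique)
  show "f (a - b) = f a - f b" using a[of a "- b"] n by simp
  show "f (a ^ n) = f a ^ n" by (induction n) (auto simp: 1 m)
  show "f (\<Sum>i\<in>A. g i) = (\<Sum>i\<in>A. f (g i))"
    by (induction A rule: infinite_finite_induct) (auto simp: z a)
  show "f (\<Prod>i\<in>A. g i) = (\<Prod>i\<in>A. f (g i))"
    by (induction A rule: infinite_finite_induct) (auto simp: 1 m)
qed

lemma ring_map_dvd: "ring_map f \<Longrightarrow> a dvd b \<Longrightarrow> f a dvd f b"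
  by (metis dvd_def ring_mapD(3))

lemma ring_map_comp: "ring_map f \<Longrightarrow> ring_map g \<Longrightarrow> ring_map (\<lambda>a. g (f a))"
  by (auto simp: ring_map_def)

lemma fps_X_power_dvd_iff:
  "fps_X ^ N dvd (a :: 'r::comm_ring_1 fps) \<longleftrightarrow> (\<forall>n<N. a $ n = 0)"
proof
  assume "fps_X ^ N dvd a"
  then show "\<forall>n<N. a $ n = 0" by (auto simp: dvd_def fps_X_power_mult_nth)
next
  assume "\<forall>n<N. a $ n = 0"
  then have "a = fps_X ^ N * fps_shift N a"
    by (auto simp: fps_eq_iff fps_X_power_mult_nth)
  then show "fps_X ^ N dvd a" by (rule dvdI)
qed

text \<open>
  Identities between power series are proved modulo all powers of the variable, where every sum
  is finite.
\<close>

lemma fps_eq_if_cong: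
  "(\<And>N. fps_X ^ N dvd a - b) \<Longrightarrow> a = (b :: 'r::comm_ring_1 fps)"
  by (auto simp: fps_X_power_dvd_iff fps_eq_iff)

lemma fps_X_power_dvd_power:
  assumes "g $ 0 = (0::'r::comm_ring_1)"
  shows "fps_X ^ n dvd g ^ n"
proof -
  have "fps_X ^ 1 dvd g" using assms by (simp only: fps_X_power_dvd_iff) simp
  then show ?thesis by (metis dvd_power_same power_one_right)
qed

text \<open>
  The substitution \<open>y := h\<close> in a series \<open>P \<in> R[[t]][[y]]\<close>, for \<open>h\<close> without constant term. As \<open>h^j\<close> is
  divisible by \<open>t^j\<close>, the terms with \<open>j > n\<close> do not contribute to the coefficient of \<open>t^n\<close>.
\<close>

definition eval_last :: "'a::comm_ring_1 fps \<Rightarrow> 'a fps fps \<Rightarrow> 'a fps" where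
  "eval_last h P = Abs_fps (\<lambda>n. \<Sum>j\<le>n. (P $ j * h ^ j) $ n)"

lemma eval_last_cong:
  assumes h: "h $ 0 = 0"
  shows "fps_X ^ N dvd eval_last h P - (\<Sum>j<N. P $ j * h ^ j)"
proof -
  have "(\<Sum>j\<le>n. (P $ j * h ^ j) $ n) = (\<Sum>j<N. (P $ j * h ^ j) $ n)" if "n < N" for n
  proof (rule sum.mono_neutral_left)
    show "\<forall>j\<in>{..<N} - {..n}. (P $ j * h ^ j) $ n = 0"
    proof
      fix j assume "j \<in> {..<N} - {..n}"
      moreover have "fps_X ^ j dvd P $ j * h ^ j"
        using fps_X_power_dvd_power[OF h] by (rule dvd_mult)
      ultimately show "(P $ j * h ^ j) $ n = 0" by (simp add: fps_X_power_dvd_iff)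
    qed
  qed (use that in auto)
  then show ?thesis by (simp add: fps_X_power_dvd_iff eval_last_def fps_sum_nth)
qed

text \<open>
  Modulo \<open>t^N\<close>, the values are finite sums, and the product of two such sums differs from the sum for
  the product by terms \<open>h^(i+j)\<close> with \<open>i + j \<ge> N\<close> only.
\<close>

lemma ring_map_eval_last:
  assumes h: "h $ 0 = (0::'a::comm_ring_1)"
  shows "ring_map (eval_last h)"
proof -
  have "eval_last h 1 = 1"
  proof (rule fps_ext)
    fix n
    have "(\<Sum>j\<le>n. ((1::'a fps fps) $ j * h ^ j) $ n) = (\<Sum>j\<le>n. if j = 0 then (1::'a fps) $ n else 0)"
      by (intro sum.cong) auto
    then show "eval_last h 1 $ n = 1 $ n" by (simp add: eval_last_def)
  qed
  moreover have "eval_last h (P + Q) = eval_last h P + eval_last h Q" for P Q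
    by (simp add: eval_last_def fps_eq_iff algebra_simps sum.distrib)
  moreover have "eval_last h (P * Q) = eval_last h P * eval_last h Q" for P Q
  proof (rule fps_eq_if_cong)
    fix N
    let ?p = "\<Sum>j<N. P $ j * h ^ j" and ?q = "\<Sum>j<N. Q $ j * h ^ j"
    let ?g = "\<lambda>(i, j). P $ i * Q $ j * h ^ (i + j)"
    have "?p * ?q = sum ?g ({..<N} \<times> {..<N})"
      by (simp add: sum_product sum.cartesian_product power_add mult_ac)
    also have "\<dots> = sum ?g {(i, j). i + j < N} + sum ?g ({..<N} \<times> {..<N} - {(i, j). i + j < N})"
      by (subst sum.subset_diff[of "{(i, j). i + j < N}"]) (auto simp: add.commute)
    also have "sum ?g {(i, j). i + j < N} = (\<Sum>k<N. \<Sum>i\<le>k. P $ i * Q $ (k - i) * h ^ k)"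
      by (simp add: sum.triangle_reindex)
    also have "\<dots> = (\<Sum>k<N. (P * Q) $ k * h ^ k)"
      by (simp add: fps_mult_nth sum_distrib_right atLeast0AtMost)
    finally have "?p * ?q - (\<Sum>k<N. (P * Q) $ k * h ^ k)
      = sum ?g ({..<N} \<times> {..<N} - {(i, j). i + j < N})" by simp
    moreover have "fps_X ^ N dvd sum ?g ({..<N} \<times> {..<N} - {(i, j). i + j < N})"
    proof (rule dvd_sum)
      fix x assume "x \<in> {..<N} \<times> {..<N} - {(i, j). i + j < N}"
      then obtain i j where x: "x = (i, j)" "N \<le> i + j" by fastforce
      then have "fps_X ^ N dvd h ^ (i + j)"
        using fps_X_power_dvd_power[OF h, of "i + j"] by (meson dvd_trans le_imp_power_dvd)
      then show "fps_X ^ N dvd ?g x" by (simp add: x)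
    qed
    ultimately have 1: "fps_X ^ N dvd ?p * ?q - (\<Sum>k<N. (P * Q) $ k * h ^ k)" by simp
    have 2: "fps_X ^ N dvd eval_last h P * (eval_last h Q - ?q) + (eval_last h P - ?p) * ?q"
      using eval_last_cong[OF h, of N P] eval_last_cong[OF h, of N Q] by (intro dvd_add dvd_mult dvd_mult2)
    have e: "eval_last h (P * Q) - eval_last h P * eval_last h Q =
      (eval_last h (P * Q) - (\<Sum>k<N. (P * Q) $ k * h ^ k)) - (?p * ?q - (\<Sum>k<N. (P * Q) $ k * h ^ k))
      - (eval_last h P * (eval_last h Q - ?q) + (eval_last h P - ?p) * ?q)"
      by (simp add: algebra_simps)
    show "fps_X ^ N dvd eval_last h (P * Q) - eval_last h P * eval_last h Q"
      by (subst e, intro dvd_diff 1 2 eval_last_cong h)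
  qed
  ultimately show ?thesis by (simp add: ring_map_def)
qed

lemma eval_last_const [simp]: "eval_last h (fps_const a) = a"
proof (rule fps_ext)
  fix n
  have "(\<Sum>j\<le>n. (fps_const a $ j * h ^ j) $ n) = (\<Sum>j\<le>n. if j = 0 then a $ n else 0)"
    by (intro sum.cong) auto
  then show "eval_last h (fps_const a) $ n = a $ n" by (simp add: eval_last_def)
qed

lemma eval_last_X [simp]: "h $ 0 = 0 \<Longrightarrow> eval_last h fps_X = h"
proof (rule fps_ext)
  fix n assume h: "h $ 0 = 0"
  have "(\<Sum>j\<le>n. (fps_X $ j * h ^ j) $ n) = (\<Sum>j\<le>n. if j = 1 then h $ n else 0)"
    by (intro sum.cong) auto
  then show "eval_last h fps_X $ n = h $ n" using h by (cases n) (auto simp: eval_last_def)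
qed

text \<open>
  Splitting off the part without \<open>y\<close> makes the divisibility of \<open>P(h) - P(0)\<close> by \<open>h\<close> visible.
\<close>

lemma eval_last_split:
  assumes h: "h $ 0 = 0"
  shows "eval_last h P = P $ 0 + h * eval_last h (fps_shift 1 P)"
proof -
  have "P = fps_const (P $ 0) + fps_X * fps_shift 1 P"
    by (auto simp: fps_eq_iff fps_mult_fps_X_commute)
  from arg_cong[OF this, of "eval_last h"] show ?thesis
    using h by (simp add: ring_mapD[OF ring_map_eval_last[OF h]])
qed

definition fps_coeffwise :: "('r::comm_ring_1 \<Rightarrow> 's::comm_ring_1) \<Rightarrow> 'r fps \<Rightarrow> 's fps" where
  "fps_coeffwise f P = Abs_fps (\<lambda>n. f (P $ n))"

lemma fps_coeffwise_nth [simp]: "fps_coeffwise f P $ n = f (P $ n)"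
  by (simp add: fps_coeffwise_def)

lemma ring_map_coeffwise: "ring_map f \<Longrightarrow> ring_map (fps_coeffwise f)"
  unfolding ring_map_def[of "fps_coeffwise f"]
  by (auto simp: fps_eq_iff fps_mult_nth ring_mapD)

lemma fps_coeffwise_const: "ring_map f \<Longrightarrow> fps_coeffwise f (fps_const a) = fps_const (f a)"
  by (auto simp: fps_eq_iff ring_mapD)

lemma fps_coeffwise_X: "ring_map f \<Longrightarrow> fps_coeffwise f fps_X = fps_X"
  by (auto simp: fps_eq_iff fps_X_def ring_mapD)

lemma ring_map_fps_const: "ring_map fps_const"
  by (auto simp: ring_map_def)

text \<open>
  Composition is substitution into a series with constant coefficients, and thereby a ring
  homomorphism over every commutative ring.
\<close>

lemma fps_compose_eq_eval_last: "a oo g = eval_last g (fps_coeffwise fps_const a)"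
  by (auto simp: fps_eq_iff fps_compose_nth eval_last_def atLeast0AtMost)

lemma ring_map_compose: "g $ 0 = 0 \<Longrightarrow> ring_map (\<lambda>a. a oo g)"
  unfolding fps_compose_eq_eval_last
  by (intro ring_map_comp[of "fps_coeffwise fps_const" "eval_last g"] ring_map_eval_last ring_map_coeffwise ring_map_fps_const)

text \<open>
  A term \<open>g^i h^j\<close> with \<open>i \<ge> N\<close> or \<open>j \<ge> N\<close> is divisible by \<open>t^N\<close>.
\<close>

lemma subst1_cong:
  assumes g: "g $ 0 = 0" and h: "h $ 0 = 0"
  shows "fps_X ^ N dvd subst1 F g h - (\<Sum>i<N. \<Sum>j<N. fps_const (F $ j $ i) * (g ^ i * h ^ j))"
proof -
  have z: "(g ^ i * h ^ j) $ n = 0" if "n < i \<or> n < j" for i j n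
    using that dvd_mult2[OF fps_X_power_dvd_power[OF g, of i], of "h ^ j"]
      dvd_mult[OF fps_X_power_dvd_power[OF h, of j], of "g ^ i"]
    by (auto simp: fps_X_power_dvd_iff)
  have "(\<Sum>i\<le>n. \<Sum>j\<le>n. F $ j $ i * (g ^ i * h ^ j) $ n)
      = (\<Sum>i<N. \<Sum>j<N. F $ j $ i * (g ^ i * h ^ j) $ n)" if n: "n < N" for n
  proof -
    have "(\<Sum>i\<le>n. \<Sum>j\<le>n. F $ j $ i * (g ^ i * h ^ j) $ n)
      = (\<Sum>i\<le>n. \<Sum>j<N. F $ j $ i * (g ^ i * h ^ j) $ n)"
      using n by (intro sum.cong refl sum.mono_neutral_left) (auto simp: z)
    also have "\<dots> = (\<Sum>i<N. \<Sum>j<N. F $ j $ i * (g ^ i * h ^ j) $ n)"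
      using n by (intro sum.mono_neutral_left) (auto simp: z)
    finally show ?thesis .
  qed
  then show ?thesis by (simp add: fps_X_power_dvd_iff subst1_def fps_sum_nth)
qed

lemma fps_X_compose: "(g::'a::comm_ring_1 fps) $ 0 = 0 \<Longrightarrow> fps_X oo g = g"
  by (simp add: fps_compose_eq_eval_last fps_coeffwise_X ring_map_fps_const)

text \<open>
  The value \<open>F(g,h)\<close> as an iterated substitution in one variable. In this form it is a ring
  homomorphism in \<open>F\<close>; \<open>subst1_eq_eval2\<close> identifies it with \<open>subst1\<close>.
\<close>

definition eval2 :: "'a::comm_ring_1 fps \<Rightarrow> 'a fps \<Rightarrow> 'a fps fps \<Rightarrow> 'a fps" where
  "eval2 g h P = eval_last h (fps_coeffwise (\<lambda>a. a oo g) P)"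

lemma ring_map_eval2:
  assumes "g $ 0 = 0" "h $ 0 = 0"
  shows "ring_map (eval2 g h)"
  using ring_map_comp[OF ring_map_coeffwise[OF ring_map_compose[OF assms(1)]] ring_map_eval_last[OF assms(2)]]
  by (simp add: eval2_def[abs_def])

lemma subst1_eq_eval2:
  assumes g: "g $ 0 = 0" and h: "h $ 0 = 0"
  shows "subst1 F g h = eval2 g h F"
proof (rule fps_eq_if_cong)
  fix N
  have c: "fps_X ^ N dvd (a oo g) - (\<Sum>i<N. fps_const (a $ i) * g ^ i)" for a
    using eval_last_cong[OF g, of N "fps_coeffwise fps_const a"] by (simp add: fps_compose_eq_eval_last)
  let ?s = "\<Sum>j<N. (F $ j oo g) * h ^ j"
  let ?t = "\<Sum>i<N. \<Sum>j<N. fps_const (F $ j $ i) * (g ^ i * h ^ j)"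
  have "?s - ?t = (\<Sum>j<N. ((F $ j oo g) - (\<Sum>i<N. fps_const (F $ j $ i) * g ^ i)) * h ^ j)"
    by (subst sum.swap) (simp add: algebra_simps sum_subtractf sum_distrib_left sum_distrib_right)
  then have 1: "fps_X ^ N dvd ?s - ?t" using c by (simp add: dvd_sum)
  have 2: "fps_X ^ N dvd eval2 g h F - ?s"
    using eval_last_cong[OF h, of N "fps_coeffwise (\<lambda>a. a oo g) F"] by (simp add: eval2_def)
  have e: "subst1 F g h - eval2 g h F
    = (subst1 F g h - ?t) - (?s - ?t) - (eval2 g h F - ?s)"
    by simp
  show "fps_X ^ N dvd subst1 F g h - eval2 g h F"
    by (subst e, intro dvd_diff 1 2 subst1_cong g h)
qed

lemma subst1_nth_0: "subst1 F g h $ 0 = F $ 0 $ 0"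
  by (simp add: subst1_def)

text \<open>
  Composition with \<open>k\<close> is a ring homomorphism that maps multiples of \<open>t^N\<close> to multiples of \<open>t^N\<close>, so it
  may be applied to the finite sum that \<open>F(g,h)\<close> is modulo \<open>t^N\<close>.
\<close>

lemma subst1_compose:
  assumes g: "g $ 0 = 0" and h: "h $ 0 = 0" and k: "k $ 0 = 0"
  shows "subst1 F g h oo k = subst1 F (g oo k) (h oo k)"
proof (rule fps_eq_if_cong)
  fix N
  note rm = ring_map_compose[OF k]
  have "fps_X oo k = k" by (simp add: fps_X_compose k)
  moreover have "fps_X ^ N oo k dvd (subst1 F g h - (\<Sum>i<N. \<Sum>j<N. fps_const (F $ j $ i) * (g ^ i * h ^ j))) oo k"
    using ring_map_dvd[OF rm subst1_cong[OF g h]] .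
  ultimately have "k ^ N dvd (subst1 F g h oo k)
     - (\<Sum>i<N. \<Sum>j<N. fps_const (F $ j $ i) * ((g oo k) ^ i * (h oo k) ^ j))"
    by (simp add: ring_mapD[OF rm])
  then have 1: "fps_X ^ N dvd (subst1 F g h oo k)
     - (\<Sum>i<N. \<Sum>j<N. fps_const (F $ j $ i) * ((g oo k) ^ i * (h oo k) ^ j))"
    using fps_X_power_dvd_power[OF k] dvd_trans by blast
  have 2: "fps_X ^ N dvd subst1 F (g oo k) (h oo k)
     - (\<Sum>i<N. \<Sum>j<N. fps_const (F $ j $ i) * ((g oo k) ^ i * (h oo k) ^ j))"
    by (rule subst1_cong) (use g h in auto)
  show "fps_X ^ N dvd (subst1 F g h oo k) - subst1 F (g oo k) (h oo k)"
    using dvd_diff[OF 1 2] by simp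
qed

section \<open>Evaluation of series in three variables\<close>

definition eval3 :: "'a::comm_ring_1 fps \<Rightarrow> 'a fps \<Rightarrow> 'a fps \<Rightarrow> 'a fps fps fps \<Rightarrow> 'a fps" where
  "eval3 g h k H = eval_last k (fps_coeffwise (eval2 g h) H)"

text \<open>
  Order with respect to the total degree: the sums in \<open>subst3\<close> are finite modulo series of high order.
\<close>

definition has_order3 :: "nat \<Rightarrow> 'a::comm_ring_1 fps fps fps \<Rightarrow> bool" where
  "has_order3 m H \<longleftrightarrow> (\<forall>a b c. a + b + c < m \<longrightarrow> H $ c $ b $ a = 0)"

lemma has_order3_mult:
  assumes "has_order3 m G" "has_order3 n H"
  shows "has_order3 (m + n) (G * H)"
  unfolding has_order3_def
proof (intro allI impI)
  fix a b c assume l: "a + b + c < m + n"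
  have "G $ c' $ b' $ a' * H $ (c - c') $ (b - b') $ (a - a') = 0"
    if "c' \<le> c" "b' \<le> b" "a' \<le> a" for a' b' c'
  proof (cases "a' + b' + c' < m")
    case False
    then have "(a - a') + (b - b') + (c - c') < n" using l that by linarith
    then show ?thesis using assms(2) by (simp add: has_order3_def)
  qed (use assms(1) in \<open>simp add: has_order3_def\<close>)
  then show "(G * H) $ c $ b $ a = 0"
    by (simp add: fps_mult_nth fps_sum_nth)
qed

lemma has_order3_power: "has_order3 1 H \<Longrightarrow> has_order3 n (H ^ n)"
proof (induction n)
  case 0 then show ?case by (simp add: has_order3_def)
next
  case (Suc n) then show ?case using has_order3_mult[of 1 H n "H ^ n"] by simp
qed

lemma fps_X_power_dvd_mult_power:
  fixes k :: "'a::comm_ring_1 fps"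
  assumes "k $ 0 = 0" "fps_X ^ (N - c) dvd a"
  shows "fps_X ^ N dvd a * k ^ c"
proof -
  have "fps_X ^ (N - c) * fps_X ^ c dvd a * k ^ c"
    by (intro mult_dvd_mono fps_X_power_dvd_power assms)
  moreover have "fps_X ^ N dvd fps_X ^ (N - c + c)" by (rule le_imp_power_dvd) simp
  ultimately show ?thesis by (metis power_add dvd_trans)
qed

lemma fps_X_power_dvd_eval_last:
  assumes k: "k $ 0 = 0" and "\<And>c. c < N \<Longrightarrow> fps_X ^ (N - c) dvd P $ c"
  shows "fps_X ^ N dvd eval_last k P"
proof -
  have "fps_X ^ N dvd (\<Sum>c<N. P $ c * k ^ c)"
    using assms by (intro dvd_sum fps_X_power_dvd_mult_power) auto
  from dvd_add[OF eval_last_cong[OF k, of N P] this] show ?thesis by simp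
qed

text \<open>
  Evaluation is continuous: a monomial of total degree \<open>N\<close> in series without constant term is
  divisible by \<open>t^N\<close>.
\<close>

lemma fps_X_power_dvd_eval3:
  assumes z: "g $ 0 = 0" "h $ 0 = 0" "k $ 0 = 0" and H: "has_order3 N H"
  shows "fps_X ^ N dvd eval3 g h k H"
  unfolding eval3_def eval2_def fps_compose_eq_eval_last
proof (rule fps_X_power_dvd_eval_last[OF z(3)], unfold fps_coeffwise_nth,
    rule fps_X_power_dvd_eval_last[OF z(2)], unfold fps_coeffwise_nth,
    rule fps_X_power_dvd_eval_last[OF z(1)], unfold fps_coeffwise_nth)
  fix a b c assume "c < N" "b < N - c" "a < N - c - b"
  with H have "H $ c $ b $ a = 0" by (simp add: has_order3_def)
  then show "fps_X ^ (N - c - b - a) dvd fps_const (H $ c $ b $ a)" by simp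
qed

lemma ring_map_eval3:
  assumes z: "g $ 0 = 0" "h $ 0 = 0" "k $ 0 = 0"
  shows "ring_map (eval3 g h k)"
  using ring_map_comp[OF ring_map_coeffwise[OF ring_map_eval2[OF z(1,2)]] ring_map_eval_last[OF z(3)]]
  by (simp add: eval3_def[abs_def])

lemma eval3_vars:
  assumes z: "g $ 0 = 0" "h $ 0 = 0" "k $ 0 = 0"
  shows "eval3 g h k var_x = g" "eval3 g h k var_y = h" "eval3 g h k var_z = k"
    "eval3 g h k (fps_const (fps_const (fps_const a))) = fps_const a"
proof -
  have c: "eval3 g h k (fps_const P) = eval2 g h P" for P
    by (simp add: eval3_def fps_coeffwise_const ring_map_eval2 z)
  have c2: "eval2 g h (fps_const a) = a oo g" for a
    by (simp add: eval2_def fps_coeffwise_const ring_map_compose z)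
  show "eval3 g h k (fps_const (fps_const (fps_const a))) = fps_const a"
    by (simp add: c c2)
  show "eval3 g h k var_x = g" by (simp add: c c2 fps_X_compose z)
  show "eval3 g h k var_y = h" by (simp add: c eval2_def fps_coeffwise_X ring_map_compose z)
  show "eval3 g h k var_z = k" by (simp add: eval3_def fps_coeffwise_X ring_map_eval2 z)
qed

text \<open>
  Up to a series of order \<open>N\<close>, \<open>F(G,H)\<close> is a polynomial in \<open>G\<close> and \<open>H\<close>, with which the ring homomorphism
  \<open>eval3\<close> commutes; the remainder evaluates to a multiple of \<open>t^N\<close>.
\<close>

lemma eval3_subst3:
  assumes z: "g $ 0 = 0" "h $ 0 = 0" "k $ 0 = 0"
    and G: "has_order3 1 G" and H: "has_order3 1 H"
  shows "eval3 g h k (subst3 F G H) = subst1 F (eval3 g h k G) (eval3 g h k H)"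
proof (rule fps_eq_if_cong)
  fix N
  note rm = ring_map_eval3[OF z]
  let ?s = "\<Sum>i<N. \<Sum>j<N. fps_const (fps_const (fps_const (F $ j $ i))) * (G ^ i * H ^ j)"
  have v: "(G ^ i * H ^ j) $ c $ b $ a = 0" if "a + b + c < i \<or> a + b + c < j" for i j a b c
    using has_order3_mult[OF has_order3_power[OF G, of i] has_order3_power[OF H, of j]] that
    by (auto simp: has_order3_def)
  have "has_order3 N (subst3 F G H - ?s)"
    unfolding has_order3_def
  proof (intro allI impI)
    fix a b c assume l: "a + b + c < N"
    have "(\<Sum>i\<le>a+b+c. \<Sum>j\<le>a+b+c. F $ j $ i * (G ^ i * H ^ j) $ c $ b $ a)
      = (\<Sum>i\<le>a+b+c. \<Sum>j<N. F $ j $ i * (G ^ i * H ^ j) $ c $ b $ a)"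
      using l by (intro sum.cong refl sum.mono_neutral_left) (auto simp: v)
    also have "\<dots> = (\<Sum>i<N. \<Sum>j<N. F $ j $ i * (G ^ i * H ^ j) $ c $ b $ a)"
      using l by (intro sum.mono_neutral_left) (auto simp: v)
    finally show "(subst3 F G H - ?s) $ c $ b $ a = 0"
      by (simp add: subst3_def fps_sum_nth)
  qed
  from fps_X_power_dvd_eval3[OF z this]
  have 1: "fps_X ^ N dvd eval3 g h k (subst3 F G H)
     - (\<Sum>i<N. \<Sum>j<N. fps_const (F $ j $ i) * (eval3 g h k G ^ i * eval3 g h k H ^ j))"
    by (simp add: ring_mapD[OF rm] eval3_vars[OF z])
  have "fps_X ^ 1 dvd eval3 g h k G" "fps_X ^ 1 dvd eval3 g h k H"
    using fps_X_power_dvd_eval3[OF z G] fps_X_power_dvd_eval3[OF z H] by auto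
  then have "eval3 g h k G $ 0 = 0" "eval3 g h k H $ 0 = 0"
    unfolding fps_X_power_dvd_iff by auto
  from dvd_diff[OF 1 subst1_cong[OF this, of N F]]
  show "fps_X ^ N dvd eval3 g h k (subst3 F G H) - subst1 F (eval3 g h k G) (eval3 g h k H)"
    by simp
qed

section \<open>Formal group laws\<close>

text \<open>
  The axiom is an identity of series in three variables. Evaluating it at \<open>(g,h,k)\<close> gives associativity
  of the formal sum of power series, the form in which it is used below.
\<close>

lemma fgl_assoc:
  assumes F: "formal_group_law F" and z: "g $ 0 = 0" "h $ 0 = 0" "k $ 0 = 0"
  shows "subst1 F (subst1 F g h) k = subst1 F g (subst1 F h k)"
proof -
  have o: "has_order3 1 var_x" "has_order3 1 var_y" "has_order3 1 var_z"
    by (auto simp: has_order3_def)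
  have F0: "F $ 0 $ 0 = 0" using F by (simp add: formal_group_law_def)
  have s: "has_order3 1 (subst3 F G H)" for G H
    using F0 by (simp add: has_order3_def subst3_def)
  have "eval3 g h k (subst3 F (subst3 F var_x var_y) var_z)
      = eval3 g h k (subst3 F var_x (subst3 F var_y var_z))"
    using F by (simp add: formal_group_law_def)
  then show ?thesis by (simp only: eval3_subst3[OF z] s o eval3_vars[OF z])
qed

text \<open>
  If \<open>e = x + c x^m + ...\<close> with \<open>m \<ge> 2\<close>, then \<open>e o e = x + 2 c x^m + ...\<close>, so that \<open>c = 0\<close>.
\<close>

lemma idempotent_tangent_to_identity:
  fixes e :: "'a::comm_ring_1 fps"
  assumes e: "e $ 0 = 0" "e $ 1 = 1" and i: "e oo e = e"
  shows "e = fps_X"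
proof -
  define d where "d = e - fps_X"
  have "fps_X oo e = e" by (simp add: fps_X_compose e)
  then have de: "d oo e = 0" using i by (simp add: d_def ring_mapD[OF ring_map_compose[OF e(1)]])
  have "d $ n = 0" for n
  proof (induction n rule: less_induct)
    case (less n)
    have "0 = (\<Sum>j=0..n. d $ j * (e ^ j) $ n)" using de by (metis fps_compose_nth fps_zero_nth)
    also have "\<dots> = (\<Sum>j=0..n. if j = n then d $ n else 0)"
      using less startsby_zero_power_nth_same[OF e(1), of n] e(2) by (intro sum.cong) auto
    finally show ?case by simp
  qed
  then show ?thesis by (simp add: d_def fps_eq_iff)
qed

text \<open>
  The axioms do not contain \<open>F(x,0) = x\<close>. But \<open>F(F(x,0),0) = F(x,F(0,0)) = F(x,0)\<close>, so \<open>F(x,0)\<close> is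
  idempotent under composition, and likewise \<open>F(0,y)\<close>.
\<close>

lemma fgl_unit:
  assumes F: "formal_group_law F"
  shows "F $ 0 = fps_X" and "g $ 0 = 0 \<Longrightarrow> subst1 F g 0 = g" and "g $ 0 = 0 \<Longrightarrow> subst1 F 0 g = g"
proof -
  have F': "F $ 0 $ 0 = 0" "F $ 0 $ 1 = 1" "F $ 1 $ 0 = 1" using F by (auto simp: formal_group_law_def)
  have r: "subst1 F g 0 = F $ 0 oo g" if "g $ 0 = 0" for g
    using that eval_last_split[of 0 "fps_coeffwise (\<lambda>a. a oo g) F"] by (simp add: subst1_eq_eval2 eval2_def)
  have 00: "subst1 F 0 0 = 0" using r[of 0] F' by (auto simp: fps_eq_iff fps_compose_nth power_0_left if_distrib cong: if_cong)
  show X: "F $ 0 = fps_X"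
    using fgl_assoc[OF F, of fps_X 0 0] r[of fps_X] r[of "F $ 0"] F' 00
    by (intro idempotent_tangent_to_identity) auto
  show "subst1 F g 0 = g" if "g $ 0 = 0"
    using r[OF that] X that by (simp add: fps_X_compose)
  \<comment> \<open>the series \<open>F(0,y)\<close>\<close>
  define e where "e = Abs_fps (\<lambda>j. F $ j $ 0)"
  have l: "subst1 F 0 g = e oo g" if "g $ 0 = 0" for g
  proof -
    have "a oo 0 = fps_const (a $ 0)" for a :: "'a fps"
      using eval_last_split[of 0 "fps_coeffwise fps_const a"] by (simp add: fps_compose_eq_eval_last)
    then have "fps_coeffwise (\<lambda>a. a oo 0) F = fps_coeffwise fps_const e"
      by (simp add: fps_eq_iff e_def)
    then show ?thesis using that by (simp add: subst1_eq_eval2 eval2_def fps_compose_eq_eval_last)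
  qed
  have "e = fps_X"
    using fgl_assoc[OF F, of 0 0 fps_X] l[of fps_X] l[of e] F' 00
    by (intro idempotent_tangent_to_identity) (auto simp: e_def)
  then show "subst1 F 0 g = g" if "g $ 0 = 0"
    using l[OF that] that by (simp add: fps_X_compose)
qed

lemma fgl_sum_eq_add_mult:
  assumes F: "formal_group_law F" and z: "g $ 0 = 0" "h $ 0 = 0"
  shows "\<exists>G. subst1 F g h = g + h * G"
proof -
  have "fps_X oo g = g" using z by (simp add: fps_X_compose)
  then show ?thesis
    using eval_last_split[OF z(2), of "fps_coeffwise (\<lambda>a. a oo g) F"] fgl_unit(1)[OF F]
    by (auto simp: subst1_eq_eval2 eval2_def z)
qed

lemma nseries_nth_0 [simp]: "formal_group_law F \<Longrightarrow> nseries F n $ 0 = 0"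
  by (cases n) (auto simp: subst1_nth_0 formal_group_law_def)

lemma nseries_eq_bracket: "formal_group_law F \<Longrightarrow> nseries F n = fps_X * bracket F n"
  by (auto simp: bracket_def fps_eq_iff fps_mult_fps_X_commute)

lemma fps_X_cancel: "fps_X * a = fps_X * b \<longleftrightarrow> a = (b :: 'a::comm_ring_1 fps)"
  by (metis fps_shift_times_fps_X' mult.commute)

lemma nseries_add:
  assumes F: "formal_group_law F"
  shows "nseries F (m + n) = subst1 F (nseries F m) (nseries F n)"
  by (induction n) (simp_all add: fgl_unit[OF F] fgl_assoc[OF F] F)

lemma nseries_mult:
  assumes F: "formal_group_law F"
  shows "nseries F (m * n) = nseries F m oo nseries F n"
proof (induction m)
  case 0 show ?case by simp
next
  case (Suc m)
  have "nseries F (Suc m * n) = nseries F (m * n + n)" by (simp add: add.commute)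
  also have "\<dots> = nseries F (Suc m) oo nseries F n"
    by (simp add: nseries_add[OF F] Suc subst1_compose F fps_X_compose)
  finally show ?case .
qed

lemma bracket_0 [simp]: "bracket F 0 = 0"
  by (simp add: bracket_def)

lemma bracket_1 [simp]: "formal_group_law F \<Longrightarrow> bracket F (Suc 0) = 1"
  by (simp add: bracket_def fgl_unit(3))

text \<open>
  This is \<open>F(x,y) = x + y G(x,y)\<close> at \<open>x = [m](t)\<close>, \<open>y = [n](t)\<close>, divided by \<open>t\<close>.
\<close>

lemma bracket_add:
  assumes F: "formal_group_law F"
  shows "\<exists>G. bracket F (m + n) = bracket F m + bracket F n * G"
proof -
  obtain G where "nseries F (m + n) = nseries F m + nseries F n * G"
    using fgl_sum_eq_add_mult[OF F, of "nseries F m" "nseries F n"] F by (auto simp: nseries_add)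
  then have "fps_X * bracket F (m + n) = fps_X * (bracket F m + bracket F n * G)"
    by (simp add: nseries_eq_bracket[OF F] algebra_simps)
  then show ?thesis unfolding fps_X_cancel by blast
qed

text \<open>
  From \<open>[mn] = [m] o [n]\<close> and \<open>[m](s) = s \<langle>m\<rangle>(s)\<close> at \<open>s = [n](t) = t \<langle>n\<rangle>\<close>.
\<close>

lemma bracket_mult:
  assumes F: "formal_group_law F"
  shows "bracket F (m * n) = bracket F n * frob F n (bracket F m)"
proof -
  have "fps_X * bracket F (m * n) = (fps_X * bracket F m) oo nseries F n"
    by (simp add: nseries_eq_bracket[OF F, symmetric] nseries_mult[OF F])
  also have "\<dots> = fps_X * (bracket F n * frob F n (bracket F m))"
    using F by (simp add: ring_mapD(3)[OF ring_map_compose] fps_X_compose frob_def)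
      (simp add: nseries_eq_bracket mult_ac)
  finally show ?thesis unfolding fps_X_cancel .
qed

lemma ring_map_frob: "formal_group_law F \<Longrightarrow> ring_map (frob F n)"
  using ring_map_compose[of "nseries F n"] by (simp add: frob_def[abs_def])

lemma bracket_nth_0:
  assumes F: "formal_group_law F"
  shows "bracket F n $ 0 = of_nat n"
proof (induction n)
  case (Suc n)
  have "bracket F (Suc n) $ 0 = subst1 F (nseries F n) fps_X $ 1" by (simp add: bracket_def)
  also have "\<dots> = nseries F n $ 1 + 1"
    using F by (simp add: subst1_def formal_group_law_def numeral_2_eq_2 fps_mult_nth)
  also have "nseries F n $ 1 = of_nat n" using Suc by (simp add: bracket_def)
  finally show ?case by simp
qed simp

lemma bracket_eq_of_nat_plus:
  assumes F: "formal_group_law F"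
  shows "\<exists>g. bracket F n = of_nat n + fps_X * g"
proof -
  have "bracket F n = fps_const (bracket F n $ 0) + fps_X * fps_shift 1 (bracket F n)"
    by (auto simp: fps_eq_iff fps_mult_fps_X_commute)
  then show ?thesis by (metis bracket_nth_0[OF F] fps_of_nat)
qed

text \<open>
  The constant term of \<open>\<langle>p\<rangle>\<close> is \<open>p\<close>, and \<open>\<phi>(t) = [p](t)\<close> is a multiple of \<open>\<langle>p\<rangle>\<close>.
\<close>

lemma frob_bracket_self:
  assumes F: "formal_group_law F"
  shows "\<exists>s. frob F p (bracket F p) = of_nat p + bracket F p * s"
proof -
  obtain g where "bracket F p = of_nat p + fps_X * g" using bracket_eq_of_nat_plus[OF F] by blast
  then have "frob F p (bracket F p) = frob F p (fps_const (of_nat p)) + frob F p fps_X * frob F p g"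
    by (simp add: ring_mapD[OF ring_map_frob[OF F]] fps_of_nat)
  also have "\<dots> = of_nat p + bracket F p * (fps_X * frob F p g)"
    by (simp add: frob_def fps_X_compose F) (simp add: nseries_eq_bracket[OF F] fps_of_nat mult_ac)
  finally show ?thesis by blast
qed

text \<open>
  Choose \<open>x\<close> and \<open>y\<close> with \<open>n x = 1 + p y\<close>. The bracket of \<open>n x\<close> is a multiple of \<open>\<langle>n\<rangle>\<close>, and that of \<open>1 + y p\<close>
  is \<open>1\<close> up to a multiple of \<open>\<langle>yp\<rangle>\<close>, hence of \<open>\<langle>p\<rangle>\<close>.
\<close>

lemma bracket_coprime_unit:
  assumes F: "formal_group_law F" and n: "coprime n p" "n \<noteq> 0"
  shows "\<exists>m s. bracket F n * m = 1 + bracket F p * s"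
proof -
  obtain x y where xy: "n * x = p * y + 1" using bezout_nat[OF n(2), of p] n(1) by auto
  obtain G where "bracket F (1 + y * p) = bracket F 1 + bracket F (y * p) * G"
    using bracket_add[OF F] by blast
  then have "bracket F (x * n) = 1 + bracket F p * (frob F p (bracket F y) * G)"
    using xy F bracket_mult[OF F, of y p] by (simp add: mult_ac)
  then show ?thesis unfolding bracket_mult[OF F, of x n] by blast
qed

lemma bracket_fact_0 [simp]: "bracket_fact F 0 = 1"
  by (simp add: bracket_fact_def)

lemma bracket_fact_Suc: "bracket_fact F (Suc n) = bracket F (Suc n) * bracket_fact F n"
  by (simp add: bracket_fact_def mult.commute)

text \<open>
  Pascal's recursion for the binomial coefficients of the brackets: with \<open>\<langle>m + n\<rangle> = \<langle>m\<rangle> + \<langle>n\<rangle> G\<close>,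
  the factorial of \<open>m + n\<close> is \<open>\<langle>m\<rangle> (m+n-1)! + \<langle>n\<rangle> (m+n-1)! G\<close>, and induction applies to both summands.
\<close>

lemma bracket_fact_mult_dvd:
  assumes F: "formal_group_law F"
  shows "bracket_fact F m * bracket_fact F n dvd bracket_fact F (m + n)"
proof (induction "m + n" arbitrary: m n)
  case (Suc k)
  show ?case
  proof (cases "m = 0 \<or> n = 0")
    case False
    then obtain i j where ij: "m = Suc i" "n = Suc j" by (metis not0_implies_Suc)
    have k: "k = i + n" "k = m + j" using Suc(2) ij by auto
    obtain G where G: "bracket F (m + n) = bracket F m + bracket F n * G"
      using bracket_add[OF F] by blast
    have "bracket_fact F m * bracket_fact F n dvd bracket F m * bracket_fact F (i + n)"
      using Suc(1)[OF k(1)] by (simp add: ij(1) bracket_fact_Suc mult.assoc mult_dvd_mono)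
    moreover have "bracket_fact F m * bracket_fact F n dvd bracket F n * bracket_fact F (m + j)"
      using Suc(1)[OF k(2)] by (metis (no_types) bracket_fact_Suc ij(2) mult.left_commute mult_dvd_mono dvd_refl)
    moreover have "bracket_fact F (m + n) = bracket F m * bracket_fact F k + bracket F n * bracket_fact F k * G"
      using bracket_fact_Suc[of F k] Suc(2) G by (simp add: algebra_simps)
    ultimately show ?thesis using k by (metis dvd_add dvd_mult2)
  qed auto
qed auto

section \<open>Cohomology of cochain complexes\<close>

text \<open>
  The module axioms see only the carrier, zero, addition and scalar multiplication. This transports
  them to records with another multiplicative part.
\<close>

lemma module_cong:
  assumes "module B M" "carrier M' = carrier M" "zero M' = zero M" "add M' = add M"
    "module.smult M' = module.smult M"
  shows "module B M'"
proof -
  interpret module B M by fact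
  have "\<exists>y\<in>carrier M. y \<oplus>\<^bsub>M\<^esub> x = \<zero>\<^bsub>M\<^esub>" if "x \<in> carrier M" for x
    using that M.l_neg M.a_inv_closed by blast
  then have "abelian_group M'"
    by (intro abelian_groupI) (auto simp: assms(2-4) M.a_ac)
  then show ?thesis
    by (intro moduleI R.is_cring)
       (simp_all add: assms(2-5) smult_l_distr smult_r_distr smult_assoc1)
qed

lemma (in abelian_group) coset_eq_iff:
  assumes N: "additive_subgroup N G" and "x \<in> carrier G" "y \<in> carrier G"
  shows "N +> x = N +> y \<longleftrightarrow> (\<exists>n\<in>N. x = n \<oplus> y)"
proof -
  have s: "subgroup N (add_monoid G)" using N by (rule additive_subgroup.a_subgroup)
  have "x \<in> N +> x"
    using abelian_subgroup.a_rcos_self[OF abelian_subgroupI3[OF N abelian_group_axioms]] assms by blast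
  then have "N +> x = N +> y \<longleftrightarrow> x \<in> N +> y"
    using a_repr_independence[OF _ assms(3) s] by blast
  then show ?thesis by (auto simp: a_r_coset_def r_coset_def)
qed

text \<open>
  The criterion by which cohomology modules are identified below: every coset has exactly one
  representative among the values of \<open>h\<close>.
\<close>

lemma quot_module_iso:
  assumes M: "module B M" and N: "submodule N B M" and h: "h \<in> mod_hom B P M"
    and inj: "\<And>x y n. x \<in> carrier P \<Longrightarrow> y \<in> carrier P \<Longrightarrow> n \<in> N \<Longrightarrow> h x = n \<oplus>\<^bsub>M\<^esub> h y \<Longrightarrow> x = y"
    and surj: "\<And>m. m \<in> carrier M \<Longrightarrow> \<exists>x\<in>carrier P. \<exists>n\<in>N. m = n \<oplus>\<^bsub>M\<^esub> h x"
  shows "(\<lambda>x. N +>\<^bsub>M\<^esub> h x) \<in> mod_iso B P (quot_module M N)"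
proof -
  interpret module B M by fact
  have N': "additive_subgroup N M"
    using N by (simp add: additive_subgroup_def submodule_def)
  interpret abelian_subgroup N M
    by (rule abelian_subgroupI3[OF N' M.abelian_group_axioms])
  have hc: "h x \<in> carrier M" if "x \<in> carrier P" for x
    using h that by (auto simp: mod_hom_def)
  have sm: "(\<Union>x\<in>N +>\<^bsub>M\<^esub> m. N +>\<^bsub>M\<^esub> (r \<odot>\<^bsub>M\<^esub> x)) = N +>\<^bsub>M\<^esub> (r \<odot>\<^bsub>M\<^esub> m)"
    if r: "r \<in> carrier B" and m: "m \<in> carrier M" for r m
  proof -
    have "N +>\<^bsub>M\<^esub> (r \<odot>\<^bsub>M\<^esub> x) = N +>\<^bsub>M\<^esub> (r \<odot>\<^bsub>M\<^esub> m)" if x: "x \<in> N +>\<^bsub>M\<^esub> m" for x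
    proof -
      obtain n where n: "n \<in> N" "x = n \<oplus>\<^bsub>M\<^esub> m" using x by (auto simp: a_r_coset_def r_coset_def)
      have nc: "n \<in> carrier M" using n a_subset by blast
      have "r \<odot>\<^bsub>M\<^esub> x = (r \<odot>\<^bsub>M\<^esub> n) \<oplus>\<^bsub>M\<^esub> (r \<odot>\<^bsub>M\<^esub> m)"
        using n nc r m by (simp add: smult_r_distr)
      moreover have "r \<odot>\<^bsub>M\<^esub> n \<in> N" using submoduleE(4)[OF N] r n by blast
      ultimately show ?thesis using M.coset_eq_iff[OF N'] r m n nc by auto
    qed
    moreover have "m \<in> N +>\<^bsub>M\<^esub> m" using a_rcos_self m by blast
    ultimately show ?thesis by blast
  qed
  have "bij_betw (\<lambda>x. N +>\<^bsub>M\<^esub> h x) (carrier P) (a_rcosets\<^bsub>M\<^esub> N)"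
    unfolding bij_betw_def
  proof
    show "inj_on (\<lambda>x. N +>\<^bsub>M\<^esub> h x) (carrier P)"
      by (rule inj_onI) (metis M.coset_eq_iff[OF N'] hc inj)
    have "N +>\<^bsub>M\<^esub> m \<in> (\<lambda>x. N +>\<^bsub>M\<^esub> h x) ` carrier P" if "m \<in> carrier M" for m
      using surj[OF that] M.coset_eq_iff[OF N'] hc that by (metis image_eqI)
    then show "(\<lambda>x. N +>\<^bsub>M\<^esub> h x) ` carrier P = a_rcosets\<^bsub>M\<^esub> N"
      using hc by (auto simp: A_RCOSETS_def' a_rcosetsI a_subset image_iff)
  qed
  then show ?thesis
    using h hc sm by (auto simp: mod_iso_def mod_hom_def quot_module_def a_rcos_sum a_rcosetsI a_subset)
qed

text \<open>
  The criterion for a map induced on quotients, in the form in which \<open>cohom_map\<close> is defined.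
\<close>

lemma bij_betw_cosets:
  assumes M: "abelian_group M" and N: "additive_subgroup N M"
    and M': "abelian_group M'" and N': "additive_subgroup N' M'"
    and u: "u \<in> carrier M \<rightarrow> carrier M'"
    and add: "\<And>x y. x \<in> carrier M \<Longrightarrow> y \<in> carrier M \<Longrightarrow> u (x \<oplus>\<^bsub>M\<^esub> y) = u x \<oplus>\<^bsub>M'\<^esub> u y"
    and sub: "\<And>n. n \<in> N \<Longrightarrow> u n \<in> N'"
    and inj: "\<And>x y n. x \<in> carrier M \<Longrightarrow> y \<in> carrier M \<Longrightarrow> n \<in> N' \<Longrightarrow> u x = n \<oplus>\<^bsub>M'\<^esub> u y \<Longrightarrow>
       \<exists>n\<in>N. x = n \<oplus>\<^bsub>M\<^esub> y"
    and surj: "\<And>m. m \<in> carrier M' \<Longrightarrow> \<exists>x\<in>carrier M. \<exists>n\<in>N'. m = n \<oplus>\<^bsub>M'\<^esub> u x"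
  shows "bij_betw (\<lambda>U. \<Union>z\<in>U. N' +>\<^bsub>M'\<^esub> u z) (a_rcosets\<^bsub>M\<^esub> N) (a_rcosets\<^bsub>M'\<^esub> N')"
proof -
  interpret M: abelian_subgroup N M by (rule abelian_subgroupI3[OF N M])
  interpret M': abelian_subgroup N' M' by (rule abelian_subgroupI3[OF N' M'])
  have uc: "u x \<in> carrier M'" if "x \<in> carrier M" for x using u that by blast
  have e: "(\<Union>z\<in>N +>\<^bsub>M\<^esub> x. N' +>\<^bsub>M'\<^esub> u z) = N' +>\<^bsub>M'\<^esub> u x" if x: "x \<in> carrier M" for x
  proof -
    have "N' +>\<^bsub>M'\<^esub> u z = N' +>\<^bsub>M'\<^esub> u x" if z: "z \<in> N +>\<^bsub>M\<^esub> x" for z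
    proof -
      obtain n where n: "n \<in> N" "z = n \<oplus>\<^bsub>M\<^esub> x" using z by (auto simp: a_r_coset_def r_coset_def)
      have nc: "n \<in> carrier M" using n M.a_subset by blast
      then show ?thesis
        using n x add[OF nc x] sub[OF n(1)] uc M'.coset_eq_iff[OF N'] by (metis M.a_closed M.add.m_closed)
    qed
    moreover have "x \<in> N +>\<^bsub>M\<^esub> x" using M.a_rcos_self x by blast
    ultimately show ?thesis by blast
  qed
  have rc: "a_rcosets\<^bsub>M\<^esub> N = (\<lambda>x. N +>\<^bsub>M\<^esub> x) ` carrier M" "a_rcosets\<^bsub>M'\<^esub> N' = (\<lambda>x. N' +>\<^bsub>M'\<^esub> x) ` carrier M'"
    by (auto simp: A_RCOSETS_def')
  show ?thesis
    unfolding bij_betw_def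
  proof
    show "inj_on (\<lambda>U. \<Union>z\<in>U. N' +>\<^bsub>M'\<^esub> u z) (a_rcosets\<^bsub>M\<^esub> N)"
      unfolding rc
    proof (rule inj_onI, clarify)
      fix x y assume xy: "x \<in> carrier M" "y \<in> carrier M"
        "(\<Union>z\<in>N +>\<^bsub>M\<^esub> x. N' +>\<^bsub>M'\<^esub> u z) = (\<Union>z\<in>N +>\<^bsub>M\<^esub> y. N' +>\<^bsub>M'\<^esub> u z)"
      then have "N' +>\<^bsub>M'\<^esub> u x = N' +>\<^bsub>M'\<^esub> u y" by (simp add: e)
      then obtain n where "n \<in> N'" "u x = n \<oplus>\<^bsub>M'\<^esub> u y"
        unfolding M'.coset_eq_iff[OF N' uc[OF xy(1)] uc[OF xy(2)]] by blast
      then show "N +>\<^bsub>M\<^esub> x = N +>\<^bsub>M\<^esub> y"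
        unfolding M.coset_eq_iff[OF N xy(1,2)] using inj[OF xy(1,2)] by blast
    qed
    have "N' +>\<^bsub>M'\<^esub> m \<in> (\<lambda>x. N' +>\<^bsub>M'\<^esub> u x) ` carrier M" if "m \<in> carrier M'" for m
      using surj[OF that] M'.coset_eq_iff[OF N'] uc that by (metis image_eqI)
    then have "(\<lambda>x. N' +>\<^bsub>M'\<^esub> u x) ` carrier M = (\<lambda>x. N' +>\<^bsub>M'\<^esub> x) ` carrier M'"
      using uc by (auto simp: image_iff)
    then show "(\<lambda>U. \<Union>z\<in>U. N' +>\<^bsub>M'\<^esub> u z) ` (a_rcosets\<^bsub>M\<^esub> N) = a_rcosets\<^bsub>M'\<^esub> N'"
      unfolding rc by (simp add: image_image e)
  qed
qed

definition cochain_complex :: "('b, 'k) ring_scheme \<Rightarrow> ('b, 'm) cochain \<Rightarrow> bool" where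
  "cochain_complex B C \<longleftrightarrow> (\<forall>i. module B (cmod C i) \<and>
     cdiff C i \<in> mod_hom B (cmod C i) (cmod C (Suc i)) \<and>
     (\<forall>z\<in>carrier (cmod C i). cdiff C (Suc i) (cdiff C i z) = \<zero>\<^bsub>cmod C (Suc (Suc i))\<^esub>))"

lemma mod_hom_zero:
  assumes M: "module B M" and N: "module B N" and h: "h \<in> mod_hom B M N"
  shows "h \<zero>\<^bsub>M\<^esub> = \<zero>\<^bsub>N\<^esub>"
proof -
  interpret M: module B M by fact
  interpret N: module B N by fact
  have "h (r \<odot>\<^bsub>M\<^esub> x) = r \<odot>\<^bsub>N\<^esub> h x" "h x \<in> carrier N" if "r \<in> carrier B" "x \<in> carrier M" for r x
    using h that by (auto simp: mod_hom_def)
  from this[of "\<zero>\<^bsub>B\<^esub>" "\<zero>\<^bsub>M\<^esub>"] show ?thesis by simp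
qed

lemma (in module) submoduleI':
  assumes "H \<subseteq> carrier M" "\<zero>\<^bsub>M\<^esub> \<in> H"
    "\<And>a b. a \<in> H \<Longrightarrow> b \<in> H \<Longrightarrow> a \<oplus>\<^bsub>M\<^esub> b \<in> H"
    "\<And>a x. a \<in> carrier R \<Longrightarrow> x \<in> H \<Longrightarrow> a \<odot>\<^bsub>M\<^esub> x \<in> H"
  shows "submodule H R M"
proof (rule submoduleI)
  fix a assume a: "a \<in> H"
  then have ac: "a \<in> carrier M" using assms(1) by blast
  have "(\<ominus> \<one>) \<odot>\<^bsub>M\<^esub> a = \<ominus>\<^bsub>M\<^esub> a" using ac smult_l_minus[of \<one> a] by simp
  then show "\<ominus>\<^bsub>M\<^esub> a \<in> H" using assms(4)[of "\<ominus> \<one>" a] a by simp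
qed (use assms in auto)

lemma submodule_vimage:
  assumes M: "module B M" and N: "module B N" and h: "h \<in> mod_hom B M N" and K: "submodule K B N"
    and H: "submodule H B M"
  shows "submodule {z \<in> H. h z \<in> K} B M"
proof -
  interpret M: module B M by fact
  interpret N: module B N by fact
  note K' = N.submoduleE[OF K] and H' = M.submoduleE[OF H]
  have z: "\<zero>\<^bsub>M\<^esub> \<in> H" "\<zero>\<^bsub>N\<^esub> \<in> K"
    using H K by (auto simp: submodule_def subgroup_def)
  show ?thesis
    using h H'(1) mod_hom_zero[OF M N h] z
    by (intro M.submoduleI') (auto simp: mod_hom_def K' H' subset_iff)
qed

lemma submodule_image:
  assumes M: "module B M" and N: "module B N" and h: "h \<in> mod_hom B M N"
  shows "submodule (h ` carrier M) B N"
proof -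
  interpret M: module B M by fact
  interpret N: module B N by fact
  have a: "h x \<oplus>\<^bsub>N\<^esub> h y = h (x \<oplus>\<^bsub>M\<^esub> y)" if "x \<in> carrier M" "y \<in> carrier M" for x y
    using h that by (simp add: mod_hom_def)
  have s: "r \<odot>\<^bsub>N\<^esub> h x = h (r \<odot>\<^bsub>M\<^esub> x)" if "x \<in> carrier M" "r \<in> carrier B" for x r
    using h that by (simp add: mod_hom_def)
  show ?thesis
  proof (rule N.submoduleI')
    show "\<zero>\<^bsub>N\<^esub> \<in> h ` carrier M" using mod_hom_zero[OF M N h] by (metis M.zero_closed image_eqI)
    show "h ` carrier M \<subseteq> carrier N" using h by (auto simp: mod_hom_def)
  qed (auto simp: a s)
qed

lemma submodule_zero: "module B M \<Longrightarrow> submodule {\<zero>\<^bsub>M\<^esub>} B M"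
proof -
  assume "module B M" then interpret module B M .
  show ?thesis by (rule submoduleI') auto
qed

lemma submodule_multiples:
  assumes "module B M" "f \<in> carrier B"
  shows "submodule (multiples f M) B M"
proof -
  interpret module B M by fact
  have "(\<lambda>m. f \<odot>\<^bsub>M\<^esub> m) \<in> mod_hom B M M"
    using assms(2) by (auto simp: mod_hom_def smult_r_distr smult_assoc1[symmetric] R.m_comm)
  then show ?thesis unfolding multiples_def by (intro submodule_image assms)
qed

lemma submodule_subset:
  assumes "module B M" "submodule H B M" "submodule K B M" "K \<subseteq> H"
  shows "submodule K B (M\<lparr>carrier := H\<rparr>)"
proof -
  interpret M: module B M by fact
  interpret H: module B "M\<lparr>carrier := H\<rparr>"
    using submodule.submodule_is_module[OF assms(2,1)] .
  show ?thesis
    using assms(4) M.submoduleE[OF assms(3)] assms(3)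
    by (intro H.submoduleI') (auto simp: submodule_def subgroup_def)
qed

lemma cohomology_modules:
  assumes C: "cochain_complex B C"
  shows "module B ((cmod C i)\<lparr>carrier := cocycles C i\<rparr>)"
    "submodule (coboundaries C i) B ((cmod C i)\<lparr>carrier := cocycles C i\<rparr>)"
proof -
  have m: "\<And>i. module B (cmod C i)" and d: "\<And>i. cdiff C i \<in> mod_hom B (cmod C i) (cmod C (Suc i))"
    using C by (auto simp: cochain_complex_def)
  have dc: "cdiff C i z \<in> carrier (cmod C (Suc i))" if "z \<in> carrier (cmod C i)" for i z
    using d[of i] that by (auto simp: mod_hom_def)
  have Z: "submodule (cocycles C i) B (cmod C i)"
    using submodule_vimage[OF m m d submodule_zero[OF m] module.carrier_is_submodule[OF m]]
    by (simp add: cocycles_def)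
  show "module B ((cmod C i)\<lparr>carrier := cocycles C i\<rparr>)"
    using submodule.submodule_is_module[OF Z m] .
  show "submodule (coboundaries C i) B ((cmod C i)\<lparr>carrier := cocycles C i\<rparr>)"
  proof (rule submodule_subset[OF m Z])
    show "submodule (coboundaries C i) B (cmod C i)"
      using m d by (auto simp: coboundaries_def submodule_zero intro!: submodule_image split: nat.split)
    show "coboundaries C i \<subseteq> cocycles C i"
    proof (cases i)
      case 0
      interpret module B "cmod C 0" by (rule m)
      show ?thesis using mod_hom_zero[OF m m d, of 0] 0 by (auto simp: coboundaries_def cocycles_def)
    next
      case (Suc j)
      then show ?thesis using C dc by (auto simp: coboundaries_def cocycles_def cochain_complex_def)
    qed
  qed
qed

lemma cohomology_groups:
  assumes "cochain_complex B C"
  shows "abelian_group ((cmod C i)\<lparr>carrier := cocycles C i\<rparr>)"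
    "additive_subgroup (coboundaries C i) ((cmod C i)\<lparr>carrier := cocycles C i\<rparr>)"
  using cohomology_modules[OF assms, of i]
  by (auto simp: module_def submodule_def additive_subgroup_def)

text \<open>
  A cohomology module is computed by giving cocycles that represent each class exactly once.
\<close>

lemma cohom_class_iso:
  assumes C: "cochain_complex B C" and h: "h \<in> mod_hom B P (cmod C i)"
    and cl: "\<And>x. x \<in> carrier P \<Longrightarrow> cdiff C i (h x) = \<zero>\<^bsub>cmod C (Suc i)\<^esub>"
    and inj: "\<And>x y n. x \<in> carrier P \<Longrightarrow> y \<in> carrier P \<Longrightarrow> n \<in> coboundaries C i \<Longrightarrow>
       h x = n \<oplus>\<^bsub>cmod C i\<^esub> h y \<Longrightarrow> x = y"
    and surj: "\<And>m. m \<in> cocycles C i \<Longrightarrow> \<exists>x\<in>carrier P. \<exists>n\<in>coboundaries C i. m = n \<oplus>\<^bsub>cmod C i\<^esub> h x"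
  shows "(\<lambda>x. cohom_class C i (h x)) \<in> mod_iso B P (cohomology C i)"
proof -
  have "h \<in> mod_hom B P ((cmod C i)\<lparr>carrier := cocycles C i\<rparr>)"
    using h cl by (auto simp: mod_hom_def cocycles_def)
  from quot_module_iso[OF cohomology_modules[OF C] this] inj surj
  show ?thesis by (simp add: cohomology_def cohom_class_def a_r_coset_def r_coset_def)
qed

lemma quasi_isoI:
  assumes C: "cochain_complex B C" and D: "cochain_complex B D" and u: "cochain_map B C D u"
    and inj: "\<And>i x y n. x \<in> cocycles C i \<Longrightarrow> y \<in> cocycles C i \<Longrightarrow> n \<in> coboundaries D i \<Longrightarrow>
       u i x = n \<oplus>\<^bsub>cmod D i\<^esub> u i y \<Longrightarrow> \<exists>n\<in>coboundaries C i. x = n \<oplus>\<^bsub>cmod C i\<^esub> y"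
    and surj: "\<And>i m. m \<in> cocycles D i \<Longrightarrow> \<exists>x\<in>cocycles C i. \<exists>n\<in>coboundaries D i. m = n \<oplus>\<^bsub>cmod D i\<^esub> u i x"
  shows "quasi_iso B C D u"
proof -
  have mC: "\<And>i. module B (cmod C i)" and mD: "\<And>i. module B (cmod D i)"
    using C D by (auto simp: cochain_complex_def)
  have um: "\<And>i. u i \<in> mod_hom B (cmod C i) (cmod D i)"
    and ud: "\<And>i z. z \<in> carrier (cmod C i) \<Longrightarrow> u (Suc i) (cdiff C i z) = cdiff D i (u i z)"
    using u by (auto simp: cochain_map_def)
  note ag = cohomology_groups
  have "bij_betw (cohom_map D u i) (carrier (cohomology C i)) (carrier (cohomology D i))" for i
  proof -
    have uz: "u i \<in> cocycles C i \<rightarrow> cocycles D i"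
    proof
      fix z assume z: "z \<in> cocycles C i"
      then have "cdiff D i (u i z) = u (Suc i) \<zero>\<^bsub>cmod C (Suc i)\<^esub>"
        using ud[of z i] by (simp add: cocycles_def)
      also have "\<dots> = \<zero>\<^bsub>cmod D (Suc i)\<^esub>" by (rule mod_hom_zero[OF mC mD um])
      finally show "u i z \<in> cocycles D i"
        using um[of i] z by (auto simp: cocycles_def mod_hom_def)
    qed
    have ub: "u i n \<in> coboundaries D i" if n: "n \<in> coboundaries C i" for n
    proof (cases i)
      case 0 then show ?thesis using n mod_hom_zero[OF mC mD um] by (auto simp: coboundaries_def)
    next
      case (Suc j)
      then obtain z where "z \<in> carrier (cmod C j)" "n = cdiff C j z" using n by (auto simp: coboundaries_def)
      then show ?thesis using ud[of z j] um[of j] Suc by (auto simp: coboundaries_def mod_hom_def)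
    qed
    let ?M = "(cmod C i)\<lparr>carrier := cocycles C i\<rparr>" and ?M' = "(cmod D i)\<lparr>carrier := cocycles D i\<rparr>"
    have "bij_betw (\<lambda>U. \<Union>z\<in>U. coboundaries D i +>\<^bsub>?M'\<^esub> u i z)
        (a_rcosets\<^bsub>?M\<^esub> coboundaries C i) (a_rcosets\<^bsub>?M'\<^esub> coboundaries D i)"
    proof (rule bij_betw_cosets[OF ag[OF C] ag[OF D]])
      show "u i \<in> carrier ?M \<rightarrow> carrier ?M'" using uz by simp
      show "u i (x \<oplus>\<^bsub>?M\<^esub> y) = u i x \<oplus>\<^bsub>?M'\<^esub> u i y" if "x \<in> carrier ?M" "y \<in> carrier ?M" for x y
        using um[of i] that by (simp add: mod_hom_def cocycles_def)
      show "\<exists>n\<in>coboundaries C i. x = n \<oplus>\<^bsub>?M\<^esub> y" if "x \<in> carrier ?M" "y \<in> carrier ?M"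
        "n \<in> coboundaries D i" "u i x = n \<oplus>\<^bsub>?M'\<^esub> u i y" for x y n
        using inj[of x i y n] that by simp
      show "\<exists>x\<in>carrier ?M. \<exists>n\<in>coboundaries D i. m = n \<oplus>\<^bsub>?M'\<^esub> u i x" if "m \<in> carrier ?M'" for m
        using surj[of m i] that by simp
    qed (rule ub)
    then show ?thesis
      unfolding cohom_map_def[abs_def] cohom_class_def cohomology_def quot_module_def a_r_coset_def r_coset_def
      by simp
  qed
  then show ?thesis using u by (simp add: quasi_iso_def)
qed

lemma cochain_complex_eta:
  assumes C: "cochain_complex B C" and f: "f \<in> carrier B"
  shows "cochain_complex B (eta B f C)"
proof -
  have m: "\<And>i. module B (cmod C i)" and d: "\<And>i. cdiff C i \<in> mod_hom B (cmod C i) (cmod C (Suc i))"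
    using C by (auto simp: cochain_complex_def)
  interpret B: cring B using module.axioms(1)[OF m[of 0]] .
  let ?E = "\<lambda>i. {z \<in> multiples (f [^]\<^bsub>B\<^esub> i) (cmod C i). cdiff C i z \<in> multiples (f [^]\<^bsub>B\<^esub> Suc i) (cmod C (Suc i))}"
  have s: "submodule (?E i) B (cmod C i)" for i
    by (rule submodule_vimage[OF m m d submodule_multiples[OF m] submodule_multiples[OF m]])
      (use f in simp_all)
  have E: "z \<in> carrier (cmod C i)" if "z \<in> ?E i" for i z
    using module.submoduleE(1)[OF m s, of i] that by (rule subsetD)
  have z: "\<zero>\<^bsub>cmod C i\<^esub> \<in> multiples (f [^]\<^bsub>B\<^esub> i) (cmod C i)" for i
    using submodule_multiples[OF m, of "f [^]\<^bsub>B\<^esub> i" i] f by (auto simp: submodule_def subgroup_def)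
  have "cdiff C i z \<in> ?E (Suc i)" if "z \<in> ?E i" for i z
    using z[of "Suc (Suc i)"] C E[OF that] that by (auto simp: cochain_complex_def)
  then have dE: "cdiff C i \<in> ?E i \<rightarrow> ?E (Suc i)" for i by blast
  have "cdiff C i \<in> mod_hom B (cmod (eta B f C) i) (cmod (eta B f C) (Suc i))" for i
    using d[of i] dE[of i] E[of _ i] unfolding mod_hom_def eta_def by (simp del: nat_pow_Suc)
  moreover have "module B (cmod (eta B f C) i)" for i
    using submodule.submodule_is_module[OF s m] by (simp add: eta_def)
  moreover have "cdiff C (Suc i) (cdiff C i z) = \<zero>\<^bsub>cmod C (Suc (Suc i))\<^esub>" if "z \<in> ?E i" for i z
    using C E[OF that] by (simp add: cochain_complex_def)
  ultimately show ?thesis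
    by (simp add: cochain_complex_def eta_def del: nat_pow_Suc)
qed

section \<open>The complexes \<open>B[x] \<rightarrow> B[x] dx\<close>\<close>

context cring begin

lemma poly_module_simps:
  "carrier (poly_module R) = up R" "zero (poly_module R) = (\<lambda>i. \<zero>)"
  "p \<in> up R \<Longrightarrow> q \<in> up R \<Longrightarrow> p \<oplus>\<^bsub>poly_module R\<^esub> q = (\<lambda>i. p i \<oplus> q i)"
  "a \<in> carrier R \<Longrightarrow> p \<in> up R \<Longrightarrow> a \<odot>\<^bsub>poly_module R\<^esub> p = (\<lambda>i. a \<otimes> p i)"
  by (simp_all add: poly_module_def module.defs UP_def)

lemma module_poly_module: "module R (poly_module R)"
proof -
  interpret UP_cring R "UP R" by unfold_locales
  have "module R (UP R)" using UP_algebra by (simp add: algebra_def)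
  then show ?thesis by (rule module_cong) (simp_all add: poly_module_def module.defs)
qed

lemma up_I: "(\<And>n. g n \<in> carrier R) \<Longrightarrow> (\<And>n. N < n \<Longrightarrow> g n = \<zero>) \<Longrightarrow> g \<in> up R"
  by (auto simp: up_def bound_def)

lemma up_E:
  assumes "g \<in> up R"
  obtains N where "\<And>n. g n \<in> carrier R" "\<And>n. N < n \<Longrightarrow> g n = \<zero>"
  using assms by (auto simp: up_def bound_def)

lemma FOmega_simps:
  "cmod (FOmega F R \<psi>) 0 = poly_module R" "cmod (FOmega F R \<psi>) (Suc 0) = poly_module R"
  "cmod (FOmega F R \<psi>) (Suc (Suc i)) = (poly_module R)\<lparr>carrier := {\<lambda>_. \<zero>}\<rparr>"
  "cdiff (FOmega F R \<psi>) 0 = (\<lambda>g n. \<psi> (bracket F (Suc n)) \<otimes> g (Suc n))"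
  "cdiff (FOmega F R \<psi>) (Suc i) = (\<lambda>_ _. \<zero>)"
  by (simp_all add: FOmega_def UP_def weighted_deriv_def[abs_def])

lemma zero_up: "(\<lambda>_. \<zero>) \<in> up R" by (rule up_I) auto

lemma weighted_up:
  assumes c: "\<And>n. c n \<in> carrier R" and g: "g \<in> up R"
  shows "(\<lambda>n. c n \<otimes> g (Suc n)) \<in> up R"
proof -
  obtain N where N: "\<And>n. g n \<in> carrier R" "\<And>n. N < n \<Longrightarrow> g n = \<zero>" using g by (rule up_E) auto
  then show ?thesis using c by (intro up_I[of _ N]) auto
qed

lemma cochain_complex_FOmega:
  assumes c: "\<And>n. \<psi> (bracket F n) \<in> carrier R"
  shows "cochain_complex R (FOmega F R \<psi>)"
proof -
  let ?C = "FOmega F R \<psi>"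
  have Z: "module R ((poly_module R)\<lparr>carrier := {\<lambda>_. \<zero>}\<rparr>)"
    using submodule.submodule_is_module[OF submodule_zero[OF module_poly_module] module_poly_module]
    by (simp add: poly_module_simps)
  have m: "module R (cmod ?C i)" for i
  proof (cases i)
    case (Suc j)
    then show ?thesis using Z module_poly_module by (cases j) (auto simp: FOmega_simps)
  qed (simp add: FOmega_simps module_poly_module)
  have zz: "(\<lambda>_ _. \<zero>) \<in> mod_hom R M ((poly_module R)\<lparr>carrier := {\<lambda>_. \<zero>}\<rparr>)" for M :: "('a, nat \<Rightarrow> 'a) module"
    using zero_up by (auto simp: mod_hom_def poly_module_simps)
  have d0: "cdiff ?C 0 \<in> mod_hom R (cmod ?C 0) (cmod ?C (Suc 0))"
    using c weighted_up[of "\<lambda>n. \<psi> (bracket F (Suc n))"] mem_upD[of _ R]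
    by (auto simp: mod_hom_def FOmega_simps poly_module_simps up_add_closed up_smult_closed r_distr m_lcomm)
  have d: "cdiff ?C i \<in> mod_hom R (cmod ?C i) (cmod ?C (Suc i))" for i
  proof (cases i)
    case 0 then show ?thesis using d0 by simp
  next
    case (Suc j) then show ?thesis using zz by (simp add: FOmega_simps)
  qed
  show ?thesis
    unfolding cochain_complex_def using m d by (auto simp: FOmega_simps poly_module_simps)
qed

lemma cocycles_FOmega:
  "cocycles (FOmega F R \<psi>) 0 = {g \<in> up R. \<forall>n. \<psi> (bracket F (Suc n)) \<otimes> g (Suc n) = \<zero>}"
  "cocycles (FOmega F R \<psi>) (Suc 0) = up R"
  "cocycles (FOmega F R \<psi>) (Suc (Suc i)) = {\<lambda>_. \<zero>}"
  by (auto simp: cocycles_def FOmega_simps poly_module_simps fun_eq_iff)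

lemma coboundaries_FOmega:
  "coboundaries (FOmega F R \<psi>) 0 = {\<lambda>_. \<zero>}"
  "coboundaries (FOmega F R \<psi>) (Suc 0) = (\<lambda>g n. \<psi> (bracket F (Suc n)) \<otimes> g (Suc n)) ` up R"
  "coboundaries (FOmega F R \<psi>) (Suc (Suc i)) = {\<lambda>_. \<zero>}"
proof -
  show "coboundaries (FOmega F R \<psi>) (Suc (Suc i)) = {\<lambda>_. \<zero>}"
    using zero_up by (cases i) (auto simp: coboundaries_def FOmega_simps poly_module_simps)
qed (auto simp: coboundaries_def FOmega_simps poly_module_simps)

end

lemma dvd_Suc_iff_mod:
  fixes p :: nat
  assumes p: "0 < p" shows "p dvd Suc n \<longleftrightarrow> n mod p = p - 1"
  using p by (metis Suc_pred' dvd_eq_mod_eq_0 mod_Suc nat.inject mod_less_divisor One_nat_def Suc_diff_1 nat.distinct(1))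

text \<open>
  The polynomial \<open>x^r g(x^p)\<close>.
\<close>

definition poly_spread :: "('b, 'k) ring_scheme \<Rightarrow> nat \<Rightarrow> nat \<Rightarrow> (nat \<Rightarrow> 'b) \<Rightarrow> nat \<Rightarrow> 'b" where
  "poly_spread B p r g = (\<lambda>m. if m mod p = r then g (m div p) else \<zero>\<^bsub>B\<^esub>)"

lemma poly_spread_nth: "r < p \<Longrightarrow> poly_spread B p r g (n * p + r) = g n"
  by (simp add: poly_spread_def)

context cring begin

lemma poly_spread_up:
  assumes "r < p" "g \<in> up R" shows "poly_spread R p r g \<in> up R"
proof -
  obtain N where N: "\<And>n. g n \<in> carrier R" "\<And>n. N < n \<Longrightarrow> g n = \<zero>" using assms(2) by (rule up_E) auto
  show ?thesis
  proof (rule up_I[of _ "N * p + r"])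
    fix n assume "N * p + r < n"
    moreover have "n = n div p * p + n mod p" by simp
    ultimately have "N < n div p" if "n mod p = r" using that assms(1) by (metis add_less_cancel_right mult_less_cancel2)
    then show "poly_spread R p r g n = \<zero>" using N(2) by (simp add: poly_spread_def)
  qed (use N(1) in \<open>simp add: poly_spread_def\<close>)
qed

lemma poly_spread_hom:
  assumes "r < p" shows "poly_spread R p r \<in> mod_hom R (poly_module R) (poly_module R)"
  using poly_spread_up[OF assms] by (auto simp: mod_hom_def poly_module_simps) (auto simp: poly_spread_def)

lemma poly_spread_inj:
  assumes "r < p" "poly_spread R p r g = poly_spread R p r g'" shows "g = g'"
  by (metis assms poly_spread_nth ext)

lemma up_reindex:
  assumes "0 < p" "g \<in> up R" shows "(\<lambda>n. g (n * p + r)) \<in> up R"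
proof -
  obtain N where N: "\<And>n. g n \<in> carrier R" "\<And>n. N < n \<Longrightarrow> g n = \<zero>" using assms(2) by (rule up_E) auto
  have "N < n * p + r" if "N < n" for n
    using that assms(1) by (metis less_le_trans le_add1 trans_le_add1 mult_le_mono2 Suc_leI nat_mult_1_right One_nat_def)
  then show ?thesis using N by (intro up_I[of _ N]) auto
qed

lemma poly_spread_monom:
  assumes "r < p" "a \<in> carrier R"
  shows "poly_spread R p r (xpow R a n) = xpow R a (n * p + r)"
  using assms by (auto simp: poly_spread_def UP_def fun_eq_iff)

lemma cocycle_eq_poly_spread:
  assumes cu: "\<And>n. \<not> p dvd n \<Longrightarrow> c n \<in> Units R"
    and z: "z \<in> up R" "\<And>n. c (Suc n) \<otimes> z (Suc n) = \<zero>"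
  shows "z = poly_spread R p 0 (\<lambda>n. z (n * p + 0))"
proof -
  have "z n = \<zero>" if "\<not> p dvd n" for n
  proof -
    obtain m where "n = Suc m" using \<open>\<not> p dvd n\<close> by (cases n) auto
    then show ?thesis using z(2)[of m] cu[OF that] mem_upD[OF z(1), of n]
      by (metis Units_closed Units_l_cancel r_null zero_closed)
  qed
  then show ?thesis by (auto simp: poly_spread_def fun_eq_iff mod_eq_0_iff_dvd)
qed

text \<open>
  The differential kills the \<open>x^(np)\<close> and maps every other \<open>x^n\<close> to a unit multiple of \<open>x^(n-1) dx\<close>. The
  monomials \<open>x^(np)\<close> therefore span the kernel, and the forms \<open>x^(np+p-1) dx\<close> a complement of the image.
\<close>

lemma FOmega_mod_iso:
  assumes p: "0 < p" and c: "\<And>n. \<psi> (bracket F n) \<in> carrier R"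
    and c0: "\<And>n. \<psi> (bracket F (n * p)) = \<zero>"
    and cu: "\<And>n. \<not> p dvd n \<Longrightarrow> \<psi> (bracket F n) \<in> Units R"
  defines "C \<equiv> FOmega F R \<psi>"
  shows "\<exists>h. (\<forall>i. h i \<in> mod_iso R (cmod C i) (cohomology C i)) \<and>
    (\<forall>n. h 0 (xpow R \<one> n) = cohom_class C 0 (xpow R \<one> (n * p))) \<and>
    (\<forall>n. h 1 (xpow R \<one> n) = cohom_class C 1 (xpow R \<one> (n * p + (p - 1))))"
proof -
  let ?K = "FOmega F R \<psi>"
  note C = cochain_complex_FOmega[of \<psi> F, OF c]
  have c0': "\<psi> (bracket F n) = \<zero>" if "p dvd n" for n using that c0 by (metis dvd_def mult.commute)
  have 0: "(\<lambda>g. cohom_class C 0 (poly_spread R p 0 g)) \<in> mod_iso R (cmod C 0) (cohomology C 0)"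
    unfolding C_def
  proof (rule cohom_class_iso[OF C])
    show "poly_spread R p 0 \<in> mod_hom R (cmod ?K 0) (cmod ?K 0)"
      using poly_spread_hom[OF p] by (simp add: FOmega_simps)
    fix g assume "g \<in> carrier (cmod ?K 0)"
    then have g: "g \<in> up R" by (simp add: FOmega_simps poly_module_simps)
    show "cdiff ?K 0 (poly_spread R p 0 g) = \<zero>\<^bsub>cmod ?K (Suc 0)\<^esub>"
      using c mem_upD[OF g] by (auto simp: FOmega_simps poly_module_simps fun_eq_iff poly_spread_def c0' mod_eq_0_iff_dvd)
    fix g' n assume "g' \<in> carrier (cmod ?K 0)" "n \<in> coboundaries ?K 0"
      "poly_spread R p 0 g = n \<oplus>\<^bsub>cmod ?K 0\<^esub> poly_spread R p 0 g'"
    then have "poly_spread R p 0 g = poly_spread R p 0 g'"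
      using poly_spread_up[OF p, of g'] zero_up mem_upD[OF poly_spread_up[OF p]]
      by (simp add: FOmega_simps poly_module_simps coboundaries_FOmega)
    then show "g = g'" by (rule poly_spread_inj[OF p])
  next
    fix z assume "z \<in> cocycles ?K 0"
    then have z: "z \<in> up R" "\<And>n. \<psi> (bracket F (Suc n)) \<otimes> z (Suc n) = \<zero>"
      by (auto simp: cocycles_FOmega)
    have zc: "\<And>n. z n \<in> carrier R" using z(1) by blast
    have "z = poly_spread R p 0 (\<lambda>n. z (n * p + 0))" by (rule cocycle_eq_poly_spread[OF cu z])
    moreover note up_reindex[OF p z(1), of 0] zero_up poly_spread_up[OF p up_reindex[OF p z(1), of 0]]
    ultimately show "\<exists>x\<in>carrier (cmod ?K 0). \<exists>n\<in>coboundaries ?K 0.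
        z = n \<oplus>\<^bsub>cmod ?K 0\<^esub> poly_spread R p 0 x"
      using zc by (rule_tac bexI[of _ "\<lambda>n. z (n * p + 0)"], rule_tac bexI[of _ "\<lambda>_. \<zero>"])
        (simp_all add: FOmega_simps coboundaries_FOmega poly_module_simps)
  qed
  have p1: "p - 1 < p" using p by simp
  note dv = dvd_Suc_iff_mod[OF p]
  have 1: "(\<lambda>g. cohom_class C 1 (poly_spread R p (p - 1) g)) \<in> mod_iso R (cmod C 1) (cohomology C 1)"
    unfolding C_def One_nat_def
  proof (rule cohom_class_iso[OF C])
    show "poly_spread R p (p - Suc 0) \<in> mod_hom R (cmod ?K (Suc 0)) (cmod ?K (Suc 0))"
      using poly_spread_hom[OF p1] by (simp add: FOmega_simps)
    show "cdiff ?K (Suc 0) (poly_spread R p (p - Suc 0) g) = \<zero>\<^bsub>cmod ?K (Suc (Suc 0))\<^esub>" for g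
      by (simp add: FOmega_simps poly_module_simps)
    fix g g' w assume "g \<in> carrier (cmod ?K (Suc 0))" "g' \<in> carrier (cmod ?K (Suc 0))"
      and w: "w \<in> coboundaries ?K (Suc 0)"
      and e: "poly_spread R p (p - Suc 0) g = w \<oplus>\<^bsub>cmod ?K (Suc 0)\<^esub> poly_spread R p (p - Suc 0) g'"
    then have g: "g \<in> up R" "g' \<in> up R" by (auto simp: FOmega_simps poly_module_simps)
    obtain z where z: "z \<in> up R" "w = (\<lambda>n. \<psi> (bracket F (Suc n)) \<otimes> z (Suc n))"
      using w by (auto simp: coboundaries_FOmega)
    have wu: "w \<in> up R" unfolding z(2) by (rule weighted_up[OF c z(1)])
    have e': "poly_spread R p (p - 1) g n = w n \<oplus> poly_spread R p (p - 1) g' n" for n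
      using e wu poly_spread_up[OF p1 g(2)] by (simp add: FOmega_simps poly_module_simps fun_eq_iff)
    show "g = g'"
    proof
      fix n
      have "p dvd Suc (n * p + (p - 1))" using p by (simp add: dv)
      then have "w (n * p + (p - 1)) = \<zero>" using z mem_upD[OF z(1)] by (simp add: c0')
      then show "g n = g' n"
        using e'[of "n * p + (p - 1)"] mem_upD[OF g(2)] by (simp only: poly_spread_nth[OF p1] l_zero)
    qed
  next
    fix m assume "m \<in> cocycles ?K (Suc 0)"
    then have m: "m \<in> up R" by (simp add: cocycles_FOmega)
    then have mc: "m n \<in> carrier R" for n by blast
    \<comment> \<open>a primitive of \<open>m\<close>, apart from the terms \<open>x^(np+p-1) dx\<close>\<close>
    define z where "z = (\<lambda>n. if p dvd n then \<zero> else inv (\<psi> (bracket F n)) \<otimes> m (n - 1))"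
    obtain N where N: "\<And>n. N < n \<Longrightarrow> m n = \<zero>" using m by (rule up_E) auto
    have iu: "inv (\<psi> (bracket F n)) \<in> carrier R" if "\<not> p dvd n" for n using cu[OF that] by blast
    have z: "z \<in> up R"
      using N mc iu by (intro up_I[of _ "Suc N"]) (auto simp: z_def)
    let ?d = "\<lambda>n. \<psi> (bracket F (Suc n)) \<otimes> z (Suc n)"
    have d: "?d n = (if n mod p = p - 1 then \<zero> else m n)" for n
    proof (cases "p dvd Suc n")
      case False
      then have "\<psi> (bracket F (Suc n)) \<otimes> (inv (\<psi> (bracket F (Suc n))) \<otimes> m n) = m n"
        using cu[OF False] mc by (simp add: m_assoc[symmetric] Units_closed)
      then show ?thesis using False by (simp add: z_def dv)
    qed (use c in \<open>simp add: z_def dv\<close>)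
    have g: "(\<lambda>n. m (n * p + (p - 1))) \<in> up R" by (rule up_reindex[OF p m])
    have s: "m n = ?d n \<oplus> poly_spread R p (p - 1) (\<lambda>n. m (n * p + (p - 1))) n" for n
    proof (cases "n mod p = p - 1")
      case True
      then have "n div p * p + (p - 1) = n" by (metis div_mult_mod_eq)
      then show ?thesis unfolding d using True mc by (simp add: poly_spread_def)
    qed (use mc in \<open>simp add: d poly_spread_def\<close>)
    show "\<exists>x\<in>carrier (cmod ?K (Suc 0)). \<exists>n\<in>coboundaries ?K (Suc 0).
        m = n \<oplus>\<^bsub>cmod ?K (Suc 0)\<^esub> poly_spread R p (p - Suc 0) x"
    proof (intro bexI)
      show "m = ?d \<oplus>\<^bsub>cmod ?K (Suc 0)\<^esub> poly_spread R p (p - Suc 0) (\<lambda>n. m (n * p + (p - 1)))"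
      proof -
        have "?d \<oplus>\<^bsub>cmod ?K (Suc 0)\<^esub> poly_spread R p (p - Suc 0) (\<lambda>n. m (n * p + (p - 1)))
          = (\<lambda>n. ?d n \<oplus> poly_spread R p (p - 1) (\<lambda>n. m (n * p + (p - 1))) n)"
          using weighted_up[OF c z, of Suc] poly_spread_up[OF p1 g] by (simp add: FOmega_simps poly_module_simps)
        also have "\<dots> = m" by (rule ext, rule s[symmetric])
        finally show ?thesis by (rule HOL.sym)
      qed
      show "?d \<in> coboundaries ?K (Suc 0)" using z by (auto simp: coboundaries_FOmega)
      show "(\<lambda>n. m (n * p + (p - 1))) \<in> carrier (cmod ?K (Suc 0))"
        using g by (simp add: FOmega_simps poly_module_simps)
    qed
  qed
  have 2: "(\<lambda>g. cohom_class C (Suc (Suc i)) g) \<in> mod_iso R (cmod C (Suc (Suc i))) (cohomology C (Suc (Suc i)))" for i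
    unfolding C_def
    by (rule cohom_class_iso[OF C])
      (use zero_up in \<open>auto simp: FOmega_simps poly_module_simps mod_hom_def coboundaries_FOmega cocycles_FOmega\<close>)
  let ?h = "\<lambda>i. if i = 0 then \<lambda>g. cohom_class C 0 (poly_spread R p 0 g)
    else if i = 1 then \<lambda>g. cohom_class C 1 (poly_spread R p (p - 1) g) else cohom_class C i"
  have "?h i \<in> mod_iso R (cmod C i) (cohomology C i)" for i
  proof (cases i)
    case (Suc j)
    then show ?thesis using 1 2 by (cases j) auto
  qed (use 0 in auto)
  then show ?thesis
    using p1 p by (intro exI[of _ ?h]) (simp add: poly_spread_monom)
qed


text \<open>
  Every form is closed, so \<open>\<eta>_f\<close> consists in degree one of all multiples of \<open>f\<close>.
\<close>

lemma eta_FOmega: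
  assumes c: "\<And>n. \<psi> (bracket F n) \<in> carrier R" and f: "f \<in> carrier R"
  defines "D \<equiv> eta R f (FOmega F R \<psi>)"
  shows "carrier (cmod D 0) = {z \<in> up R. \<exists>v\<in>up R. \<forall>n. \<psi> (bracket F (Suc n)) \<otimes> z (Suc n) = f \<otimes> v n}"
    "carrier (cmod D (Suc 0)) = (\<lambda>v n. f \<otimes> v n) ` up R"
    "carrier (cmod D (Suc (Suc i))) = {\<lambda>_. \<zero>}"
    "cocycles D 0 = {z \<in> up R. \<forall>n. \<psi> (bracket F (Suc n)) \<otimes> z (Suc n) = \<zero>}"
    "cocycles D (Suc 0) = (\<lambda>v n. f \<otimes> v n) ` up R"
    "cocycles D (Suc (Suc i)) = {\<lambda>_. \<zero>}"
    "coboundaries D 0 = {\<lambda>_. \<zero>}"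
    "coboundaries D (Suc 0) = (\<lambda>z n. \<psi> (bracket F (Suc n)) \<otimes> z (Suc n)) ` carrier (cmod D 0)"
    "coboundaries D (Suc (Suc i)) = {\<lambda>_. \<zero>}"
    "add (cmod D 0) = add (poly_module R)" "add (cmod D (Suc 0)) = add (poly_module R)"
    "add (cmod D (Suc (Suc i))) = add (poly_module R)"
    "zero (cmod D j) = (\<lambda>_. \<zero>)" "module.smult (cmod D j) = module.smult (poly_module R)"
    "cdiff D 0 = (\<lambda>g n. \<psi> (bracket F (Suc n)) \<otimes> g (Suc n))"
    "cdiff D (Suc i) = (\<lambda>_ _. \<zero>)"
proof -
  let ?P = "poly_module R" and ?Z = "(poly_module R)\<lparr>carrier := {\<lambda>_. \<zero>}\<rparr>"
  interpret P: module R ?P by (rule module_poly_module)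
  have m: "multiples a ?P = (\<lambda>v n. a \<otimes> v n) ` up R" if "a \<in> carrier R" for a
    using that by (auto simp: multiples_def poly_module_simps)
  have m1: "multiples \<one> ?P = up R" using mem_upD[of _ R] by (force simp: m)
  have mz: "multiples a ?Z = {\<lambda>_. \<zero>}" if "a \<in> carrier R" for a
    using that zero_up by (simp add: multiples_def poly_module_simps)
  have z: "(\<lambda>_. \<zero>) \<in> (\<lambda>v n. f \<otimes> v n) ` up R"
    using zero_up f by (force simp: image_iff)
  show c0: "carrier (cmod D 0) = {z \<in> up R. \<exists>v\<in>up R. \<forall>n. \<psi> (bracket F (Suc n)) \<otimes> z (Suc n) = f \<otimes> v n}"
    using f by (auto simp: D_def eta_def FOmega_simps m1 m image_iff fun_eq_iff)
  show c1: "carrier (cmod D (Suc 0)) = (\<lambda>v n. f \<otimes> v n) ` up R"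
    using f by (auto simp: D_def eta_def FOmega_simps m mz)
  show c2: "carrier (cmod D (Suc (Suc i))) = {\<lambda>_. \<zero>}" for i
    using f by (auto simp: D_def eta_def FOmega_simps mz)
  show zD: "zero (cmod D j) = (\<lambda>_. \<zero>)" for j
  proof (cases j)
    case (Suc k) then show ?thesis by (cases k) (simp_all add: D_def eta_def FOmega_simps poly_module_simps)
  qed (simp add: D_def eta_def FOmega_simps poly_module_simps)
  show "module.smult (cmod D j) = module.smult (poly_module R)"
  proof (cases j)
    case (Suc k) then show ?thesis by (cases k) (simp_all add: D_def eta_def FOmega_simps poly_module_simps)
  qed (simp add: D_def eta_def FOmega_simps poly_module_simps)
  show d: "cdiff D 0 = (\<lambda>g n. \<psi> (bracket F (Suc n)) \<otimes> g (Suc n))" "cdiff D (Suc i) = (\<lambda>_ _. \<zero>)" for i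
    by (simp_all add: D_def eta_def FOmega_simps)
  show "add (cmod D 0) = add (poly_module R)" "add (cmod D (Suc 0)) = add (poly_module R)"
    "add (cmod D (Suc (Suc i))) = add (poly_module R)"
    by (simp_all add: D_def eta_def FOmega_simps)
  show "cocycles D 0 = {z \<in> up R. \<forall>n. \<psi> (bracket F (Suc n)) \<otimes> z (Suc n) = \<zero>}"
    using zero_up f by (auto simp: cocycles_def c0 d zD fun_eq_iff intro!: bexI[of _ "\<lambda>_. \<zero>"])
  show "cocycles D (Suc 0) = (\<lambda>v n. f \<otimes> v n) ` up R" "cocycles D (Suc (Suc i)) = {\<lambda>_. \<zero>}"
    by (auto simp: cocycles_def c1 c2 d zD)
  show "coboundaries D 0 = {\<lambda>_. \<zero>}"
    "coboundaries D (Suc 0) = (\<lambda>z n. \<psi> (bracket F (Suc n)) \<otimes> z (Suc n)) ` carrier (cmod D 0)"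
    by (simp_all add: coboundaries_def zD d)
  show "coboundaries D (Suc (Suc i)) = {\<lambda>_. \<zero>}"
    using z by (cases i) (auto simp: coboundaries_def zD d c1 c2)
qed

text \<open>
  In the target, the coefficient of \<open>x^n\<close> is divisible by \<open>f\<close> if \<open>p\<close> does not divide \<open>n\<close>, and \<open>\<nabla>\<close> then maps
  \<open>f x^n\<close> to a unit multiple of \<open>f x^(n-1) dx\<close>: these exponents contribute nothing to the cohomology. On \<open>x^(kp)\<close>
  the differential is \<open>f\<close> times the coefficient of the source, and this \<open>f\<close> is the one in
  \<open>x^k dx \<mapsto> f x^(kp+p-1) dx\<close>. As \<open>f\<close> is regular, it can be cancelled.
\<close>

lemma FOmega_eta_quasi_iso:
  assumes p: "0 < p" and c: "\<And>n. \<psi> (bracket F n) \<in> carrier R" and c': "\<And>n. \<psi>' (bracket F n) \<in> carrier R"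
    and f: "f \<in> carrier R" and f_reg: "\<And>b. b \<in> carrier R \<Longrightarrow> f \<otimes> b = \<zero> \<Longrightarrow> b = \<zero>"
    and cp: "\<And>n. \<psi> (bracket F (n * p)) = f \<otimes> \<psi>' (bracket F n)"
    and cu: "\<And>n. \<not> p dvd n \<Longrightarrow> \<psi> (bracket F n) \<in> Units R"
  shows "\<exists>u. quasi_iso R (FOmega F R \<psi>') (eta R f (FOmega F R \<psi>)) u \<and>
    (\<forall>n. u 0 (xpow R \<one> n) = xpow R \<one> (n * p)) \<and>
    (\<forall>n. u 1 (xpow R \<one> n) = xpow R f (n * p + (p - 1)))"
proof -
  let ?C = "FOmega F R \<psi>'" and ?D = "eta R f (FOmega F R \<psi>)"
  note C = cochain_complex_FOmega[of \<psi>' F, OF c']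
  note D = cochain_complex_eta[OF cochain_complex_FOmega[of \<psi> F, OF c] f]
  note simps = eta_FOmega[of \<psi> F, OF c f] FOmega_simps poly_module_simps
  have p1: "p - 1 < p" using p by simp
  note dv = dvd_Suc_iff_mod[OF p]
  have canc: "a = b" if "a \<in> carrier R" "b \<in> carrier R" "f \<otimes> a = f \<otimes> b" for a b
  proof -
    have "f \<otimes> (a \<ominus> b) = \<zero>" using that f by (simp add: a_minus_def r_distr r_minus r_neg)
    then have "a \<ominus> b = \<zero>" using f_reg that by simp
    then show ?thesis using that by simp
  qed
  define u1 where "u1 = (\<lambda>g n. f \<otimes> poly_spread R p (p - 1) g n)"
  define u where "u = (\<lambda>i::nat. if i = 0 then poly_spread R p 0 else if i = 1 then u1 else (\<lambda>_ _. \<zero>))"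
  have sc: "poly_spread R p r g n \<in> carrier R" if "g \<in> up R" for r g n
    using mem_upD[OF that] by (simp add: poly_spread_def)
  have du: "\<psi> (bracket F (Suc n)) \<otimes> poly_spread R p 0 g (Suc n)
      = f \<otimes> poly_spread R p (p - 1) (\<lambda>n. \<psi>' (bracket F (Suc n)) \<otimes> g (Suc n)) n" if g: "g \<in> up R" for g n
  proof (cases "p dvd Suc n")
    case True
    then obtain k where k: "Suc n = Suc k * p" by (metis dvd_def mult.commute mult_0 nat.distinct(1) not0_implies_Suc)
    then have "n = k * p + (p - 1)" using p by simp
    moreover have "(k * p + (p - 1)) div p = k + (p - 1) div p" by (rule div_mult_self3) (use p in simp)
    ultimately have "n div p = k" using p1 by simp
    moreover have "Suc n div p = Suc k" using k p by (metis div_mult_self_is_m)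
    ultimately show ?thesis
      using True f c' mem_upD[OF g] iffD1[OF dv True] by (simp add: poly_spread_def k cp m_assoc mod_eq_0_iff_dvd del: mult_Suc)
  next
    case False
    then show ?thesis using c f by (simp add: poly_spread_def dv mod_eq_0_iff_dvd)
  qed
  have u1_up: "u1 g \<in> (\<lambda>v n. f \<otimes> v n) ` up R" if "g \<in> up R" for g
    using poly_spread_up[OF p1 that] by (auto simp: u1_def)
  have u1_up': "u1 g \<in> up R" if "g \<in> up R" for g
    using up_smult_closed[OF f poly_spread_up[OF p1 that]] by (simp add: u1_def)
  have u0: "u 0 \<in> mod_hom R (cmod ?C 0) (cmod ?D 0)"
  proof -
    have "\<exists>v\<in>up R. \<forall>n. \<psi> (bracket F (Suc n)) \<otimes> poly_spread R p 0 g (Suc n) = f \<otimes> v n" if g: "g \<in> up R" for g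
      using du[OF g] poly_spread_up[OF p1 weighted_up[OF c' g, of Suc]] by blast
    then show ?thesis
      using poly_spread_hom[OF p] poly_spread_up[OF p] by (auto simp: simps mod_hom_def u_def)
  qed
  have u1: "u (Suc 0) \<in> mod_hom R (cmod ?C (Suc 0)) (cmod ?D (Suc 0))"
    using u1_up u1_up' f
    by (auto simp: simps mod_hom_def u_def up_add_closed up_smult_closed)
      (auto simp: u1_def poly_spread_def r_distr m_lcomm mem_upD)
  have u: "cochain_map R ?C ?D u"
    unfolding cochain_map_def
  proof (intro allI conjI ballI)
    fix i show "u i \<in> mod_hom R (cmod ?C i) (cmod ?D i)"
    proof (cases i)
      case (Suc j)
      show ?thesis
      proof (cases j)
        case (Suc k)
        then show ?thesis unfolding \<open>i = Suc j\<close> using zero_up by (simp add: mod_hom_def simps u_def)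
      qed (use u1 Suc in simp)
    qed (use u0 in simp)
    fix z assume z: "z \<in> carrier (cmod ?C i)"
    show "u (Suc i) (cdiff ?C i z) = cdiff ?D i (u i z)"
      using z du[of z] f by (cases i) (simp_all add: simps u_def u1_def)
  qed
  have "quasi_iso R ?C ?D u"
  proof (rule quasi_isoI[OF C D u])
    fix i g g' w assume g: "g \<in> cocycles ?C i" "g' \<in> cocycles ?C i" and w: "w \<in> coboundaries ?D i"
      and e: "u i g = w \<oplus>\<^bsub>cmod ?D i\<^esub> u i g'"
    consider "i = 0" | "i = Suc 0" | j where "i = Suc (Suc j)" by (metis not0_implies_Suc)
    then show "\<exists>w\<in>coboundaries ?C i. g = w \<oplus>\<^bsub>cmod ?C i\<^esub> g'"
    proof cases
      case 1
      then have g: "g \<in> up R" "g' \<in> up R" using g by (auto simp: cocycles_FOmega)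
      have "poly_spread R p 0 g = poly_spread R p 0 g'"
        using e w zero_up poly_spread_up[OF p g(2)] sc[OF g(2)] by (simp add: 1 simps u_def)
      then have "g = g'" by (rule poly_spread_inj[OF p])
      then show ?thesis
        using g zero_up mem_upD[OF g(1)] by (simp add: 1 coboundaries_FOmega simps)
    next
      case 2
      then have g: "g \<in> up R" "g' \<in> up R" using g by (auto simp: cocycles_FOmega)
      obtain z where z: "z \<in> up R" "w = (\<lambda>n. \<psi> (bracket F (Suc n)) \<otimes> z (Suc n))"
        using w by (auto simp: 2 simps)
      have wu: "w \<in> up R" unfolding z(2) by (rule weighted_up[OF c z(1)])
      have e': "u1 g n = w n \<oplus> u1 g' n" for n
        using e wu u1_up'[OF g(2)] by (simp add: 2 simps u_def fun_eq_iff)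
      define z' where "z' = (\<lambda>n. z (n * p + 0))"
      have z': "z' \<in> up R" unfolding z'_def by (rule up_reindex[OF p z(1)])
      have "g n = \<psi>' (bracket F (Suc n)) \<otimes> z' (Suc n) \<oplus> g' n" for n
      proof -
        have s: "Suc (n * p + (p - 1)) = Suc n * p" using p by simp
        have "f \<otimes> g n = f \<otimes> \<psi>' (bracket F (Suc n)) \<otimes> z' (Suc n) \<oplus> f \<otimes> g' n"
          using e'[of "n * p + (p - 1)"]
          unfolding u1_def poly_spread_nth[OF p1] z(2) s cp by (simp add: z'_def)
        then have "f \<otimes> g n = f \<otimes> (\<psi>' (bracket F (Suc n)) \<otimes> z' (Suc n) \<oplus> g' n)"
          using f c' mem_upD[OF z'] mem_upD[OF g(2)] by (simp add: r_distr m_assoc)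
        then show ?thesis using c' mem_upD[OF z'] mem_upD[OF g(2)] mem_upD[OF g(1)] by (rule_tac canc) auto
      qed
      then show ?thesis
        using z' g weighted_up[OF c' z', of Suc]
        by (intro bexI[of _ "\<lambda>n. \<psi>' (bracket F (Suc n)) \<otimes> z' (Suc n)"])
           (auto simp: 2 coboundaries_FOmega simps fun_eq_iff)
    next
      case 3
      then show ?thesis using g zero_up by (simp add: cocycles_FOmega coboundaries_FOmega simps)
    qed
  next
    fix i m assume m: "m \<in> cocycles ?D i"
    consider "i = 0" | "i = Suc 0" | j where "i = Suc (Suc j)" by (metis not0_implies_Suc)
    then show "\<exists>g\<in>cocycles ?C i. \<exists>w\<in>coboundaries ?D i. m = w \<oplus>\<^bsub>cmod ?D i\<^esub> u i g"
    proof cases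
      case 1
      then have z: "m \<in> up R" "\<And>n. \<psi> (bracket F (Suc n)) \<otimes> m (Suc n) = \<zero>"
        using m by (auto simp: simps)
      have zc: "\<And>n. m n \<in> carrier R" using z(1) by blast
      have e: "m = poly_spread R p 0 (\<lambda>n. m (n * p + 0))" by (rule cocycle_eq_poly_spread[OF cu z])
      have "\<psi>' (bracket F (Suc n)) \<otimes> m (Suc n * p + 0) = \<zero>" for n
      proof (rule f_reg)
        have "Suc (Suc n * p - 1) = Suc n * p" using p by simp
        then have "\<psi> (bracket F (Suc n * p)) \<otimes> m (Suc n * p) = \<zero>" using z(2)[of "Suc n * p - 1"] by metis
        then show "f \<otimes> (\<psi>' (bracket F (Suc n)) \<otimes> m (Suc n * p + 0)) = \<zero>"
          unfolding cp using f c' zc by (simp add: m_assoc)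
      qed (use c' zc in simp)
      moreover note up_reindex[OF p z(1), of 0] zero_up poly_spread_up[OF p up_reindex[OF p z(1), of 0]]
      ultimately show ?thesis using e zc
        by (rule_tac bexI[of _ "\<lambda>n. m (n * p + 0)"], rule_tac bexI[of _ "\<lambda>_. \<zero>"])
          (simp_all add: 1 simps cocycles_FOmega u_def)
    next
      case 2
      then obtain v where v: "v \<in> up R" "m = (\<lambda>n. f \<otimes> v n)" using m by (auto simp: simps)
      then have vc: "v n \<in> carrier R" for n by blast
      \<comment> \<open>a primitive of \<open>m\<close>, apart from the terms \<open>x^(kp+p-1) dx\<close>\<close>
      define z where "z = (\<lambda>n. if p dvd n then \<zero> else inv (\<psi> (bracket F n)) \<otimes> (f \<otimes> v (n - 1)))"
      obtain N where N: "\<And>n. N < n \<Longrightarrow> v n = \<zero>" using v(1) by (rule up_E) auto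
      have iu: "inv (\<psi> (bracket F n)) \<in> carrier R" if "\<not> p dvd n" for n using cu[OF that] by blast
      have z: "z \<in> up R"
        using N vc iu f by (intro up_I[of _ "Suc N"]) (auto simp: z_def)
      define v' where "v' = (\<lambda>n. if n mod p = p - 1 then \<zero> else v n)"
      have v': "v' \<in> up R" using N vc by (intro up_I[of _ N]) (auto simp: v'_def)
      have d: "\<psi> (bracket F (Suc n)) \<otimes> z (Suc n) = f \<otimes> v' n" for n
      proof (cases "p dvd Suc n")
        case False
        then have "\<psi> (bracket F (Suc n)) \<otimes> (inv (\<psi> (bracket F (Suc n))) \<otimes> (f \<otimes> v n)) = f \<otimes> v n"
          using cu[OF False] vc f by (simp add: m_assoc[symmetric] Units_closed)
        then show ?thesis using False by (simp add: z_def v'_def dv)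
      qed (use c f in \<open>simp add: z_def v'_def dv\<close>)
      have g: "(\<lambda>n. v (n * p + (p - 1))) \<in> up R" by (rule up_reindex[OF p v(1)])
      have s: "m n = f \<otimes> v' n \<oplus> u1 (\<lambda>n. v (n * p + (p - 1))) n" for n
      proof (cases "n mod p = p - 1")
        case True
        then have "n div p * p + (p - 1) = n" by (metis div_mult_mod_eq)
        then show ?thesis using True vc f by (simp add: poly_spread_def u1_def v(2) v'_def)
      qed (use vc f in \<open>simp add: poly_spread_def u1_def v(2) v'_def\<close>)
      show ?thesis
      proof (intro bexI)
        show "m = (\<lambda>n. f \<otimes> v' n) \<oplus>\<^bsub>cmod ?D i\<^esub> u i (\<lambda>n. v (n * p + (p - 1)))"
        proof -
          have "(\<lambda>n. f \<otimes> v' n) \<oplus>\<^bsub>cmod ?D i\<^esub> u i (\<lambda>n. v (n * p + (p - 1)))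
            = (\<lambda>n. f \<otimes> v' n \<oplus> u1 (\<lambda>n. v (n * p + (p - 1))) n)"
            using up_smult_closed[OF f v'] u1_up'[OF g] by (simp add: 2 simps u_def)
          also have "\<dots> = m" by (rule ext, rule s[symmetric])
          finally show ?thesis by (rule HOL.sym)
        qed
        show "(\<lambda>n. f \<otimes> v' n) \<in> coboundaries ?D i"
          using z v' d by (auto simp: 2 simps fun_eq_iff image_iff intro!: exI[of _ z])
        show "(\<lambda>n. v (n * p + (p - 1))) \<in> cocycles ?C i"
          using g by (simp add: 2 cocycles_FOmega)
      qed
    next
      case 3
      then show ?thesis using m zero_up by (simp add: cocycles_FOmega simps u_def)
    qed
  qed
  moreover have "u1 (xpow R \<one> n) = xpow R f (n * p + (p - 1))" for n
    using f p1 by (simp add: u1_def poly_spread_monom) (auto simp: UP_def fun_eq_iff)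
  ultimately show ?thesis
    using p by (intro exI[of _ u]) (simp add: u_def poly_spread_monom)
qed

end

section \<open>Adic completions\<close>

abbreviation tring :: "'s::comm_ring_1 ring" where "tring \<equiv> ring_of_type_algebra"

lemma tring_simps [simp]:
  "carrier tring = UNIV" "x \<otimes>\<^bsub>tring\<^esub> y = x * y" "\<one>\<^bsub>tring\<^esub> = 1" "\<zero>\<^bsub>tring\<^esub> = 0" "x \<oplus>\<^bsub>tring\<^esub> y = x + y"
  by (simp_all add: ring_of_type_algebra_def)

interpretation tring: cring tring
  by (rule cring_from_type_algebra)

lemma tring_a_inv [simp]: "\<ominus>\<^bsub>tring\<^esub> x = - x"
  by (rule tring.minus_equality) simp_all

lemma tring_finsum [simp]: "finsum tring f A = sum f A"
  by (induction A rule: infinite_finite_induct) auto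

lemma ideal_tring_iff:
  "ideal J tring \<longleftrightarrow> 0 \<in> J \<and> (\<forall>a\<in>J. \<forall>b\<in>J. a + b \<in> J) \<and> (\<forall>a\<in>J. \<forall>r. r * a \<in> J)"
proof
  assume "ideal J tring"
  then interpret ideal J tring .
  show "0 \<in> J \<and> (\<forall>a\<in>J. \<forall>b\<in>J. a + b \<in> J) \<and> (\<forall>a\<in>J. \<forall>r. r * a \<in> J)"
    using zero_closed a_closed I_l_closed by simp
next
  assume J: "0 \<in> J \<and> (\<forall>a\<in>J. \<forall>b\<in>J. a + b \<in> J) \<and> (\<forall>a\<in>J. \<forall>r. r * a \<in> J)"
  show "ideal J tring"
  proof (rule idealI)
    show "subgroup J (add_monoid tring)"
    proof (rule tring.add.subgroupI)
      show "\<ominus>\<^bsub>tring\<^esub> a \<in> J" if "a \<in> J" for a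
        using J that by (metis mult_minus1 tring_a_inv)
    qed (use J in auto)
  qed (use J in \<open>auto simp: tring.ring_axioms mult.commute\<close>)
qed

lemma ideal_tringD:
  assumes "ideal J tring"
  shows "0 \<in> J" "a \<in> J \<Longrightarrow> b \<in> J \<Longrightarrow> a + b \<in> J" "a \<in> J \<Longrightarrow> r * a \<in> J" "a \<in> J \<Longrightarrow> a * r \<in> J"
    "a \<in> J \<Longrightarrow> - a \<in> J" "a \<in> J \<Longrightarrow> b \<in> J \<Longrightarrow> a - b \<in> J"
proof -
  show *: "0 \<in> J" "\<And>a b. a \<in> J \<Longrightarrow> b \<in> J \<Longrightarrow> a + b \<in> J" "\<And>a r. a \<in> J \<Longrightarrow> r * a \<in> J"
    using assms unfolding ideal_tring_iff by auto
  show "a \<in> J \<Longrightarrow> a * r \<in> J" using *(3)[of a r] by (simp add: mult.commute)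
  show m: "\<And>a. a \<in> J \<Longrightarrow> - a \<in> J" using *(3)[of _ "- 1"] by simp
  show "a \<in> J \<Longrightarrow> b \<in> J \<Longrightarrow> a - b \<in> J" using *(2)[of a "- b"] m[of b] by simp
qed

lemma coset_tring_eq_iff:
  assumes "ideal J tring"
  shows "J +>\<^bsub>tring\<^esub> a = J +>\<^bsub>tring\<^esub> b \<longleftrightarrow> a - b \<in> J"
proof -
  interpret ideal J tring by fact
  have "J +>\<^bsub>tring\<^esub> a = J +>\<^bsub>tring\<^esub> b \<longleftrightarrow> (\<exists>n\<in>J. a = n + b)"
    using tring.coset_eq_iff[OF is_additive_subgroup, of a b] by simp
  then show ?thesis by (metis add_diff_cancel_right' diff_add_cancel)
qed

lemma coset_tring_0: "ideal J tring \<Longrightarrow> J +>\<^bsub>tring\<^esub> 0 = J"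
  using tring.a_coset_add_zero[of J] by simp

(* powers of ideals are to stay folded *)
declare nat_pow_0 [simp del] nat_pow_Suc [simp del]

lemma ideal_power_0 [simp]: "ideal_power tring I 0 = UNIV"
  by (simp add: nat_pow_def ideals_set_def)

lemma ideal_power_Suc: "ideal_power tring I (Suc n) = ideal_prod tring (ideal_power tring I n) I"
  by (simp add: nat_pow_def ideals_set_def)

lemma ideal_ideal_power: "ideal I tring \<Longrightarrow> ideal (ideal_power tring I n) tring"
proof (induction n)
  case 0 show ?case by (simp add: ideal_power_0 ideal_tring_iff)
next
  case (Suc n) then show ?case unfolding ideal_power_Suc by (intro tring.ideal_prod_is_ideal)
qed

lemma ideal_power_mult:
  "a \<in> ideal_power tring I n \<Longrightarrow> b \<in> I \<Longrightarrow> a * b \<in> ideal_power tring I (Suc n)"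
  unfolding ideal_power_Suc using ideal_prod.prod[of a _ b I tring] by simp

lemma power_in_ideal_power: "a \<in> I \<Longrightarrow> a ^ n \<in> ideal_power tring I n"
proof (induction n)
  case (Suc n) then show ?case using ideal_power_mult[of "a ^ n" I n a] by (simp add: mult.commute)
qed (simp add: ideal_power_0)

lemma ideal_power_decr:
  assumes "ideal I tring" shows "ideal_power tring I (Suc n) \<subseteq> ideal_power tring I n"
  unfolding ideal_power_Suc using tring.ideal_prod_inter[OF ideal_ideal_power[OF assms] assms] by blast

lemma ideal_power_Suc_induct:
  assumes "x \<in> ideal_power tring I (Suc n)"
    and "\<And>a b. a \<in> ideal_power tring I n \<Longrightarrow> b \<in> I \<Longrightarrow> P (a * b)"
    and "\<And>a b. P a \<Longrightarrow> P b \<Longrightarrow> P (a + b)"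
  shows "P x"
  using assms(1) unfolding ideal_power_Suc
  by (induction x rule: ideal_prod.induct) (use assms(2,3) in auto)

text \<open>
  Points of the completion are handled through sequences \<open>s\<close> of representatives: \<open>s n\<close> determines the
  point modulo \<open>I^n\<close>.
\<close>

definition compatible :: "'s::comm_ring_1 set \<Rightarrow> (nat \<Rightarrow> 's) \<Rightarrow> bool" where
  "compatible I s \<longleftrightarrow> (\<forall>n. s (Suc n) - s n \<in> ideal_power tring I n)"

definition limit_point :: "'s::comm_ring_1 set \<Rightarrow> (nat \<Rightarrow> 's) \<Rightarrow> nat \<Rightarrow> 's set" where
  "limit_point I s = (\<lambda>n. ideal_power tring I n +>\<^bsub>tring\<^esub> s n)"

locale adic =
  fixes I :: "'s::comm_ring_1 set"
  assumes ideal_I: "ideal I tring"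
begin

abbreviation "J \<equiv> ideal_power tring I"
abbreviation "lim_of \<equiv> limit_point I"
abbreviation "B \<equiv> adic_completion tring I"
abbreviation "\<iota> \<equiv> completion_map tring I"

lemma ideal_J: "ideal (J n) tring"
  by (rule ideal_ideal_power[OF ideal_I])

lemmas J_simps = ideal_tringD[OF ideal_J]

lemma carrier_B: "carrier B = lim_of ` {s. compatible I s}"
proof (intro equalityI subsetI)
  fix U assume U: "U \<in> carrier B"
  then have "\<exists>x. U n = J n +>\<^bsub>tring\<^esub> x" for n
    by (auto simp: adic_completion_def FactRing_def A_RCOSETS_def' image_iff)
  then obtain s where s: "\<And>n. U n = J n +>\<^bsub>tring\<^esub> s n" by metis
  have "compatible I s"
    unfolding compatible_def
  proof
    fix n
    have "s (Suc n) \<in> U (Suc n)"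
      unfolding s using J_simps(1) by (auto simp: a_r_coset_def r_coset_def intro!: bexI[of _ 0])
    then have "s (Suc n) \<in> U n" using U by (auto simp: adic_completion_def)
    then show "s (Suc n) - s n \<in> J n" unfolding s by (auto simp: a_r_coset_def r_coset_def)
  qed
  then show "U \<in> lim_of ` {s. compatible I s}" using s by (auto simp: limit_point_def fun_eq_iff)
next
  fix U assume "U \<in> lim_of ` {s. compatible I s}"
  then obtain s where s: "compatible I s" "U = lim_of s" by auto
  have "U (Suc n) \<subseteq> U n" for n
  proof
    fix x assume "x \<in> U (Suc n)"
    then have "x - s (Suc n) \<in> J (Suc n)" by (auto simp: s limit_point_def a_r_coset_def r_coset_def)
    then have "x - s (Suc n) \<in> J n" using ideal_power_decr[OF ideal_I] by blast
    then have "(x - s (Suc n)) + (s (Suc n) - s n) \<in> J n"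
      using s(1) unfolding compatible_def by (intro J_simps(2)) auto
    then have "x - s n \<in> J n" by simp
    then have "\<exists>j\<in>J n. x = j + s n" by (metis diff_add_cancel)
    then show "x \<in> U n" by (auto simp: s limit_point_def a_r_coset_def r_coset_def)
  qed
  moreover have "U n \<in> carrier (tring Quot J n)" for n
    by (auto simp: s limit_point_def FactRing_def A_RCOSETS_def')
  ultimately show "U \<in> carrier B" by (simp add: adic_completion_def)
qed

lemma B_cases:
  assumes "U \<in> carrier B" obtains s where "compatible I s" "U = lim_of s"
  using assms by (auto simp: carrier_B)

lemma lim_closed: "compatible I s \<Longrightarrow> lim_of s \<in> carrier B"
  by (simp add: carrier_B)

lemma lim_eq_iff: "lim_of s = lim_of t \<longleftrightarrow> (\<forall>n. s n - t n \<in> J n)"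
  by (simp add: limit_point_def fun_eq_iff coset_tring_eq_iff[OF ideal_J])

lemma lim_mult: "lim_of s \<otimes>\<^bsub>B\<^esub> lim_of t = lim_of (\<lambda>n. s n * t n)"
  using ideal.rcoset_mult_add[OF ideal_J, of "s _" "t _"]
  by (simp add: adic_completion_def limit_point_def FactRing_def fun_eq_iff)

lemma lim_add: "lim_of s \<oplus>\<^bsub>B\<^esub> lim_of t = lim_of (\<lambda>n. s n + t n)"
  using abelian_subgroup.a_rcos_sum[OF abelian_subgroupI3[OF ideal.axioms(1)[OF ideal_J] tring.abelian_group_axioms], of "s _" "t _"]
  by (simp add: adic_completion_def limit_point_def FactRing_def fun_eq_iff)

lemma lim_one: "\<one>\<^bsub>B\<^esub> = lim_of (\<lambda>_. 1)"
  by (simp add: adic_completion_def limit_point_def FactRing_def)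

lemma lim_zero: "\<zero>\<^bsub>B\<^esub> = lim_of (\<lambda>_. 0)"
  by (simp add: adic_completion_def limit_point_def FactRing_def coset_tring_0[OF ideal_J])

lemma iota_eq: "\<iota> b = lim_of (\<lambda>_. b)"
  by (simp add: completion_map_def limit_point_def)

lemma compatible_const: "compatible I (\<lambda>_. b)"
  using J_simps(1) by (simp add: compatible_def)

lemma compatible_add: "compatible I s \<Longrightarrow> compatible I t \<Longrightarrow> compatible I (\<lambda>n. s n + t n)"
  unfolding compatible_def using J_simps(2) by (metis add_diff_add)

lemma compatible_mult:
  assumes "compatible I s" "compatible I t" shows "compatible I (\<lambda>n. s n * t n)"
  unfolding compatible_def
proof
  fix n
  have "s (Suc n) * t (Suc n) - s n * t n = s (Suc n) * (t (Suc n) - t n) + (s (Suc n) - s n) * t n"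
    by (simp add: algebra_simps)
  then show "s (Suc n) * t (Suc n) - s n * t n \<in> J n"
    using assms unfolding compatible_def by (auto intro: J_simps)
qed

lemma compatible_uminus: "compatible I s \<Longrightarrow> compatible I (\<lambda>n. - s n)"
  using compatible_mult[OF compatible_const[of "- 1"], of s] by simp

lemma cring_B: "cring B"
proof (rule cringI)
  show "abelian_group B"
  proof (rule abelian_groupI)
    fix x assume "x \<in> carrier B"
    then obtain s where s: "compatible I s" "x = lim_of s" by (rule B_cases)
    show "\<exists>y\<in>carrier B. y \<oplus>\<^bsub>B\<^esub> x = \<zero>\<^bsub>B\<^esub>"
      using compatible_uminus[OF s(1)] s(2)
      by (intro bexI[of _ "lim_of (\<lambda>n. - s n)"]) (auto simp: lim_add lim_zero lim_closed)
  qed (auto simp: lim_zero compatible_const compatible_add lim_closed lim_add add_ac elim!: B_cases)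
  show "comm_monoid B"
    by (rule comm_monoidI) (auto simp: lim_one compatible_const compatible_mult lim_closed lim_mult mult_ac elim!: B_cases)
  show "(x \<oplus>\<^bsub>B\<^esub> y) \<otimes>\<^bsub>B\<^esub> z = x \<otimes>\<^bsub>B\<^esub> z \<oplus>\<^bsub>B\<^esub> y \<otimes>\<^bsub>B\<^esub> z"
    if "x \<in> carrier B" "y \<in> carrier B" "z \<in> carrier B" for x y z
    using that by (auto simp: lim_mult lim_add distrib_right elim!: B_cases)
qed

lemma iota_closed: "\<iota> b \<in> carrier B"
  by (simp add: iota_eq lim_closed compatible_const)

lemma iota_mult: "\<iota> (a * b) = \<iota> a \<otimes>\<^bsub>B\<^esub> \<iota> b" and iota_add: "\<iota> (a + b) = \<iota> a \<oplus>\<^bsub>B\<^esub> \<iota> b"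
  and iota_one: "\<iota> 1 = \<one>\<^bsub>B\<^esub>" and iota_zero: "\<iota> 0 = \<zero>\<^bsub>B\<^esub>"
  by (simp_all add: iota_eq lim_mult lim_add lim_one lim_zero)

text \<open>
  The inverse of \<open>1 + a\<close> is the geometric series, truncated at \<open>n\<close> modulo \<open>I^n\<close>.
\<close>

lemma iota_unit:
  assumes "a \<in> I" shows "\<iota> (1 + a) \<in> Units B"
proof -
  interpret B: cring B by (rule cring_B)
  have aJ: "(- a) ^ n \<in> J n" for n
    using power_in_ideal_power[of "- a"] assms ideal_tringD(5)[OF ideal_I] by blast
  have c: "compatible I (\<lambda>n. \<Sum>i<n. (- a) ^ i)"
    using aJ by (simp add: compatible_def)
  have "(1 + a) * (\<Sum>i<n. (- a) ^ i) - 1 \<in> J n" for n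
  proof -
    have "(1 + a) * (\<Sum>i<n. (- a) ^ i) - 1 = - ((- a) ^ n)"
      using one_diff_power_eq[of "- a" n] by (simp add: algebra_simps)
    then show ?thesis using J_simps(5)[OF aJ] by simp
  qed
  then have "\<iota> (1 + a) \<otimes>\<^bsub>B\<^esub> lim_of (\<lambda>n. \<Sum>i<n. (- a) ^ i) = \<one>\<^bsub>B\<^esub>"
    by (simp add: iota_eq lim_mult lim_one lim_eq_iff)
  then show ?thesis using iota_closed lim_closed[OF c] B.Units_one_closed B.unit_factor by (metis B.m_comm)
qed

lemma iota_unit_of_mult:
  assumes "b * m = 1 + a" "a \<in> I" shows "\<iota> b \<in> Units B"
proof -
  interpret B: cring B by (rule cring_B)
  have "\<iota> b \<otimes>\<^bsub>B\<^esub> \<iota> m \<in> Units B" using iota_unit[OF assms(2)] by (simp add: assms(1)[symmetric] iota_mult)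
  then show ?thesis by (rule B.unit_factor) (rule iota_closed)+
qed

end

lemma Idl_tring_singleton: "Idl\<^bsub>tring\<^esub> {f} = {f * r |r. True}"
proof -
  have "Idl\<^bsub>tring\<^esub> {f} = PIdl\<^bsub>tring\<^esub> f" using tring.cgenideal_eq_genideal[of f] by simp
  then show ?thesis by (auto simp: cgenideal_def mult.commute)
qed

lemma Idl_tring_pair: "Idl\<^bsub>tring\<^esub> {q, f} = {q * a + f * b |a b. True}"
proof
  have "ideal {q * a + f * b |a b. True} tring"
    unfolding ideal_tring_iff
  proof (intro conjI ballI allI)
    show "0 \<in> {q * a + f * b |a b. True}" by (auto intro!: exI[of _ 0])
    show "x + y \<in> {q * a + f * b |a b. True}" if "x \<in> {q * a + f * b |a b. True}" "y \<in> {q * a + f * b |a b. True}" for x y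
    proof -
      obtain a b c d where "x = q * a + f * b" "y = q * c + f * d"
        using \<open>x \<in> _\<close> \<open>y \<in> _\<close> by blast
      then have "x + y = q * (a + c) + f * (b + d)" by (simp add: algebra_simps)
      then show ?thesis by blast
    qed
    show "r * x \<in> {q * a + f * b |a b. True}" if "x \<in> {q * a + f * b |a b. True}" for x r
    proof -
      obtain a b where "x = q * a + f * b" using \<open>x \<in> _\<close> by blast
      then have "r * x = q * (r * a) + f * (r * b)" by (simp add: algebra_simps)
      then show ?thesis by blast
    qed
  qed
  moreover have "q = q * 1 + f * 0" "f = q * 0 + f * 1" by simp_all
  then have "{q, f} \<subseteq> {q * a + f * b |a b. True}" by blast
  ultimately show "Idl\<^bsub>tring\<^esub> {q, f} \<subseteq> {q * a + f * b |a b. True}"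
    by (rule tring.genideal_minimal)
  have i: "ideal (Idl\<^bsub>tring\<^esub> {q, f}) tring" by (rule tring.genideal_ideal) simp
  have "q \<in> Idl\<^bsub>tring\<^esub> {q, f}" "f \<in> Idl\<^bsub>tring\<^esub> {q, f}" using tring.genideal_self[of "{q, f}"] by auto
  then show "{q * a + f * b |a b. True} \<subseteq> Idl\<^bsub>tring\<^esub> {q, f}"
    using ideal_tringD[OF i] by auto
qed

text \<open>
  If \<open>f b = 0\<close> and \<open>s\<close> represents \<open>b\<close>, then \<open>f s(n+1)\<close> is a multiple of \<open>f^(n+1)\<close>. Cancelling \<open>f\<close> leaves
  \<open>s(n+1)\<close>, and with it \<open>s(n)\<close>, in the ideal \<open>(f^n)\<close>.
\<close>

lemma principal_completion_regular:
  assumes f: "regular (f :: 's::comm_ring_1)" and b: "b \<in> carrier (adic_completion tring (Idl\<^bsub>tring\<^esub> {f}))"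
    and 0: "completion_map tring (Idl\<^bsub>tring\<^esub> {f}) f \<otimes>\<^bsub>adic_completion tring (Idl\<^bsub>tring\<^esub> {f})\<^esub> b
      = \<zero>\<^bsub>adic_completion tring (Idl\<^bsub>tring\<^esub> {f})\<^esub>"
  shows "b = \<zero>\<^bsub>adic_completion tring (Idl\<^bsub>tring\<^esub> {f})\<^esub>"
proof -
  interpret adic "Idl\<^bsub>tring\<^esub> {f}"
    by (rule adic.intro, rule tring.genideal_ideal) simp
  have JD: "f ^ n dvd x" if "x \<in> J n" for n x
    using that
  proof (induction n arbitrary: x)
    case (Suc n)
    from Suc(2) show ?case
    proof (rule ideal_power_Suc_induct)
      fix a b assume ab: "a \<in> J n" "b \<in> Idl\<^bsub>tring\<^esub> {f}"
      have "f dvd b" using ab(2) unfolding Idl_tring_singleton by auto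
      then show "f ^ Suc n dvd a * b" using mult_dvd_mono[OF Suc(1)[OF ab(1)] \<open>f dvd b\<close>] by (simp add: mult.commute)
    qed (rule dvd_add)
  qed simp
  have fI: "f \<in> Idl\<^bsub>tring\<^esub> {f}" using tring.genideal_self[of "{f}"] by auto
  obtain s where s: "compatible (Idl\<^bsub>tring\<^esub> {f}) s" "b = lim_of s" using b by (rule B_cases)
  have m: "f * s n \<in> J n" for n using 0 by (simp add: s(2) iota_eq lim_mult lim_zero lim_eq_iff)
  have "s n \<in> J n" for n
  proof -
    obtain r where r: "f * s (Suc n) = f ^ Suc n * r" using JD[OF m[of "Suc n"]] by blast
    have "s (Suc n) = f ^ n * r" by (rule regular_cancel[OF f]) (use r in \<open>simp add: mult.assoc\<close>)
    then have "s (Suc n) \<in> J n" using J_simps(4)[OF power_in_ideal_power[OF fI]] by simp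
    moreover have "s (Suc n) - s n \<in> J n" using s(1) by (simp add: compatible_def)
    ultimately show ?thesis using J_simps(6) by fastforce
  qed
  then show ?thesis by (simp add: s(2) lim_zero lim_eq_iff)
qed

section \<open>Reduction modulo an element and regularity in the completion\<close>

lemma PIdl_iff: "cring R \<Longrightarrow> x \<in> PIdl\<^bsub>R\<^esub> f \<longleftrightarrow> (\<exists>b\<in>carrier R. x = b \<otimes>\<^bsub>R\<^esub> f)"
  by (auto simp: cgenideal_def)

lemma (in cring) ideal_PIdl: "f \<in> carrier R \<Longrightarrow> ideal (PIdl f) R"
  by (rule cgenideal_ideal)

lemma (in cring) mod_elem_simps:
  assumes f: "f \<in> carrier R"
  shows "cring (mod_elem R f)"
    "mod_elem_map R f \<in> ring_hom R (mod_elem R f)"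
    "carrier (mod_elem R f) = mod_elem_map R f ` carrier R"
    "a \<in> carrier R \<Longrightarrow> mod_elem_map R f a = \<zero>\<^bsub>mod_elem R f\<^esub> \<longleftrightarrow> (\<exists>b\<in>carrier R. a = f \<otimes> b)"
proof -
  interpret ideal "PIdl f" R by (rule ideal_PIdl[OF f])
  show "cring (mod_elem R f)" unfolding mod_elem_def by (rule quotient_is_cring[OF is_cring])
  show "mod_elem_map R f \<in> ring_hom R (mod_elem R f)"
    unfolding mod_elem_def mod_elem_map_def[abs_def] by (rule rcos_ring_hom)
  show "carrier (mod_elem R f) = mod_elem_map R f ` carrier R"
    by (auto simp: mod_elem_def mod_elem_map_def FactRing_def A_RCOSETS_def')
  show "mod_elem_map R f a = \<zero>\<^bsub>mod_elem R f\<^esub> \<longleftrightarrow> (\<exists>b\<in>carrier R. a = f \<otimes> b)" if a: "a \<in> carrier R"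
  proof -
    have "mod_elem_map R f a = \<zero>\<^bsub>mod_elem R f\<^esub> \<longleftrightarrow> a \<in> PIdl f"
      using a a_coset_join1[OF _ a a_subgroup] a_coset_join2[OF a a_subgroup]
      by (auto simp: mod_elem_def mod_elem_map_def FactRing_def)
    then show ?thesis unfolding PIdl_iff[OF is_cring] using f by (auto simp: m_comm)
  qed
qed

text \<open>
  Regularity of \<open>c\<close> modulo \<open>f\<close>, read off in the ring itself.
\<close>

lemma (in cring) non_zero_divisor_mod_elem:
  assumes f: "f \<in> carrier R" and c: "c \<in> carrier R"
    and nz: "non_zero_divisor (mod_elem R f) (mod_elem_map R f c)"
    and a: "a \<in> carrier R" and b: "b \<in> carrier R" "c \<otimes> a = f \<otimes> b"
  shows "\<exists>b\<in>carrier R. a = f \<otimes> b"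
proof -
  note m = mod_elem_simps[OF f]
  have "mod_elem_map R f c \<otimes>\<^bsub>mod_elem R f\<^esub> mod_elem_map R f a = \<zero>\<^bsub>mod_elem R f\<^esub>"
    unfolding ring_hom_mult[OF m(2) c a, symmetric] m(4)[OF m_closed[OF c a]]
    using b by (rule bexI[rotated])
  then have "mod_elem_map R f a = \<zero>\<^bsub>mod_elem R f\<^esub>"
    using nz a unfolding non_zero_divisor_def m(3) by blast
  then show ?thesis unfolding m(4)[OF a] .
qed

text \<open>
  Modulo \<open>f\<close>, the number \<open>p\<close> equals \<open>- t g\<close>. So \<open>y 0\<close> is congruent to \<open>(- t g)^n y n\<close> for all \<open>n\<close>; adding up the
  multiples of \<open>f\<close> in these congruences gives a \<open>t\<close>-adically convergent series, and \<open>y 0\<close> is \<open>f\<close> times it.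
\<close>

lemma fps_p_divisible_mod:
  fixes f g :: "'a::comm_ring_1 fps"
  assumes f: "f = of_nat p + fps_X * g" and y: "\<And>i. f dvd y i - of_nat p * y (Suc i)"
  shows "f dvd y 0"
proof -
  let ?h = "- (fps_X * g)"
  obtain z where z: "\<And>i. y i - of_nat p * y (Suc i) = f * z i" using y unfolding dvd_def by metis
  define w where "w = (\<lambda>i. z i + y (Suc i))"
  have yw: "y i = ?h * y (Suc i) + f * w i" for i
    using z[of i] by (simp add: w_def f algebra_simps)
  have s: "y 0 = ?h ^ n * y n + f * (\<Sum>i<n. w i * ?h ^ i)" for n
  proof (induction n)
    case (Suc n)
    have "?h ^ n * y n = ?h ^ Suc n * y (Suc n) + f * (w n * ?h ^ n)"
      by (subst yw[of n]) (simp only: algebra_simps power_Suc)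
    then show ?case using Suc by (simp add: algebra_simps)
  qed simp
  have h0: "?h $ 0 = 0" by simp
  have "y 0 = f * eval_last ?h (Abs_fps w)"
  proof (rule fps_eq_if_cong)
    fix N
    have e: "y 0 - f * eval_last ?h (Abs_fps w)
      = ?h ^ N * y N - f * (eval_last ?h (Abs_fps w) - (\<Sum>i<N. w i * ?h ^ i))"
      by (subst s[of N]) (simp only: algebra_simps)
    have "fps_X ^ N dvd ?h ^ N * y N"
      by (rule dvd_mult2[OF fps_X_power_dvd_power[OF h0]])
    moreover have "fps_X ^ N dvd f * (eval_last ?h (Abs_fps w) - (\<Sum>i<N. w i * ?h ^ i))"
      using eval_last_cong[OF h0, of N "Abs_fps w"] by (intro dvd_mult) simp
    ultimately show "fps_X ^ N dvd y 0 - f * eval_last ?h (Abs_fps w)" unfolding e by (rule dvd_diff)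
  qed
  then show ?thesis by simp
qed

text \<open>
  That is, \<open>(q,f)^(n+1) = (q^(n+1)) + f (q,f)^n\<close>.
\<close>

lemma ideal_power_pair_cases:
  fixes q f :: "'s::comm_ring_1"
  defines "I \<equiv> Idl\<^bsub>tring\<^esub> {q, f}"
  assumes "x \<in> ideal_power tring I (Suc n)"
  shows "\<exists>a. \<exists>j \<in> ideal_power tring I n. x = q ^ Suc n * a + f * j"
proof -
  have I: "I = {q * a + f * b |a b. True}" unfolding I_def by (rule Idl_tring_pair)
  interpret adic I
    by (rule adic.intro, unfold I_def, rule tring.genideal_ideal) simp
  have q: "q \<in> I" unfolding I_def using tring.genideal_self[of "{q, f}"] by auto
  have add: "\<exists>a. \<exists>j \<in> J n. x + y = q ^ Suc n * a + f * j"
    if xy: "\<exists>a. \<exists>j \<in> J n. x = q ^ Suc n * a + f * j" "\<exists>a. \<exists>j \<in> J n. y = q ^ Suc n * a + f * j" for x y n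
  proof -
    obtain a j b k where "j \<in> J n" "x = q ^ Suc n * a + f * j" "k \<in> J n" "y = q ^ Suc n * b + f * k"
      using xy by blast
    then have "x + y = q ^ Suc n * (a + b) + f * (j + k)" "j + k \<in> J n"
      using J_simps(2) by (auto simp: algebra_simps)
    then show ?thesis by blast
  qed
  show ?thesis using assms(2)
  proof (induction n arbitrary: x)
    case 0
    then show ?case
    proof (rule ideal_power_Suc_induct)
      fix a b assume "b \<in> I"
      then obtain c d where "b = q * c + f * d" unfolding I by blast
      then have "a * b = q ^ Suc 0 * (a * c) + f * (a * d)" by (simp add: algebra_simps)
      then show "\<exists>e. \<exists>j\<in>J 0. a * b = q ^ Suc 0 * e + f * j" by auto
    qed (rule add)
  next
    case (Suc n)
    from Suc(2) show ?case
    proof (rule ideal_power_Suc_induct)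
      fix a b assume a: "a \<in> J (Suc n)" and b: "b \<in> I"
      obtain c j where aj: "j \<in> J n" "a = q ^ Suc n * c + f * j" using Suc(1)[OF a] by blast
      obtain d e where be: "b = q * d + f * e" using b unfolding I by blast
      have "a * b = q ^ Suc (Suc n) * (c * d) + f * (d * (j * q) + e * a)"
      proof -
        have "a * b = a * (q * d) + a * (f * e)" by (simp add: be distrib_left)
        also have "a * (q * d) = (q ^ Suc n * c + f * j) * (q * d)" using aj(2) by simp
        finally show ?thesis by (simp add: algebra_simps)
      qed
      moreover have "d * (j * q) + e * a \<in> J (Suc n)"
        by (rule J_simps(2)[OF J_simps(3)[OF ideal_power_mult[OF aj(1) q]] J_simps(3)[OF a]])
      ultimately show "\<exists>e. \<exists>j\<in>J (Suc n). a * b = q ^ Suc (Suc n) * e + f * j" by blast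
    qed (rule add)
  qed
qed

text \<open>
  The assumption says that \<open>p\<close> is regular modulo \<open>f\<close> in the completion \<open>B\<close>. First, \<open>y\<close> is a multiple of \<open>f\<close> if its
  image in \<open>B\<close> is one (\<open>lift\<close>): such a \<open>y\<close> is \<open>p y'\<close> modulo \<open>f\<close>, where \<open>y'\<close> again has this property, and
  \<open>fps_p_divisible_mod\<close> applies to the resulting sequence. So \<open>p\<close> is regular modulo \<open>f\<close> in \<open>R[[t]]\<close> as
  well. Now let \<open>f b = 0\<close> and let \<open>s\<close> represent \<open>b\<close>. Then \<open>f s(n+1) = p^(n+1) a + f j\<close> with \<open>j \<in> I^n\<close>, the
  element \<open>a\<close> is a multiple of \<open>f\<close>, and cancelling \<open>f\<close> leaves \<open>s(n+1) \<in> I^n\<close>.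
\<close>

lemma p_completion_regular:
  fixes f g :: "'a::comm_ring_1 fps"
  assumes f: "f = of_nat p + fps_X * g" and reg: "regular f"
    and I: "I = Idl\<^bsub>tring\<^esub> {of_nat p, f}"
    and pnz: "\<And>a b. a \<in> carrier (adic_completion tring I) \<Longrightarrow> b \<in> carrier (adic_completion tring I) \<Longrightarrow>
      completion_map tring I (of_nat p) \<otimes>\<^bsub>adic_completion tring I\<^esub> a
        = completion_map tring I f \<otimes>\<^bsub>adic_completion tring I\<^esub> b \<Longrightarrow>
      \<exists>b\<in>carrier (adic_completion tring I). a = completion_map tring I f \<otimes>\<^bsub>adic_completion tring I\<^esub> b"
    and b: "b \<in> carrier (adic_completion tring I)"
      "completion_map tring I f \<otimes>\<^bsub>adic_completion tring I\<^esub> b = \<zero>\<^bsub>adic_completion tring I\<^esub>"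
  shows "b = \<zero>\<^bsub>adic_completion tring I\<^esub>"
proof -
  interpret adic I
    by (rule adic.intro, unfold I, rule tring.genideal_ideal) simp
  interpret B: cring B by (rule cring_B)
  have lift: "f dvd y" if "c \<in> carrier B" "\<iota> y = \<iota> f \<otimes>\<^bsub>B\<^esub> c" for y c
  proof -
    have step: "\<exists>y'. f dvd y - of_nat p * y' \<and> (\<exists>c\<in>carrier B. \<iota> y' = \<iota> f \<otimes>\<^bsub>B\<^esub> c)"
      if yc: "\<exists>c\<in>carrier B. \<iota> y = \<iota> f \<otimes>\<^bsub>B\<^esub> c" for y
    proof -
      obtain c where c: "c \<in> carrier B" "\<iota> y = \<iota> f \<otimes>\<^bsub>B\<^esub> c" using yc by blast
      obtain s where s: "compatible I s" "c = lim_of s" using c(1) by (rule B_cases)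
      have "y - f * s (Suc 0) \<in> J (Suc 0)" using c(2) by (simp add: s(2) iota_eq lim_mult lim_eq_iff)
      from ideal_power_pair_cases[OF this[unfolded I]]
      obtain a j where aj: "y - f * s (Suc 0) = of_nat p ^ Suc 0 * a + f * j" by (elim exE bexE)
      then have y: "y = of_nat p * a + f * (s (Suc 0) + j)" by (simp add: algebra_simps)
      have "\<iota> (of_nat p) \<otimes>\<^bsub>B\<^esub> \<iota> a = \<iota> f \<otimes>\<^bsub>B\<^esub> (c \<ominus>\<^bsub>B\<^esub> \<iota> (s (Suc 0) + j))"
      proof -
        have "\<iota> f \<otimes>\<^bsub>B\<^esub> c = \<iota> (of_nat p) \<otimes>\<^bsub>B\<^esub> \<iota> a \<oplus>\<^bsub>B\<^esub> \<iota> f \<otimes>\<^bsub>B\<^esub> \<iota> (s (Suc 0) + j)"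
          using c(2) by (subst (asm) y) (simp add: iota_mult iota_add)
        then have "\<iota> f \<otimes>\<^bsub>B\<^esub> c \<ominus>\<^bsub>B\<^esub> \<iota> f \<otimes>\<^bsub>B\<^esub> \<iota> (s (Suc 0) + j) = \<iota> (of_nat p) \<otimes>\<^bsub>B\<^esub> \<iota> a"
          using iota_closed by (simp add: a_minus_def B.a_assoc B.r_neg)
        then show ?thesis using iota_closed c(1) by (simp add: a_minus_def B.r_distr B.r_minus)
      qed
      from pnz[OF iota_closed _ this] c(1) iota_closed
      have "\<exists>c\<in>carrier B. \<iota> a = \<iota> f \<otimes>\<^bsub>B\<^esub> c" by blast
      moreover have "f dvd y - of_nat p * a" by (subst y) simp
      ultimately show ?thesis by blast
    qed
    obtain nx where nx: "\<And>y. \<exists>c\<in>carrier B. \<iota> y = \<iota> f \<otimes>\<^bsub>B\<^esub> c \<Longrightarrow>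
        f dvd y - of_nat p * nx y \<and> (\<exists>c\<in>carrier B. \<iota> (nx y) = \<iota> f \<otimes>\<^bsub>B\<^esub> c)"
      using step by metis
    define ys where "ys = (\<lambda>i. (nx ^^ i) y)"
    have ys: "\<exists>c\<in>carrier B. \<iota> (ys i) = \<iota> f \<otimes>\<^bsub>B\<^esub> c" for i
      by (induction i) (use that nx in \<open>auto simp: ys_def\<close>)
    have "f dvd ys i - of_nat p * ys (Suc i)" for i
      using nx[OF ys[of i]] by (simp add: ys_def)
    then have "f dvd ys 0" by (rule fps_p_divisible_mod[OF f])
    then show ?thesis by (simp add: ys_def)
  qed
  have p_cancel: "f dvd y" if "f dvd of_nat p * y" for y
  proof -
    obtain r where "of_nat p * y = f * r" using \<open>f dvd _\<close> by blast
    then have "\<iota> (of_nat p) \<otimes>\<^bsub>B\<^esub> \<iota> y = \<iota> f \<otimes>\<^bsub>B\<^esub> \<iota> r" by (simp add: iota_mult[symmetric])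
    from pnz[OF iota_closed iota_closed this] show ?thesis using lift by blast
  qed
  have p_power_cancel: "f dvd y" if "f dvd of_nat p ^ n * y" for n y
    using that
  proof (induction n)
    case (Suc n)
    from Suc(2) have "f dvd of_nat p * (of_nat p ^ n * y)" by (simp add: mult.assoc)
    then show ?case using Suc(1) p_cancel by blast
  qed simp
  obtain s where s: "compatible I s" "b = lim_of s" using b(1) by (rule B_cases)
  have m: "f * s n \<in> J n" for n using b(2) by (simp add: s(2) iota_eq lim_mult lim_zero lim_eq_iff)
  have "s n \<in> J n" for n
  proof -
    obtain a j where j: "j \<in> J n" and aj: "f * s (Suc n) = of_nat p ^ Suc n * a + f * j"
      using ideal_power_pair_cases[OF m[of "Suc n", unfolded I], folded I] by (elim exE bexE)
    then have "of_nat p ^ Suc n * a = f * (s (Suc n) - j)" by (simp add: algebra_simps)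
    then have "f dvd of_nat p ^ Suc n * a" by simp
    then obtain a' where a': "a = f * a'" using p_power_cancel by blast
    have "s (Suc n) = of_nat p ^ Suc n * a' + j"
      by (rule regular_cancel[OF reg]) (use aj a' in \<open>simp add: algebra_simps\<close>)
    moreover have pI: "of_nat p \<in> I" unfolding I using tring.genideal_self[of "{of_nat p, f}"] by auto
    then have "of_nat p ^ Suc n * a' \<in> J n"
      using power_in_ideal_power[OF pI, of "Suc n"] ideal_power_decr[OF ideal_I, of n] J_simps(4) by blast
    ultimately have "s (Suc n) \<in> J n" using j J_simps(2) by simp
    moreover have "s (Suc n) - s n \<in> J n" using s(1) by (simp add: compatible_def)
    ultimately show ?thesis using J_simps(6) by fastforce
  qed
  then show ?thesis by (simp add: s(2) lim_zero lim_eq_iff)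
qed

section \<open>Torsion and flatness\<close>

lemma module_free_module:
  fixes B :: "('b, 'k) ring_scheme" and J :: "'i set"
  assumes "cring B" shows "module B (free_module B J)"
proof -
  interpret cring B by fact
  have fin: "finite {j. v j \<oplus>\<^bsub>B\<^esub> w j \<noteq> \<zero>\<^bsub>B\<^esub>}"
    if "finite {j. v j \<noteq> \<zero>\<^bsub>B\<^esub>}" "finite {j. w j \<noteq> \<zero>\<^bsub>B\<^esub>}" for v w :: "'i \<Rightarrow> 'b"
    by (rule finite_subset[OF _ finite_UnI[OF that]]) auto
  have fin2: "finite {j. h (v j) \<noteq> \<zero>\<^bsub>B\<^esub>}"
    if "finite {j. v j \<noteq> \<zero>\<^bsub>B\<^esub>}" "h \<zero>\<^bsub>B\<^esub> = \<zero>\<^bsub>B\<^esub>" for v :: "'i \<Rightarrow> 'b" and h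
    by (rule finite_subset[OF _ that(1)]) (use that(2) in auto)
  show ?thesis
  proof (rule moduleI)
    show "abelian_group (free_module B J)"
    proof (rule abelian_groupI)
      fix v assume v: "v \<in> carrier (free_module B J)"
      show "\<exists>w\<in>carrier (free_module B J). w \<oplus>\<^bsub>free_module B J\<^esub> v = \<zero>\<^bsub>free_module B J\<^esub>"
        using v fin2[of v "a_inv B"]
        by (intro bexI[of _ "\<lambda>j. \<ominus>\<^bsub>B\<^esub> v j"]) (auto simp: free_module_def l_neg)
    qed (auto simp: free_module_def fin a_ac)
    fix a assume a: "a \<in> carrier B"
    show "a \<odot>\<^bsub>free_module B J\<^esub> v \<in> carrier (free_module B J)" if "v \<in> carrier (free_module B J)" for v
      using a that fin2[of v "\<lambda>x. a \<otimes>\<^bsub>B\<^esub> x"] by (auto simp: free_module_def)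
  qed (auto simp: free_module_def assms l_distr r_distr m_assoc)
qed

lemma mod_reduction_carrier:
  "carrier (mod_reduction f M) = (\<lambda>x. multiples f M +>\<^bsub>M\<^esub> x) ` carrier M"
  "zero (mod_reduction f M) = multiples f M"
  by (auto simp: mod_reduction_def A_RCOSETS_def')

lemma mem_coset_multiples:
  "x \<in> multiples f M +>\<^bsub>M\<^esub> y \<longleftrightarrow> (\<exists>m\<in>carrier M. x = (f \<odot>\<^bsub>M\<^esub> m) \<oplus>\<^bsub>M\<^esub> y)"
  by (auto simp: multiples_def a_r_coset_def r_coset_def)

lemma additive_subgroup_multiples:
  assumes "module B M" "f \<in> carrier B" shows "additive_subgroup (multiples f M) M"
  using submodule_multiples[OF assms] by (simp add: submodule_def additive_subgroup_def)

lemma coset_multiples_eq_0_iff: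
  assumes M: "module R M" and f: "f \<in> carrier R" and x: "x \<in> carrier M"
  shows "multiples f M +>\<^bsub>M\<^esub> x = multiples f M \<longleftrightarrow> x \<in> multiples f M"
proof -
  interpret module R M by fact
  have s: "subgroup (multiples f M) (add_monoid M)"
    using additive_subgroup_multiples[OF assms(1,2)] by (rule additive_subgroup.a_subgroup)
  show ?thesis using M.a_coset_join1[OF _ assms(3) s] M.a_coset_join2[OF assms(3) s] by blast
qed

text \<open>
  A representative of \<open>Tor_1(A, B/f)\<close>: lift \<open>a\<close> to \<open>v \<in> P_0\<close> and write \<open>f v = d w\<close>. Modulo \<open>f\<close>, \<open>w\<close> is a cycle,
  hence a boundary, so \<open>w = f m\<close> up to a boundary, and \<open>v = d m\<close> since \<open>f\<close> is regular on the free module \<open>P_0\<close>.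
\<close>

lemma tor_vanishes_torsionfree:
  fixes B :: "'b ring" and A :: "('b, 'c) module"
  assumes A: "module B A" and f: "f \<in> carrier B"
    and reg: "\<And>b. b \<in> carrier B \<Longrightarrow> f \<otimes>\<^bsub>B\<^esub> b = \<zero>\<^bsub>B\<^esub> \<Longrightarrow> b = \<zero>\<^bsub>B\<^esub>"
    and tor: "tor_vanishes B f A" and a: "a \<in> carrier A" "f \<odot>\<^bsub>A\<^esub> a = \<zero>\<^bsub>A\<^esub>"
  shows "a = \<zero>\<^bsub>A\<^esub>"
proof -
  interpret A: module B A by fact
  obtain J :: "nat \<Rightarrow> (nat + 'b + 'c) set" and e d where res: "free_resolution B A J e d"
    and ex: "\<And>i. map_reduction f (free_module B (J (Suc i))) (d (Suc i)) `
                carrier (mod_reduction f (free_module B (J (Suc (Suc i))))) =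
             {U \<in> carrier (mod_reduction f (free_module B (J (Suc i)))).
                map_reduction f (free_module B (J i)) (d i) U =
                  \<zero>\<^bsub>mod_reduction f (free_module B (J i))\<^esub>}"
    using tor unfolding tor_vanishes_def by (elim exE conjE) (rule that, assumption, erule spec)
  let ?P = "\<lambda>i. free_module B (J i)"
  let ?tgt = "?P 0" and ?src = "?P (Suc 0)"
  note P = module_free_module[OF A.R.cring_axioms]
  have e: "e \<in> mod_hom B ?tgt A" "e ` carrier ?tgt = carrier A"
    and d: "\<And>i. d i \<in> mod_hom B (?P (Suc i)) (?P i)"
    and ker_e: "d 0 ` carrier ?src = {v \<in> carrier ?tgt. e v = \<zero>\<^bsub>A\<^esub>}"
    and ker_d: "\<And>i. d (Suc i) ` carrier (?P (Suc (Suc i))) = {v \<in> carrier (?P (Suc i)). d i v = \<zero>\<^bsub>?P i\<^esub>}"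
    using res unfolding free_resolution_def One_nat_def by blast+
  interpret P0: module B "?P 0" by (rule P)
  interpret P1: module B "?P (Suc 0)" by (rule P)
  interpret P2: module B "?P (Suc (Suc 0))" by (rule P)
  have dP: "d 0 x \<in> carrier ?tgt" "d 0 (x \<oplus>\<^bsub>?src\<^esub> y) = d 0 x \<oplus>\<^bsub>?tgt\<^esub> d 0 y"
    "d 0 (r \<odot>\<^bsub>?src\<^esub> x) = r \<odot>\<^bsub>?tgt\<^esub> d 0 x"
    if "x \<in> carrier ?src" "y \<in> carrier ?src" "r \<in> carrier B" for x y r
    using d[of 0] that by (auto simp: mod_hom_def)
  have "a \<in> e ` carrier ?tgt" unfolding e(2) by (rule a(1))
  then obtain v where v: "v \<in> carrier ?tgt" "e v = a" by (elim imageE) simp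
  have "e (f \<odot>\<^bsub>?tgt\<^esub> v) = \<zero>\<^bsub>A\<^esub>" using e(1) v f a(2) by (simp add: mod_hom_def)
  then have "f \<odot>\<^bsub>?tgt\<^esub> v \<in> d 0 ` carrier ?src"
    unfolding ker_e using P0.smult_closed[OF f v(1)] by simp
  then obtain w where w: "w \<in> carrier ?src" "d 0 w = f \<odot>\<^bsub>?tgt\<^esub> v" by (elim imageE) simp
  let ?U = "multiples f ?src +>\<^bsub>?src\<^esub> w"
  have "d 0 x \<in> multiples f ?tgt" if x: "x \<in> ?U" for x
  proof -
    obtain m where m: "m \<in> carrier ?src" "x = (f \<odot>\<^bsub>?src\<^esub> m) \<oplus>\<^bsub>?src\<^esub> w"
      using x unfolding mem_coset_multiples by blast
    then have "d 0 x = f \<odot>\<^bsub>?tgt\<^esub> (d 0 m \<oplus>\<^bsub>?tgt\<^esub> v)"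
      using w v f dP[of m m f] dP[of "f \<odot>\<^bsub>?src\<^esub> m" w f] by (simp add: P0.smult_r_distr)
    then show ?thesis using dP(1)[OF m(1) m(1) f] v by (auto simp: multiples_def)
  qed
  moreover have "d 0 x \<in> carrier ?tgt" if x: "x \<in> ?U" for x
  proof -
    obtain m where "m \<in> carrier ?src" "x = (f \<odot>\<^bsub>?src\<^esub> m) \<oplus>\<^bsub>?src\<^esub> w"
      using x unfolding mem_coset_multiples by blast
    then show ?thesis using w(1) f dP(1)[of x x f] by simp
  qed
  ultimately have c: "multiples f ?tgt +>\<^bsub>?tgt\<^esub> d 0 x = multiples f ?tgt" if "x \<in> ?U" for x
    using coset_multiples_eq_0_iff[OF P0.module_axioms f] that by simp
  have wU: "w \<in> ?U"
    unfolding mem_coset_multiples using w(1) f by (intro bexI[of _ "\<zero>\<^bsub>?src\<^esub>"]) simp_all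
  then have "map_reduction f ?tgt (d 0) ?U = \<zero>\<^bsub>mod_reduction f ?tgt\<^esub>"
    unfolding map_reduction_def mod_reduction_carrier using c by blast
  moreover have "?U \<in> carrier (mod_reduction f ?src)"
    using w(1) by (auto simp: mod_reduction_carrier)
  ultimately have "?U \<in> map_reduction f ?src (d (Suc 0)) ` carrier (mod_reduction f (?P (Suc (Suc 0))))"
    unfolding ex by simp
  then obtain U' where U': "U' \<in> carrier (mod_reduction f (?P (Suc (Suc 0))))"
    "?U = map_reduction f ?src (d (Suc 0)) U'" by (elim imageE)
  have "w \<in> map_reduction f ?src (d (Suc 0)) U'" using wU unfolding U'(2) .
  then obtain x where x: "x \<in> U'" "w \<in> multiples f ?src +>\<^bsub>?src\<^esub> d (Suc 0) x"
    unfolding map_reduction_def One_nat_def by (elim UN_E)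
  obtain y where "y \<in> carrier (?P (Suc (Suc 0)))" "U' = multiples f (?P (Suc (Suc 0))) +>\<^bsub>?P (Suc (Suc 0))\<^esub> y"
    using U'(1) by (auto simp: mod_reduction_carrier numeral_2_eq_2)
  then have xc: "x \<in> carrier (?P (Suc (Suc 0)))"
    using x(1) f by (auto simp: mem_coset_multiples)
  obtain m where m: "m \<in> carrier ?src" "w = (f \<odot>\<^bsub>?src\<^esub> m) \<oplus>\<^bsub>?src\<^esub> d (Suc 0) x"
    using x(2) unfolding mem_coset_multiples by blast
  have dx: "d (Suc 0) x \<in> carrier ?src" "d 0 (d (Suc 0) x) = \<zero>\<^bsub>?tgt\<^esub>"
    using ker_d[of 0] xc by (auto simp: numeral_2_eq_2)
  have dm: "d 0 m \<in> carrier ?tgt" by (rule dP(1)[OF m(1) m(1) f])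
  have fv: "f \<odot>\<^bsub>?tgt\<^esub> v = f \<odot>\<^bsub>?tgt\<^esub> d 0 m"
    using w(2) m f dx dm dP(2)[of "f \<odot>\<^bsub>?src\<^esub> m" "d (Suc 0) x" f] dP(3)[of m m f] by simp
  have "v = d 0 m"
  proof
    fix j
    have c: "v j \<in> carrier B" "d 0 m j \<in> carrier B" using v(1) dm by (auto simp: free_module_def)
    have "f \<otimes>\<^bsub>B\<^esub> v j = f \<otimes>\<^bsub>B\<^esub> d 0 m j" using fun_cong[OF fv, of j] by (simp add: free_module_def)
    then have "f \<otimes>\<^bsub>B\<^esub> (v j \<ominus>\<^bsub>B\<^esub> d 0 m j) = \<zero>\<^bsub>B\<^esub>"
      using c f by (simp add: a_minus_def A.R.r_distr A.R.r_minus A.R.r_neg)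
    then have "v j \<ominus>\<^bsub>B\<^esub> d 0 m j = \<zero>\<^bsub>B\<^esub>" using reg c by simp
    then show "v j = d 0 m j" using c by simp
  qed
  then show ?thesis using v(2) ker_e m(1) by auto
qed

text \<open>
  The homomorphism from \<open>M \<otimes> B\<close> to \<open>M\<close>, \<open>m \<otimes> r \<mapsto> r m\<close>, on formal sums. It detects whether \<open>m \<otimes> 1\<close> is zero.
\<close>

definition tensor_eval :: "('b, 'm) module \<Rightarrow> ('m \<times> 'b) list \<Rightarrow> 'm" where
  "tensor_eval M xs = foldr (\<lambda>(m, r) s. (r \<odot>\<^bsub>M\<^esub> m) \<oplus>\<^bsub>M\<^esub> s) xs \<zero>\<^bsub>M\<^esub>"

lemma self_module_simps [simp]:
  "carrier (self_module Q) = carrier Q" "add (self_module Q) = add Q" "zero (self_module Q) = zero Q"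
  "module.smult (self_module Q) = monoid.mult Q"
  by (simp_all add: self_module_def)

lemma module_self_module:
  assumes "cring Q" shows "module Q (self_module Q)"
proof -
  interpret cring Q by fact
  have "abelian_group (self_module Q)"
  proof (rule abelian_groupI)
    show "\<exists>y\<in>carrier (self_module Q). y \<oplus>\<^bsub>self_module Q\<^esub> x = \<zero>\<^bsub>self_module Q\<^esub>" if "x \<in> carrier (self_module Q)" for x
      using that l_neg a_inv_closed by auto
  qed (auto simp: a_ac)
  then show ?thesis by (intro moduleI) (auto simp: assms l_distr r_distr m_assoc)
qed

lemma tensor_eval_closed:
  assumes "module R M" shows "set xs \<subseteq> carrier M \<times> carrier R \<Longrightarrow> tensor_eval M xs \<in> carrier M"
proof -
  interpret module R M by fact
  show "set xs \<subseteq> carrier M \<times> carrier R \<Longrightarrow> tensor_eval M xs \<in> carrier M"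
    by (induction xs) (auto simp: tensor_eval_def)
qed

lemma tensor_eval_append:
  assumes M: "module R M" and "set xs \<subseteq> carrier M \<times> carrier R" "set ys \<subseteq> carrier M \<times> carrier R"
  shows "tensor_eval M (xs @ ys) = tensor_eval M xs \<oplus>\<^bsub>M\<^esub> tensor_eval M ys"
proof -
  interpret module R M by fact
  show ?thesis using assms(2)
  proof (induction xs)
    case Nil then show ?case using tensor_eval_closed[OF M assms(3)] by (simp add: tensor_eval_def)
  next
    case (Cons x xs)
    then show ?case
      using tensor_eval_closed[OF M, of xs] tensor_eval_closed[OF M assms(3)]
      by (cases x) (auto simp: tensor_eval_def M.a_assoc)
  qed
qed

lemma tensor_eval_cong:
  assumes M: "module R M" and "tensor_eq R M (self_module R) xs ys"
  shows "set xs \<subseteq> carrier M \<times> carrier R \<and> set ys \<subseteq> carrier M \<times> carrier R \<and>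
    tensor_eval M xs = tensor_eval M ys"
proof -
  interpret module R M by fact
  note closed = tensor_eval_closed[OF M] and append = tensor_eval_append[OF M]
  show ?thesis using assms(2)
  proof (induction rule: tensor_eq.induct)
    case (append xs xs' ys ys') then show ?case by (simp add: tensor_eval_append[OF M])
  next
    case (commute xs ys)
    then show ?case using closed[of xs] closed[of ys] by (simp add: append M.a_comm)
  next
    case (balanced r m n)
    then have "n \<odot>\<^bsub>M\<^esub> (r \<odot>\<^bsub>M\<^esub> m) = (r \<otimes>\<^bsub>R\<^esub> n) \<odot>\<^bsub>M\<^esub> m" using R.m_comm[of r n] by (simp add: smult_assoc1)
    then show ?case using balanced by (simp add: tensor_eval_def)
  qed (auto simp: tensor_eval_def smult_l_distr smult_r_distr M.a_assoc)
qed

text \<open>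
  Multiplication by \<open>c\<close> is an injection of \<open>Q\<close> into itself, and \<open>U \<otimes> 1\<close> lies in the kernel of the induced map.
\<close>

lemma flat_module_regular:
  assumes flat: "flat_module Q M" and c: "non_zero_divisor Q c"
    and U: "U \<in> carrier M" "c \<odot>\<^bsub>M\<^esub> U = \<zero>\<^bsub>M\<^esub>"
  shows "U = \<zero>\<^bsub>M\<^esub>"
proof -
  interpret module Q M using flat by (simp add: flat_module_def)
  have cc: "c \<in> carrier Q" using c by (simp add: non_zero_divisor_def)
  let ?N = "self_module Q" and ?g = "\<lambda>x. c \<otimes>\<^bsub>Q\<^esub> x"
  have N: "module Q ?N" by (rule module_self_module[OF R.cring_axioms])
  have g: "?g \<in> mod_hom Q ?N ?N" using cc by (auto simp: mod_hom_def R.r_distr R.m_lcomm)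
  have "inj_on ?g (carrier ?N)"
  proof (rule inj_onI)
    fix x y assume xy: "x \<in> carrier ?N" "y \<in> carrier ?N" "c \<otimes>\<^bsub>Q\<^esub> x = c \<otimes>\<^bsub>Q\<^esub> y"
    then have "c \<otimes>\<^bsub>Q\<^esub> (x \<ominus>\<^bsub>Q\<^esub> y) = \<zero>\<^bsub>Q\<^esub>" using cc by (simp add: a_minus_def R.r_distr R.r_minus R.r_neg)
    then have "x \<ominus>\<^bsub>Q\<^esub> y = \<zero>\<^bsub>Q\<^esub>" using c xy by (simp add: non_zero_divisor_def)
    then show "x = y" using xy by simp
  qed
  moreover have "tensor_eq Q M ?N (map (map_prod id ?g) [(U, \<one>\<^bsub>Q\<^esub>)]) []"
  proof -
    have "tensor_eq Q M ?N [(c \<odot>\<^bsub>M\<^esub> U, \<one>\<^bsub>Q\<^esub>)] [(U, c \<odot>\<^bsub>?N\<^esub> \<one>\<^bsub>Q\<^esub>)]"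
      by (rule tensor_eq.balanced) (use cc U in auto)
    moreover have "tensor_eq Q M ?N [(c \<odot>\<^bsub>M\<^esub> U, \<one>\<^bsub>Q\<^esub>)] []"
      unfolding U(2) by (rule tensor_eq.zero) simp
    ultimately show ?thesis by (auto intro: tensor_eq.sym tensor_eq.trans)
  qed
  moreover have "set [(U, \<one>\<^bsub>Q\<^esub>)] \<subseteq> carrier M \<times> carrier ?N" using U by simp
  ultimately have "tensor_eq Q M ?N [(U, \<one>\<^bsub>Q\<^esub>)] []"
    using flat N g unfolding flat_module_def by blast
  then have "tensor_eval M [(U, \<one>\<^bsub>Q\<^esub>)] = tensor_eval M []" using tensor_eval_cong[OF module_axioms] by blast
  then show ?thesis using U by (simp add: tensor_eval_def)
qed

text \<open>
  The previous lemma for \<open>A/f\<close>, in terms of elements of \<open>A\<close>.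
\<close>

lemma flat_reduction_regular:
  fixes A (structure)
  assumes A: "module B A" and f: "f \<in> carrier B"
    and flat: "flat_module (mod_elem B f) (mod_reduction f A)"
    and c: "c \<in> carrier B" "non_zero_divisor (mod_elem B f) (mod_elem_map B f c)"
    and a: "a \<in> carrier A" "b \<in> carrier A" "c \<odot> a = f \<odot> b"
  shows "\<exists>b\<in>carrier A. a = f \<odot> b"
proof -
  interpret A: module B A by fact
  let ?M = "mod_reduction f A" and ?U = "multiples f A +> a"
  have "multiples f A +> (q \<odot> x) = multiples f A" if q: "q \<in> mod_elem_map B f c" and x: "x \<in> ?U" for q x
  proof -
    obtain r where r: "r \<in> carrier B" "q = r \<otimes>\<^bsub>B\<^esub> f \<oplus>\<^bsub>B\<^esub> c"
      using q by (auto simp: mod_elem_map_def a_r_coset_def r_coset_def cgenideal_def)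
    obtain m where m: "m \<in> carrier A" "x = (f \<odot> m) \<oplus> a"
      using x unfolding mem_coset_multiples by blast
    have xc: "x \<in> carrier A" using m f a by simp
    have "q \<odot> x = f \<odot> (r \<odot> x) \<oplus> c \<odot> x"
      unfolding r(2) using r(1) f c(1) xc A.R.m_comm[OF r(1) f] by (simp add: A.smult_l_distr A.smult_assoc1)
    also have "c \<odot> x = f \<odot> (c \<odot> m) \<oplus> f \<odot> b"
      unfolding m(2) using m(1) f c(1) a A.R.m_comm[OF c(1) f]
      by (simp add: A.smult_r_distr A.smult_assoc1[symmetric])
    finally have "q \<odot> x = f \<odot> (r \<odot> x \<oplus> (c \<odot> m \<oplus> b))"
      using r(1) f c(1) xc m(1) a by (simp add: A.smult_r_distr)
    then have "q \<odot> x \<in> multiples f A"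
      using r(1) c(1) xc m(1) a by (auto simp: multiples_def)
    moreover have "q \<in> carrier B" using r f c(1) by simp
    ultimately show ?thesis using coset_multiples_eq_0_iff[OF A f] xc by simp
  qed
  moreover have "c \<in> mod_elem_map B f c"
    unfolding mod_elem_map_def a_r_coset_def r_coset_def cgenideal_def
    using c(1) f by (auto intro!: exI[of _ "\<zero>\<^bsub>B\<^esub>"])
  moreover have "a \<in> ?U"
    unfolding mem_coset_multiples using a(1) f by (intro bexI[of _ "\<zero>"]) simp_all
  ultimately have "mod_elem_map B f c \<odot>\<^bsub>?M\<^esub> ?U = \<zero>\<^bsub>?M\<^esub>"
    unfolding mod_reduction_def by auto
  moreover have "?U \<in> carrier ?M" using a(1) by (auto simp: mod_reduction_carrier)
  ultimately have "?U = \<zero>\<^bsub>?M\<^esub>" using flat_module_regular[OF flat c(2)] by blast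
  then have "a \<in> multiples f A"
    using coset_multiples_eq_0_iff[OF A f a(1)] by (simp add: mod_reduction_carrier)
  then show ?thesis by (auto simp: multiples_def)
qed

section \<open>Divided powers from a Frobenius lift\<close>

text \<open>
  Here \<open>c n\<close> plays the role of \<open>n!\<close> and \<open>\<beta> n\<close> that of \<open>\<langle>n\<rangle>\<close>. Write \<open>k\<close> for \<open>n div p\<close>. Then \<open>c n\<close> is a unit times
  \<open>f^k \<Phi>(c k)\<close> (\<open>c_eq\<close>), because the factors with index prime to \<open>p\<close> are units and the others are
  \<open>\<beta> (ip) = f \<Phi>(\<beta> i)\<close>. Both \<open>f^k\<close> and \<open>\<Phi>(c k)\<close> divide \<open>x^(pk)\<close>, and \<open>reg_power\<close> combines
  the two divisibilities.
\<close>

lemma divided_powers_exist: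
  fixes A (structure)
  assumes A: "algebra B A" and f: "f \<in> carrier B" and p: "1 < p"
    and \<Phi>: "\<Phi> \<in> ring_hom B B"
    and \<beta>: "\<And>n. \<beta> n \<in> carrier B"
    and \<beta>p: "\<And>n. \<beta> (n * p) = f \<otimes>\<^bsub>B\<^esub> \<Phi> (\<beta> n)"
    and \<beta>u: "\<And>n. \<not> p dvd n \<Longrightarrow> \<beta> n \<in> Units B"
    and c0: "c 0 = \<one>\<^bsub>B\<^esub>" and cS: "\<And>n. c (Suc n) = \<beta> (Suc n) \<otimes>\<^bsub>B\<^esub> c n"
    and tf: "\<And>a. a \<in> carrier A \<Longrightarrow> f \<odot> a = \<zero> \<Longrightarrow> a = \<zero>"
    and reg: "\<And>k a b. a \<in> carrier A \<Longrightarrow> b \<in> carrier A \<Longrightarrow> \<Phi> (c k) \<odot> a = f \<odot> b \<Longrightarrow>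
       \<exists>b\<in>carrier A. a = f \<odot> b"
    and \<phi>: "semilinear_multiplicative B \<Phi> A \<phi>"
    and x: "x \<in> carrier A" "\<phi> x = x [^] p" and y: "y \<in> carrier A" "\<phi> x = f \<odot> y"
  shows "\<exists>z\<in>carrier A. x [^] (n::nat) = c n \<odot> z"
proof -
  interpret A: algebra B A by fact
  have \<Phi>c: "\<Phi> b \<in> carrier B" if "b \<in> carrier B" for b using ring_hom_closed[OF \<Phi> that] .
  have cc: "c n \<in> carrier B" for n by (induction n) (auto simp: c0 cS \<beta>)
  have \<phi>c: "\<phi> a \<in> carrier A" if "a \<in> carrier A" for a
    using \<phi> that by (auto simp: semilinear_multiplicative_def)
  have \<phi>m: "\<phi> (a \<otimes> b) = \<phi> a \<otimes> \<phi> b" "\<phi> (r \<odot> a) = \<Phi> r \<odot> \<phi> a"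
    if "a \<in> carrier A" "b \<in> carrier A" "r \<in> carrier B" for a b r
    using \<phi> that by (auto simp: semilinear_multiplicative_def)
  have c_eq: "\<exists>u\<in>Units B. c n = u \<otimes>\<^bsub>B\<^esub> (f [^]\<^bsub>B\<^esub> (n div p) \<otimes>\<^bsub>B\<^esub> \<Phi> (c (n div p)))" for n
  proof (induction n)
    case 0
    show ?case using p ring_hom_one[OF \<Phi>] by (auto simp: c0 A.R.nat_pow_0 intro!: bexI[of _ "\<one>\<^bsub>B\<^esub>"])
  next
    case (Suc n)
    then obtain u where u: "u \<in> Units B" "c n = u \<otimes>\<^bsub>B\<^esub> (f [^]\<^bsub>B\<^esub> (n div p) \<otimes>\<^bsub>B\<^esub> \<Phi> (c (n div p)))" by blast
    note uc = A.R.Units_closed[OF u(1)]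
    show ?case
    proof (cases "p dvd Suc n")
      case True
      let ?k = "n div p"
      have d: "Suc n div p = Suc ?k" using True p by (simp add: div_Suc dvd_eq_mod_eq_0)
      then have n: "Suc n = Suc ?k * p" using True by (metis dvd_div_mult_self)
      have "c (Suc n) = f \<otimes>\<^bsub>B\<^esub> \<Phi> (\<beta> (Suc ?k)) \<otimes>\<^bsub>B\<^esub> (u \<otimes>\<^bsub>B\<^esub> (f [^]\<^bsub>B\<^esub> ?k \<otimes>\<^bsub>B\<^esub> \<Phi> (c ?k)))"
        unfolding cS u(2)[symmetric] by (subst n, subst \<beta>p) simp
      also have "\<dots> = u \<otimes>\<^bsub>B\<^esub> (f [^]\<^bsub>B\<^esub> Suc ?k \<otimes>\<^bsub>B\<^esub> (\<Phi> (\<beta> (Suc ?k)) \<otimes>\<^bsub>B\<^esub> \<Phi> (c ?k)))"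
        using uc f \<Phi>c[OF \<beta>] \<Phi>c[OF cc] by (simp add: A.R.m_ac A.R.nat_pow_Suc)
      also have "\<Phi> (\<beta> (Suc ?k)) \<otimes>\<^bsub>B\<^esub> \<Phi> (c ?k) = \<Phi> (c (Suc ?k))"
        unfolding cS by (rule ring_hom_mult[OF \<Phi> \<beta> cc, symmetric])
      finally show ?thesis unfolding d using u(1) by blast
    next
      case False
      then have d: "Suc n div p = n div p" by (simp add: div_Suc dvd_eq_mod_eq_0)
      have "c (Suc n) = (\<beta> (Suc n) \<otimes>\<^bsub>B\<^esub> u) \<otimes>\<^bsub>B\<^esub> (f [^]\<^bsub>B\<^esub> (n div p) \<otimes>\<^bsub>B\<^esub> \<Phi> (c (n div p)))"
        unfolding cS u(2) using uc f \<beta> \<Phi>c[OF cc] by (simp add: A.R.m_assoc)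
      moreover have "\<beta> (Suc n) \<otimes>\<^bsub>B\<^esub> u \<in> Units B" using \<beta>u[OF False] u(1) by simp
      ultimately show ?thesis unfolding d by blast
    qed
  qed
  have reg_power: "\<exists>b\<in>carrier A. a = f [^]\<^bsub>B\<^esub> j \<odot> b"
    if "a \<in> carrier A" "b \<in> carrier A" "\<Phi> (c k) \<odot> a = f [^]\<^bsub>B\<^esub> (j::nat) \<odot> b" for a b j k
    using that
  proof (induction j arbitrary: a)
    case 0 then show ?case by (intro bexI[of _ a]) (simp_all add: A.R.nat_pow_0)
  next
    case (Suc j)
    have ck: "\<Phi> (c k) \<in> carrier B" by (rule \<Phi>c[OF cc])
    have fj: "f [^]\<^bsub>B\<^esub> j \<in> carrier B" using f by simp
    have e: "f [^]\<^bsub>B\<^esub> Suc j \<odot> z = f \<odot> (f [^]\<^bsub>B\<^esub> j \<odot> z)" if "z \<in> carrier A" for z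
      unfolding A.R.nat_pow_Suc A.R.m_comm[OF fj f] using that fj f by (rule_tac A.smult_assoc1)
    obtain a1 where a1: "a1 \<in> carrier A" "a = f \<odot> a1"
      using reg[OF Suc(2) A.smult_closed[OF fj Suc(3)]] Suc(4) unfolding e[OF Suc(3)] by blast
    have "f \<odot> (\<Phi> (c k) \<odot> a1) = f \<odot> (f [^]\<^bsub>B\<^esub> j \<odot> b)"
      using Suc(4) unfolding e[OF Suc(3)] a1(2)
      using a1(1) ck f A.R.m_comm[OF ck f] by (simp add: A.smult_assoc1[symmetric])
    then have "f \<odot> (\<Phi> (c k) \<odot> a1 \<ominus> f [^]\<^bsub>B\<^esub> j \<odot> b) = \<zero>"
      using a1(1) Suc(3) ck f fj by (simp add: a_minus_def A.smult_r_distr A.smult_r_minus A.M.r_neg)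
    then have "\<Phi> (c k) \<odot> a1 \<ominus> f [^]\<^bsub>B\<^esub> j \<odot> b = \<zero>"
      using a1(1) Suc(3) ck fj by (rule_tac tf) simp_all
    then have "\<Phi> (c k) \<odot> a1 = f [^]\<^bsub>B\<^esub> j \<odot> b"
      using a1(1) Suc(3) ck fj by simp
    from Suc(1)[OF a1(1) Suc(3) this] obtain a2 where "a2 \<in> carrier A" "a1 = f [^]\<^bsub>B\<^esub> j \<odot> a2" by blast
    then show ?case unfolding a1(2) using e by auto
  qed
  have \<phi>_pow: "\<phi> (x [^] Suc k) = \<phi> x [^] Suc k" for k :: nat
  proof (induction k)
    case 0 show ?case using x(1) \<phi>c by (simp add: A.nat_pow_Suc A.nat_pow_0)
  next
    case (Suc k)
    have "\<phi> (x [^] Suc (Suc k)) = \<phi> (x [^] Suc k) \<otimes> \<phi> x"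
      unfolding A.nat_pow_Suc[of x "Suc k"] using x(1) f by (intro \<phi>m) auto
    then show ?case by (simp only: Suc A.nat_pow_Suc[of "\<phi> x" "Suc k"])
  qed
  have pow_f: "(f \<odot> y) [^] k = f [^]\<^bsub>B\<^esub> k \<odot> (y [^] k)" for k :: nat
  proof (induction k)
    case 0 show ?case using y(1) by (simp add: A.nat_pow_0 A.R.nat_pow_0)
  next
    case (Suc k)
    have "f [^]\<^bsub>B\<^esub> k \<odot> (y [^] k) \<otimes> (f \<odot> y)
        = (f [^]\<^bsub>B\<^esub> k \<otimes>\<^bsub>B\<^esub> f) \<odot> (y [^] k \<otimes> y)"
    proof -
      have "y [^] k \<otimes> (f \<odot> y) = f \<odot> (y [^] k \<otimes> y)"
        using y(1) f A.smult_assoc2[of f y "y [^] k"] by (simp add: A.m_comm)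
      then show ?thesis using y(1) f by (simp add: A.smult_assoc2 A.smult_assoc1)
    qed
    then show ?case by (simp add: Suc A.nat_pow_Suc A.R.nat_pow_Suc)
  qed
  show ?thesis
  proof (induction n rule: less_induct)
    case (less n)
    let ?k = "n div p"
    obtain u where u: "u \<in> Units B" "c n = u \<otimes>\<^bsub>B\<^esub> (f [^]\<^bsub>B\<^esub> ?k \<otimes>\<^bsub>B\<^esub> \<Phi> (c ?k))" using c_eq by blast
    note uc = A.R.Units_closed[OF u(1)]
    have ck: "\<Phi> (c ?k) \<in> carrier B" by (rule \<Phi>c[OF cc])
    have fk: "f [^]\<^bsub>B\<^esub> ?k \<in> carrier B" using f by simp
    \<comment> \<open>\<open>\<phi>\<close> need not preserve the unit, so \<open>\<phi>(x^k) = \<phi>(x)^k\<close> is available only for \<open>k > 0\<close>\<close>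
    have "\<exists>w\<in>carrier A. x [^] (p * ?k) = (f [^]\<^bsub>B\<^esub> ?k \<otimes>\<^bsub>B\<^esub> \<Phi> (c ?k)) \<odot> w"
    proof (cases ?k)
      case 0
      then show ?thesis using ring_hom_one[OF \<Phi>]
        by (intro bexI[of _ "\<one>"]) (simp_all add: A.nat_pow_0 A.R.nat_pow_0 c0)
    next
      case (Suc k)
      then have "?k < n" using p by (intro div_less_dividend) (auto intro: Nat.gr0I)
      from less[OF this] obtain z where z: "z \<in> carrier A" "x [^] ?k = c ?k \<odot> z" by blast
      have "x [^] (p * ?k) = \<phi> x [^] ?k" unfolding x(2) using x(1) by (simp add: A.nat_pow_pow)
      then have e1: "x [^] (p * ?k) = \<Phi> (c ?k) \<odot> \<phi> z"
        using \<phi>_pow[of k] unfolding Suc[symmetric] z(2) using \<phi>m(2)[OF z(1) z(1) cc] by simp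
      have e2: "x [^] (p * ?k) = f [^]\<^bsub>B\<^esub> ?k \<odot> (y [^] ?k)"
        using \<open>x [^] (p * ?k) = \<phi> x [^] ?k\<close> unfolding y(2) pow_f .
      have "y [^] ?k \<in> carrier A" using y(1) by simp
      from reg_power[OF \<phi>c[OF z(1)] this e1[symmetric, unfolded e2]]
      obtain w where w: "w \<in> carrier A" "\<phi> z = f [^]\<^bsub>B\<^esub> ?k \<odot> w" by blast
      have "x [^] (p * ?k) = (f [^]\<^bsub>B\<^esub> ?k \<otimes>\<^bsub>B\<^esub> \<Phi> (c ?k)) \<odot> w"
        unfolding e1 w(2) A.R.m_comm[OF fk ck] by (rule A.smult_assoc1[OF ck fk w(1), symmetric])
      then show ?thesis using w(1) by blast
    qed
    then obtain w where w: "w \<in> carrier A" "x [^] (p * ?k) = (f [^]\<^bsub>B\<^esub> ?k \<otimes>\<^bsub>B\<^esub> \<Phi> (c ?k)) \<odot> w" by blast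
    let ?v = "w \<otimes> x [^] (n mod p)" and ?g = "f [^]\<^bsub>B\<^esub> ?k \<otimes>\<^bsub>B\<^esub> \<Phi> (c ?k)"
    have gc: "?g \<in> carrier B" using fk ck by simp
    have vc: "?v \<in> carrier A" using w(1) x(1) by simp
    have iu: "inv\<^bsub>B\<^esub> u \<in> carrier B" using u(1) by simp
    have "x [^] n = x [^] (p * ?k) \<otimes> x [^] (n mod p)"
      using x(1) by (simp add: A.nat_pow_mult)
    also have "\<dots> = ?g \<odot> ?v"
      unfolding w(2) using gc w(1) x(1) by (intro A.smult_assoc2) auto
    also have "\<dots> = (c n \<otimes>\<^bsub>B\<^esub> inv\<^bsub>B\<^esub> u) \<odot> ?v"
    proof -
      have "c n \<otimes>\<^bsub>B\<^esub> inv\<^bsub>B\<^esub> u = (u \<otimes>\<^bsub>B\<^esub> inv\<^bsub>B\<^esub> u) \<otimes>\<^bsub>B\<^esub> ?g"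
        unfolding u(2) using uc iu fk ck by (simp only: A.R.m_ac A.R.m_closed)
      then show ?thesis using u(1) gc by simp
    qed
    also have "\<dots> = c n \<odot> (inv\<^bsub>B\<^esub> u \<odot> ?v)"
      by (rule A.smult_assoc1[OF cc iu vc])
    finally show ?case using iu vc by blast
  qed
qed

section \<open>The divided power complex\<close>

lemma frac_UP_nth: "g \<in> up frac_ring \<Longrightarrow> up_ring.coeff (UP frac_ring) g n = g n"
  by (simp add: UP_def)

lemma frac_UP_simps:
  "carrier (UP frac_ring) = up frac_ring" "\<zero>\<^bsub>UP frac_ring\<^esub> = (\<lambda>_. 0)"
  "\<one>\<^bsub>UP frac_ring\<^esub> = (\<lambda>n. if n = 0 then 1 else 0)"
  "p \<in> up frac_ring \<Longrightarrow> q \<in> up frac_ring \<Longrightarrow> p \<oplus>\<^bsub>UP frac_ring\<^esub> q = (\<lambda>n. p n + q n)"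
  "p \<in> up frac_ring \<Longrightarrow> q \<in> up frac_ring \<Longrightarrow> p \<otimes>\<^bsub>UP frac_ring\<^esub> q = (\<lambda>n. \<Sum>i\<le>n. p i * q (n - i))"
  "p \<in> up frac_ring \<Longrightarrow> c \<odot>\<^bsub>UP frac_ring\<^esub> p = (\<lambda>n. c * p n)"
  "xpow frac_ring c m = (\<lambda>n. if n = m then c else 0)"
  by (simp_all add: UP_def cong: if_cong)

lemma frac_UP_a_inv: "p \<in> up frac_ring \<Longrightarrow> \<ominus>\<^bsub>UP frac_ring\<^esub> p = (\<lambda>n. - p n)"
proof -
  assume p: "p \<in> up frac_ring"
  interpret frac_UP: UP_cring frac_ring "UP frac_ring" by unfold_locales
  have q: "(\<lambda>n. - p n) \<in> up frac_ring" using tring.up_a_inv_closed[OF p] by simp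
  show ?thesis by (rule frac_UP.P.minus_equality) (use p q in \<open>simp_all add: frac_UP_simps\<close>)
qed

lemma to_tfrac_simps: "to_tfrac (a + b) = to_tfrac a + to_tfrac b" "to_tfrac (a * b) = to_tfrac a * to_tfrac b"
  "to_tfrac 1 = 1" "to_tfrac 0 = 0" "to_tfrac a = to_tfrac b \<longleftrightarrow> a = b"
  by (simp_all add: to_tfrac_def One_tfrac Zero_tfrac eq_Tfrac)

text \<open>
  The submodule \<open>u^(-1) S\<close> of the total ring of fractions of \<open>S\<close>.
\<close>

definition fractions_over :: "'s::comm_ring_1 \<Rightarrow> 's tfrac set" where
  "fractions_over u = range (\<lambda>s. Tfrac s u)"

lemma fractions_over_closed:
  assumes u: "regular u"
  shows "0 \<in> fractions_over u" "a \<in> fractions_over u \<Longrightarrow> b \<in> fractions_over u \<Longrightarrow> a + b \<in> fractions_over u" "a \<in> fractions_over u \<Longrightarrow> - a \<in> fractions_over u"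
    "a \<in> fractions_over u \<Longrightarrow> to_tfrac s * a \<in> fractions_over u"
proof -
  have "(0 :: 'a tfrac) = Tfrac 0 u" using u by (simp add: Zero_tfrac eq_Tfrac)
  then show "0 \<in> fractions_over u" by (simp add: fractions_over_def)
  have "Tfrac s u + Tfrac t u = Tfrac (s + t) u" for s t
    using u by (simp add: eq_Tfrac algebra_simps)
  then show "a \<in> fractions_over u \<Longrightarrow> b \<in> fractions_over u \<Longrightarrow> a + b \<in> fractions_over u" by (auto simp: fractions_over_def)
  show "a \<in> fractions_over u \<Longrightarrow> - a \<in> fractions_over u" using u by (auto simp: fractions_over_def)
  show "a \<in> fractions_over u \<Longrightarrow> to_tfrac s * a \<in> fractions_over u" using u by (auto simp: fractions_over_def to_tfrac_def)
qed

lemma fractions_over_mult: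
  assumes "regular u" "regular v" "regular w" "u * v dvd w" "a \<in> fractions_over u" "b \<in> fractions_over v"
  shows "a * b \<in> fractions_over w"
proof -
  obtain s t where st: "a = Tfrac s u" "b = Tfrac t v" using assms by (auto simp: fractions_over_def)
  obtain r where r: "w = u * v * r" using assms(4) by blast
  have "a * b = Tfrac (s * t * r) w" using assms(1-3) by (simp add: st eq_Tfrac) (simp add: r mult_ac)
  then show ?thesis by (simp add: fractions_over_def)
qed

text \<open>
  The free module on the \<open>x^n/n!\<close>; that it is a ring is the integrality of the binomial coefficients.
\<close>

definition divided_coeffs :: "'a::comm_ring_1 fps fps \<Rightarrow> (nat \<Rightarrow> 'a fps tfrac) set" where
  "divided_coeffs F = {g \<in> up frac_ring. \<forall>n. g n \<in> fractions_over (bracket_fact F n)}"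

lemma divided_polys_eq:
  assumes F: "formal_group_law F" and reg: "\<And>n. regular (bracket_fact F n)"
  shows "divided_polys F = divided_coeffs F"
proof
  interpret frac_UP: UP_cring frac_ring "UP frac_ring" by unfold_locales
  let ?P = "UP frac_ring"
  let ?H = "range (\<lambda>s. xpow frac_ring (to_tfrac s) 0) \<union> {xpow frac_ring 1 1} \<union>
      range (\<lambda>n. xpow frac_ring (Tfrac 1 (bracket_fact F n)) n)"
  have mon_up: "xpow frac_ring c m \<in> up frac_ring" for c m
    using frac_UP.monom_closed[of c m] by (simp add: frac_UP_simps(1))
  then have H: "?H \<subseteq> carrier (?P)" by (auto simp: frac_UP_simps(1))
  have one: "(1 :: 'a fps tfrac) = Tfrac 1 1" by (rule One_tfrac)
  have mon_D: "xpow frac_ring c m \<in> divided_coeffs F" if "c \<in> fractions_over (bracket_fact F m)" for c m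
    using that mon_up[of c m] fractions_over_closed(1)[OF reg] by (auto simp: divided_coeffs_def frac_UP_simps(7))
  have sub: "subring (divided_coeffs F) (?P)"
  proof (rule frac_UP.P.subringI)
    show "divided_coeffs F \<subseteq> carrier (?P)" by (auto simp: divided_coeffs_def frac_UP_simps)
    show "\<one>\<^bsub>?P\<^esub> \<in> divided_coeffs F"
      using mon_D[of 1 0] one by (simp add: frac_UP_simps fractions_over_def)
    fix g h assume g: "g \<in> divided_coeffs F" and h: "h \<in> divided_coeffs F"
    then have gu: "g \<in> up frac_ring" "h \<in> up frac_ring" by (auto simp: divided_coeffs_def)
    show "\<ominus>\<^bsub>?P\<^esub> g \<in> divided_coeffs F"
      using g frac_UP.P.a_inv_closed[of g] fractions_over_closed(3)[OF reg]
      by (simp add: divided_coeffs_def frac_UP_simps(1) frac_UP_a_inv)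
    show "g \<oplus>\<^bsub>?P\<^esub> h \<in> divided_coeffs F"
      using g h frac_UP.P.a_closed[of g h] fractions_over_closed(2)[OF reg]
      by (simp add: divided_coeffs_def frac_UP_simps(1,4))
    have "(\<Sum>i\<in>A. g i * h (n - i)) \<in> fractions_over (bracket_fact F n)" if "finite A" "A \<subseteq> {..n}" for A n
      using that
    proof (induction A rule: finite_induct)
      case empty then show ?case by (simp add: fractions_over_closed(1)[OF reg])
    next
      case (insert i A)
      have "g i * h (n - i) \<in> fractions_over (bracket_fact F n)"
      proof (rule fractions_over_mult[OF reg reg reg])
        show "bracket_fact F i * bracket_fact F (n - i) dvd bracket_fact F n"
          using bracket_fact_mult_dvd[OF F, of i "n - i"] insert(4) by simp
      qed (use g h in \<open>auto simp: divided_coeffs_def\<close>)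
      then show ?case using insert fractions_over_closed(2)[OF reg] by simp
    qed
    then show "g \<otimes>\<^bsub>?P\<^esub> h \<in> divided_coeffs F"
      using gu frac_UP.P.m_closed[of g h]
      by (simp add: divided_coeffs_def frac_UP_simps(1,5))
  qed
  have "?H \<subseteq> divided_coeffs F"
    using mon_D one F by (auto simp: fractions_over_def to_tfrac_def bracket_fact_Suc)
  then show "divided_polys F \<subseteq> divided_coeffs F"
    unfolding divided_polys_def by (rule frac_UP.P.generate_ring_min_subring1[OF H sub])
  show "divided_coeffs F \<subseteq> divided_polys F"
  proof
    fix g assume g: "g \<in> divided_coeffs F"
    then have gu: "g \<in> up frac_ring" by (simp add: divided_coeffs_def)
    have mon: "xpow frac_ring (g i) i \<in> divided_polys F" for i
    proof -
      obtain s where s: "g i = Tfrac s (bracket_fact F i)" using g by (auto simp: divided_coeffs_def fractions_over_def)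
      have "xpow frac_ring (g i) i = xpow frac_ring (to_tfrac s) 0 \<otimes>\<^bsub>?P\<^esub> xpow frac_ring (Tfrac 1 (bracket_fact F i)) i"
        using frac_UP.monom_mult[of "to_tfrac s" "Tfrac 1 (bracket_fact F i)" 0 i] reg
        by (simp add: s to_tfrac_def)
      moreover have "xpow frac_ring (to_tfrac s) 0 \<in> divided_polys F"
        "xpow frac_ring (Tfrac 1 (bracket_fact F i)) i \<in> divided_polys F"
        unfolding divided_polys_def by (rule generate_ring.incl, blast)+
      ultimately show ?thesis unfolding divided_polys_def by (simp only: generate_ring.eng_mult)
    qed
    have "(\<Oplus>\<^bsub>?P\<^esub>i\<in>A. xpow frac_ring (g i) i) \<in> divided_polys F" if "finite A" for A
      using that
    proof (induction A rule: finite_induct)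
      case empty show ?case unfolding divided_polys_def by (simp add: frac_UP.P.zero_in_generate)
    next
      case (insert i A)
      have "(\<Oplus>\<^bsub>?P\<^esub>i\<in>insert i A. xpow frac_ring (g i) i)
        = xpow frac_ring (g i) i \<oplus>\<^bsub>?P\<^esub> (\<Oplus>\<^bsub>?P\<^esub>i\<in>A. xpow frac_ring (g i) i)"
        using insert(1,2) mon_up by (intro frac_UP.P.finsum_insert) (auto simp: frac_UP_simps(1))
      then show ?case
        using mon[of i] insert(3) unfolding divided_polys_def by (simp only: generate_ring.eng_add)
    qed
    from this[of "{..deg frac_ring g}"] show "g \<in> divided_polys F"
      using frac_UP.up_repr_le[of g "deg frac_ring g"] gu by (simp add: frac_UP_simps(1) frac_UP_nth)
  qed
qed

text \<open>
  The differential maps \<open>x^(n+1)/(n+1)!\<close> to \<open>x^n/n!\<close>, hence is onto; a polynomial in its kernel is constant.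
\<close>

lemma divided_cohomology:
  assumes F: "formal_group_law F" and reg: "\<And>n. regular (bracket_fact F n)"
    and regb: "\<And>n. 0 < n \<Longrightarrow> regular (bracket F n)"
  shows "\<exists>h. h \<in> mod_iso pseries_ring (self_module pseries_ring) (cohomology (FOmega_divided F) 0)"
    "0 < i \<Longrightarrow> carrier (cohomology (FOmega_divided F) i) = {\<zero>\<^bsub>cohomology (FOmega_divided F) i\<^esub>}"
proof -
  let ?C = "FOmega_divided F" and ?D = "divided_coeffs F" and ?M = "divided_module F"
  let ?Z = "?M\<lparr>carrier := {\<lambda>_. 0}\<rparr>"
  have up: "g \<in> up frac_ring" if "g \<in> ?D" for g using that by (simp add: divided_coeffs_def)
  have M: "carrier ?M = ?D" "zero ?M = (\<lambda>_. 0)"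
    "\<And>g h. g \<in> ?D \<Longrightarrow> h \<in> ?D \<Longrightarrow> g \<oplus>\<^bsub>?M\<^esub> h = (\<lambda>n. g n + h n)"
    "\<And>s g. g \<in> ?D \<Longrightarrow> s \<odot>\<^bsub>?M\<^esub> g = (\<lambda>n. to_tfrac s * g n)"
    using up by (simp_all add: divided_module_def divided_polys_eq[OF F reg] frac_UP_simps)
  have zD: "(\<lambda>_. 0) \<in> ?D"
    using tring.zero_up fractions_over_closed(1)[OF reg] by (simp add: divided_coeffs_def)
  have aD: "(\<lambda>n. g n + h n) \<in> ?D" if "g \<in> ?D" "h \<in> ?D" for g h
    using that tring.up_add_closed[of g h] fractions_over_closed(2)[OF reg] by (simp add: divided_coeffs_def)
  have sD: "(\<lambda>n. to_tfrac s * g n) \<in> ?D" if "g \<in> ?D" for g s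
    using that tring.up_smult_closed[of "to_tfrac s" g] fractions_over_closed(4)[OF reg] by (simp add: divided_coeffs_def)
  have nD: "(\<lambda>n. - g n) \<in> ?D" if "g \<in> ?D" for g
    using that tring.up_a_inv_closed[of g] fractions_over_closed(3)[OF reg] by (simp add: divided_coeffs_def)
  have "abelian_group ?M"
  proof (rule abelian_groupI)
    show "\<exists>h\<in>carrier ?M. h \<oplus>\<^bsub>?M\<^esub> g = \<zero>\<^bsub>?M\<^esub>" if "g \<in> carrier ?M" for g
      using that nD by (intro bexI[of _ "\<lambda>n. - g n"]) (auto simp: M)
  qed (auto simp: M zD aD add_ac)
  then have mM: "module pseries_ring ?M"
    by (intro moduleI)
      (auto simp: M aD sD to_tfrac_simps distrib_left distrib_right mult.assoc tring.cring_axioms)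
  have mZ: "module pseries_ring ?Z"
    using submodule.submodule_is_module[OF submodule_zero[OF mM] mM] by (simp add: M)
  have C: "cmod ?C 0 = ?M" "cmod ?C (Suc 0) = ?M" "cmod ?C (Suc (Suc j)) = ?Z"
    "cdiff ?C 0 = (\<lambda>g n. to_tfrac (bracket F (Suc n)) * g (Suc n))" "cdiff ?C (Suc j) = (\<lambda>_ _. 0)" for j
    by (simp_all add: FOmega_divided_def tring.FOmega_simps frac_UP_simps)
  have down: "to_tfrac (bracket F (Suc n)) * Tfrac s (bracket_fact F (Suc n)) = Tfrac s (bracket_fact F n)" for s n
    using reg[of n] reg[of "Suc n"] by (simp add: to_tfrac_def eq_Tfrac bracket_fact_Suc mult_ac)
  have dD: "(\<lambda>n. to_tfrac (bracket F (Suc n)) * g (Suc n)) \<in> ?D" if g: "g \<in> ?D" for g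
  proof -
    have "(\<lambda>n. to_tfrac (bracket F (Suc n)) * g (Suc n)) \<in> up frac_ring"
      using tring.weighted_up[of "\<lambda>n. to_tfrac (bracket F (Suc n))", OF _ up[OF g]] by simp
    moreover have "to_tfrac (bracket F (Suc n)) * g (Suc n) \<in> fractions_over (bracket_fact F n)" for n
    proof -
      obtain s where "g (Suc n) = Tfrac s (bracket_fact F (Suc n))" using g by (auto simp: divided_coeffs_def fractions_over_def)
      then show ?thesis by (simp add: down fractions_over_def)
    qed
    ultimately show ?thesis by (simp add: divided_coeffs_def)
  qed
  have "cdiff ?C i \<in> mod_hom pseries_ring (cmod ?C i) (cmod ?C (Suc i))" for i
  proof (cases i)
    case 0
    then show ?thesis using dD by (auto simp: C mod_hom_def M aD sD distrib_left mult_ac)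
  next
    case (Suc j)
    then show ?thesis by (cases j) (auto simp: C mod_hom_def M zD)
  qed
  moreover have "module pseries_ring (cmod ?C i)" for i
  proof (cases i)
    case (Suc j)
    then show ?thesis using mM mZ by (cases j) (simp_all add: C)
  qed (simp add: C mM)
  ultimately have cc: "cochain_complex pseries_ring ?C"
    by (simp add: cochain_complex_def C M)
  have z0: "g = (\<lambda>n. if n = 0 then g 0 else 0)"
    if g: "g \<in> ?D" "\<And>n. to_tfrac (bracket F (Suc n)) * g (Suc n) = 0" for g
  proof
    fix n show "g n = (if n = 0 then g 0 else 0)"
    proof (cases n)
      case (Suc m)
      have "g (Suc m) \<in> fractions_over (bracket_fact F (Suc m))" using g(1) by (simp add: divided_coeffs_def)
      then obtain s where s: "g (Suc m) = Tfrac s (bracket_fact F (Suc m))" by (auto simp: fractions_over_def)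
      have "Tfrac s (bracket_fact F m) = 0" using g(2)[of m] by (simp add: s down)
      then have "s = 0" using reg by (simp add: Zero_tfrac eq_Tfrac)
      then show ?thesis using reg Suc by (simp add: s Zero_tfrac eq_Tfrac)
    qed simp
  qed
  have conD: "(\<lambda>n. if n = 0 then to_tfrac s else 0) \<in> ?D" for s
  proof -
    have "(\<lambda>n::nat. if n = 0 then to_tfrac s else 0) \<in> up frac_ring" by (rule tring.up_I[of _ 0]) auto
    then show ?thesis using fractions_over_closed(1)[OF reg] by (auto simp: divided_coeffs_def fractions_over_def to_tfrac_def)
  qed
  have "(\<lambda>s. cohom_class ?C 0 (\<lambda>n. if n = 0 then to_tfrac s else 0))
      \<in> mod_iso pseries_ring (self_module pseries_ring) (cohomology ?C 0)"
  proof (rule cohom_class_iso[OF cc])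
    show "(\<lambda>s n. if n = 0 then to_tfrac s else 0) \<in> mod_hom pseries_ring (self_module pseries_ring) (cmod ?C 0)"
      using conD by (auto simp: mod_hom_def C M to_tfrac_simps fun_eq_iff)
    show "cdiff ?C 0 (\<lambda>n. if n = 0 then to_tfrac s else 0) = \<zero>\<^bsub>cmod ?C (Suc 0)\<^esub>" for s
      by (simp add: C M)
    fix s t w assume "w \<in> coboundaries ?C 0"
      "(\<lambda>n. if n = 0 then to_tfrac s else 0) = w \<oplus>\<^bsub>cmod ?C 0\<^esub> (\<lambda>n. if n = 0 then to_tfrac t else 0)"
    then have "(\<lambda>n::nat. if n = 0 then to_tfrac s else 0) = (\<lambda>n. if n = 0 then to_tfrac t else 0)"
      using zD conD by (simp add: coboundaries_def C M)
    from fun_cong[OF this, of 0] show "s = t" by (simp add: to_tfrac_simps)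
  next
    fix g assume "g \<in> cocycles ?C 0"
    then have g: "g \<in> ?D" "\<And>n. to_tfrac (bracket F (Suc n)) * g (Suc n) = 0"
      by (auto simp: cocycles_def C M fun_eq_iff)
    have "g 0 \<in> fractions_over (bracket_fact F 0)" using g(1) unfolding divided_coeffs_def by blast
    then obtain s where s: "g 0 = to_tfrac s" by (auto simp: fractions_over_def to_tfrac_def)
    have e: "g = (\<lambda>n. if n = 0 then to_tfrac s else 0)" by (rule z0[OF g, unfolded s])
    show "\<exists>s\<in>carrier (self_module pseries_ring). \<exists>w\<in>coboundaries ?C 0.
        g = w \<oplus>\<^bsub>cmod ?C 0\<^esub> (\<lambda>n. if n = 0 then to_tfrac s else 0)"
      unfolding e using zD conD
      by (rule_tac bexI[of _ s], rule_tac bexI[of _ "\<lambda>_. 0"]) (simp_all add: coboundaries_def C M)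
  qed
  then show "\<exists>h. h \<in> mod_iso pseries_ring (self_module pseries_ring) (cohomology ?C 0)" by blast
  have "cocycles ?C i = coboundaries ?C i" if "0 < i" for i
  proof -
    obtain j where j: "i = Suc j" using \<open>0 < i\<close> by (cases i) auto
    show ?thesis
    proof (cases j)
      case 0
      have "g \<in> (\<lambda>g n. to_tfrac (bracket F (Suc n)) * g (Suc n)) ` ?D" if g: "g \<in> ?D" for g
      proof -
        have "\<exists>s. g n = Tfrac s (bracket_fact F n)" for n using g by (auto simp: divided_coeffs_def fractions_over_def)
        then obtain s where s: "\<And>n. g n = Tfrac (s n) (bracket_fact F n)" by metis
        \<comment> \<open>the test \<open>g m = 0\<close> keeps the support finite, as \<open>s m\<close> is an arbitrary choice of a numerator\<close>
        define h where "h = (\<lambda>n. case n of 0 \<Rightarrow> 0 | Suc m \<Rightarrow> if g m = 0 then 0 else Tfrac (s m) (bracket_fact F n))"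
        obtain N where N: "\<And>n. N < n \<Longrightarrow> g n = 0"
          by (rule tring.up_E[OF up[OF g]], rule that) simp
        have "h \<in> up frac_ring"
          by (rule tring.up_I[of _ "Suc N"]) (auto simp: h_def N split: nat.split)
        moreover have "h n \<in> fractions_over (bracket_fact F n)" for n
          using fractions_over_closed(1)[OF reg[of n]] rangeI[of "\<lambda>s. Tfrac s (bracket_fact F n)"]
          by (cases n) (simp_all add: h_def fractions_over_def[symmetric])
        ultimately have "h \<in> ?D" by (simp add: divided_coeffs_def)
        moreover have "g n = to_tfrac (bracket F (Suc n)) * h (Suc n)" for n
          using s[of n] by (simp add: h_def down)
        ultimately show ?thesis by (intro image_eqI[of _ _ h]) auto
      qed
      then show ?thesis using j 0 dD by (auto simp: cocycles_def coboundaries_def C M)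
    next
      case (Suc k)
      then show ?thesis using j zD by (cases k) (auto simp: cocycles_def coboundaries_def C M)
    qed
  qed note e = this
  assume i: "0 < i"
  let ?N = "(cmod ?C i)\<lparr>carrier := coboundaries ?C i\<rparr>"
  have ag: "abelian_group ?N" "subgroup (coboundaries ?C i) (add_monoid ?N)"
    using cohomology_groups[OF cc, of i] e[OF i] by (auto simp: additive_subgroup_def)
  then have "coboundaries ?C i +>\<^bsub>?N\<^esub> z = coboundaries ?C i" if "z \<in> coboundaries ?C i" for z
    using abelian_group.a_coset_join2[OF ag(1) _ ag(2)] that by simp
  moreover have "coboundaries ?C i \<noteq> {}" using ag(2) by (auto simp: subgroup_def)
  ultimately show "carrier (cohomology ?C i) = {\<zero>\<^bsub>cohomology ?C i\<^esub>}"
    unfolding cohomology_def e[OF i] by (auto simp: quot_module_def A_RCOSETS_def')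
qed

section \<open>Application to the brackets of a formal group law\<close>

lemma regular_bracket:
  assumes F: "formal_group_law F" and n: "non_zero_divisor pseries_ring (nseries F n)"
  shows "regular (bracket F n)"
  unfolding regular_def
proof (intro allI impI)
  fix a assume "bracket F n * a = 0"
  then have "nseries F n * a = 0" by (simp add: nseries_eq_bracket[OF F] mult.assoc)
  then show "a = 0" using n by (simp add: non_zero_divisor_def)
qed

lemma regular_bracket_fact:
  assumes "\<And>n. 0 < n \<Longrightarrow> regular (bracket F n)"
  shows "regular (bracket_fact F n)"
  by (induction n) (auto simp: bracket_fact_Suc assms)

lemma bracket_unit_mod_bracket:
  assumes F: "formal_group_law F" and p: "prime p" and n: "\<not> p dvd n"
  shows "\<exists>m s. bracket F n * m = 1 + bracket F p * s"
proof (rule bracket_coprime_unit[OF F])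
  show "coprime n p" using prime_imp_coprime[OF p n] by (simp add: coprime_commute)
  show "n \<noteq> 0" using n by (metis dvd_0_right)
qed

text \<open>
  Modulo \<open>\<langle>p\<rangle>\<close>, the brackets are zero or units according to divisibility of the index by \<open>p\<close>.
\<close>

lemma reduction_cohomology:
  assumes F: "formal_group_law F" and p: "prime p"
  defines "Q \<equiv> mod_elem pseries_ring (bracket F p)" and "\<psi> \<equiv> mod_elem_map pseries_ring (bracket F p)"
  shows "\<exists>h. (\<forall>i. h i \<in> mod_iso Q (cmod (FOmega F Q \<psi>) i) (cohomology (FOmega F Q \<psi>) i)) \<and>
    (\<forall>n. h 0 (xpow Q \<one>\<^bsub>Q\<^esub> n) = cohom_class (FOmega F Q \<psi>) 0 (xpow Q \<one>\<^bsub>Q\<^esub> (n * p))) \<and>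
    (\<forall>n. h 1 (xpow Q \<one>\<^bsub>Q\<^esub> n) = cohom_class (FOmega F Q \<psi>) 1 (xpow Q \<one>\<^bsub>Q\<^esub> (n * p + (p - 1))))"
proof -
  note m = tring.mod_elem_simps[of "bracket F p", simplified, folded Q_def \<psi>_def]
  interpret Q: cring Q by (rule m(1))
  have closed: "\<psi> a \<in> carrier Q" for a using m(3) by blast
  have zero: "\<psi> (bracket F p * a) = \<zero>\<^bsub>Q\<^esub>" for a using m(4) by blast
  show ?thesis
  proof (rule Q.FOmega_mod_iso)
    show "0 < p" using p by (rule prime_gt_0_nat)
    show "\<psi> (bracket F n) \<in> carrier Q" for n by (rule closed)
    show "\<psi> (bracket F (n * p)) = \<zero>\<^bsub>Q\<^esub>" for n unfolding bracket_mult[OF F] by (rule zero)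
    show "\<psi> (bracket F n) \<in> Units Q" if n: "\<not> p dvd n" for n
    proof -
      obtain a s where as: "bracket F n * a = 1 + bracket F p * s"
        using bracket_unit_mod_bracket[OF F p n] by blast
      have "\<psi> (bracket F n) \<otimes>\<^bsub>Q\<^esub> \<psi> a = \<psi> (1 + bracket F p * s)"
        using ring_hom_mult[OF m(2), of "bracket F n" a] by (simp add: as)
      also have "\<dots> = \<one>\<^bsub>Q\<^esub>"
        using ring_hom_add[OF m(2), of 1 "bracket F p * s"] ring_hom_one[OF m(2)] by (simp add: zero)
      finally have "\<psi> (bracket F n) \<otimes>\<^bsub>Q\<^esub> \<psi> a \<in> Units Q" by simp
      then show ?thesis by (rule Q.unit_factor) (rule closed)+
    qed
  qed
qed

text \<open>
  The factorization \<open>\<langle>np\<rangle> = \<langle>p\<rangle> \<phi>(\<langle>n\<rangle>)\<close> relates the two differentials; the brackets prime to \<open>p\<close> are units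
  in the completion, because they are units modulo \<open>\<langle>p\<rangle>\<close>.
\<close>

lemma decalage_quasi_iso:
  assumes F: "formal_group_law F" and p: "prime p" and reg: "regular (bracket F p)"
    and \<psi>: "\<psi> = completion_map pseries_ring (bracket_ideal F p) \<circ> frob F p"
  defines "B \<equiv> adic_completion pseries_ring (bracket_ideal F p)"
    and "\<iota> \<equiv> completion_map pseries_ring (bracket_ideal F p)"
  shows "\<exists>u. quasi_iso B (FOmega F B \<psi>) (eta B (\<iota> (bracket F p)) (FOmega F B \<iota>)) u \<and>
     (\<forall>n. u 0 (xpow B \<one>\<^bsub>B\<^esub> n) = xpow B \<one>\<^bsub>B\<^esub> (n * p)) \<and>
     (\<forall>n. u 1 (xpow B \<one>\<^bsub>B\<^esub> n) = xpow B (\<iota> (bracket F p)) (n * p + (p - 1)))"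
proof -
  interpret adic "bracket_ideal F p"
    by (rule adic.intro, unfold bracket_ideal_def, rule tring.genideal_ideal) simp
  note defs = B_def[symmetric] \<iota>_def[symmetric]
  note closed = iota_closed[unfolded defs] and mult = iota_mult[unfolded defs]
  interpret B: cring B unfolding B_def by (rule cring_B)
  show ?thesis
  proof (rule B.FOmega_eta_quasi_iso)
    show "0 < p" using p by (rule prime_gt_0_nat)
    show "\<iota> (bracket F n) \<in> carrier B" "\<iota> (bracket F p) \<in> carrier B" for n by (rule closed)+
    show "\<psi> (bracket F n) \<in> carrier B" for n unfolding \<psi> defs o_def by (rule closed)
    show "b = \<zero>\<^bsub>B\<^esub>" if "b \<in> carrier B" "\<iota> (bracket F p) \<otimes>\<^bsub>B\<^esub> b = \<zero>\<^bsub>B\<^esub>" for b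
      using principal_completion_regular[OF reg, of b] that unfolding B_def \<iota>_def bracket_ideal_def by blast
    show "\<iota> (bracket F (n * p)) = \<iota> (bracket F p) \<otimes>\<^bsub>B\<^esub> \<psi> (bracket F n)" for n
      unfolding bracket_mult[OF F] mult \<psi> defs o_def ..
    show "\<iota> (bracket F n) \<in> Units B" if n: "\<not> p dvd n" for n
    proof -
      obtain a s where as: "bracket F n * a = 1 + bracket F p * s"
        using bracket_unit_mod_bracket[OF F p n] by blast
      have "bracket F p * s \<in> bracket_ideal F p"
        unfolding bracket_ideal_def Idl_tring_singleton by blast
      with as show ?thesis by (rule iota_unit_of_mult[unfolded defs])
    qed
  qed
qed

text \<open>
  The hypothesis for \<open>n = p\<close> makes \<open>p\<close> regular modulo \<open>\<langle>p\<rangle>\<close>, because \<open>\<phi>(p!)\<close> is a multiple of \<open>\<phi>(\<langle>p\<rangle>)\<close>, which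
  is congruent to \<open>p\<close>. By \<open>p_completion_regular\<close>, \<open>\<langle>p\<rangle>\<close> is then regular in the completion, and \<open>A\<close> has no
  \<open>\<langle>p\<rangle>\<close>-torsion.
\<close>

lemma divided_powers_in_flat_algebra:
  fixes F :: "'a::comm_ring_1 fps fps" and A :: "(nat \<Rightarrow> 'a fps set, 'c) module"
  assumes F: "formal_group_law F" and p: "prime p" and reg: "regular (bracket F p)"
  defines "B \<equiv> adic_completion pseries_ring (p_bracket_ideal F p)"
    and "\<iota> \<equiv> completion_map pseries_ring (p_bracket_ideal F p)"
  defines "f \<equiv> \<iota> (bracket F p)"
  assumes \<Phi>: "\<Phi> \<in> frob_extensions F p (p_bracket_ideal F p)"
    and nz: "\<And>n. non_zero_divisor (mod_elem B f) (mod_elem_map B f (\<Phi> (\<iota> (bracket_fact F n))))"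
    and A: "algebra B A" and flat: "completely_flat B f A" and \<phi>: "semilinear_multiplicative B \<Phi> A \<phi>"
    and x: "x \<in> carrier A" "\<phi> x = x [^]\<^bsub>A\<^esub> p" and y: "y \<in> carrier A" "\<phi> x = f \<odot>\<^bsub>A\<^esub> y"
  shows "\<exists>z\<in>carrier A. x [^]\<^bsub>A\<^esub> (n::nat) = \<iota> (bracket_fact F n) \<odot>\<^bsub>A\<^esub> z"
proof -
  let ?I = "p_bracket_ideal F p"
  interpret adic ?I
    by (rule adic.intro, unfold p_bracket_ideal_def, rule tring.genideal_ideal) simp
  note defs = B_def[symmetric] \<iota>_def[symmetric]
  note closed = iota_closed[unfolded defs] and mult = iota_mult[unfolded defs] and add = iota_add[unfolded defs]
  interpret B: cring B unfolding B_def by (rule cring_B)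
  interpret A: algebra B A by (rule A)
  have A': "module B A" by (rule A.module_axioms)
  have fB: "f \<in> carrier B" unfolding f_def by (rule closed)
  have \<Phi>h: "\<Phi> \<in> ring_hom B B" and \<Phi>': "\<Phi> \<circ> \<iota> = \<iota> \<circ> frob F p"
    using \<Phi> unfolding frob_extensions_def defs by blast+
  have \<Phi>\<iota>: "\<Phi> (\<iota> a) = \<iota> (frob F p a)" for a using fun_cong[OF \<Phi>', of a] by simp
  have \<Phi>c: "\<Phi> b \<in> carrier B" if "b \<in> carrier B" for b using ring_hom_closed[OF \<Phi>h that] .
  obtain s where s: "frob F p (bracket F p) = of_nat p + bracket F p * s"
    using frob_bracket_self[OF F] by blast
  obtain q where q: "p = Suc q" using prime_gt_0_nat[OF p] by (metis gr0_implies_Suc)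
  have p_nz: "\<exists>b\<in>carrier B. a = f \<otimes>\<^bsub>B\<^esub> b"
    if a: "a \<in> carrier B" and b: "b \<in> carrier B" and ab: "\<iota> (of_nat p) \<otimes>\<^bsub>B\<^esub> a = f \<otimes>\<^bsub>B\<^esub> b" for a b
  proof -
    let ?t = "\<iota> (frob F p (bracket_fact F q))"
    have "\<Phi> (\<iota> (bracket_fact F p)) = (\<iota> (of_nat p) \<oplus>\<^bsub>B\<^esub> f \<otimes>\<^bsub>B\<^esub> \<iota> s) \<otimes>\<^bsub>B\<^esub> ?t"
      unfolding \<Phi>\<iota> q bracket_fact_Suc ring_mapD(3)[OF ring_map_frob[OF F]]
      unfolding q[symmetric] s mult add f_def ..
    then have "\<Phi> (\<iota> (bracket_fact F p)) \<otimes>\<^bsub>B\<^esub> a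
      = ?t \<otimes>\<^bsub>B\<^esub> (\<iota> (of_nat p) \<otimes>\<^bsub>B\<^esub> a \<oplus>\<^bsub>B\<^esub> f \<otimes>\<^bsub>B\<^esub> (\<iota> s \<otimes>\<^bsub>B\<^esub> a))"
      using a fB closed by (simp add: B.l_distr B.r_distr B.m_ac)
    also have "\<dots> = f \<otimes>\<^bsub>B\<^esub> (?t \<otimes>\<^bsub>B\<^esub> (b \<oplus>\<^bsub>B\<^esub> \<iota> s \<otimes>\<^bsub>B\<^esub> a))"
      unfolding ab using a b fB closed by (simp add: B.r_distr B.m_ac)
    finally have e: "\<Phi> (\<iota> (bracket_fact F p)) \<otimes>\<^bsub>B\<^esub> a = f \<otimes>\<^bsub>B\<^esub> (?t \<otimes>\<^bsub>B\<^esub> (b \<oplus>\<^bsub>B\<^esub> \<iota> s \<otimes>\<^bsub>B\<^esub> a))" .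
    show ?thesis
      by (rule B.non_zero_divisor_mod_elem[OF fB \<Phi>c[OF closed] nz a _ e]) (use a b closed in simp)
  qed
  obtain g where g: "bracket F p = of_nat p + fps_X * g" using bracket_eq_of_nat_plus[OF F] by blast
  have f_reg: "b = \<zero>\<^bsub>B\<^esub>" if "b \<in> carrier B" "f \<otimes>\<^bsub>B\<^esub> b = \<zero>\<^bsub>B\<^esub>" for b
    unfolding B_def
  proof (rule p_completion_regular[OF g reg p_bracket_ideal_def], unfold defs f_def[symmetric])
    show "b \<in> carrier B" "f \<otimes>\<^bsub>B\<^esub> b = \<zero>\<^bsub>B\<^esub>" by fact+
  qed (rule p_nz)
  have flat': "tor_vanishes B f A" "flat_module (mod_elem B f) (mod_reduction f A)"
    using flat by (auto simp: completely_flat_def)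
  show ?thesis
  proof (rule divided_powers_exist[OF A fB _ \<Phi>h, of p "\<lambda>n. \<iota> (bracket F n)" "\<lambda>n. \<iota> (bracket_fact F n)" \<phi> x y n])
    show "1 < p" using p by (rule prime_gt_1_nat)
    show "\<iota> (bracket F n) \<in> carrier B" for n by (rule closed)
    show "\<iota> (bracket F (n * p)) = f \<otimes>\<^bsub>B\<^esub> \<Phi> (\<iota> (bracket F n))" for n
      unfolding bracket_mult[OF F] mult \<Phi>\<iota> f_def ..
    show "\<iota> (bracket F n) \<in> Units B" if n: "\<not> p dvd n" for n
    proof -
      obtain a s where as: "bracket F n * a = 1 + bracket F p * s"
        using bracket_unit_mod_bracket[OF F p n] by blast
      have "bracket F p * s = of_nat p * 0 + bracket F p * s" by simp
      then have "bracket F p * s \<in> ?I"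
        unfolding p_bracket_ideal_def Idl_tring_pair by blast
      with as show ?thesis by (rule iota_unit_of_mult[unfolded defs])
    qed
    show "\<iota> (bracket_fact F 0) = \<one>\<^bsub>B\<^esub>" using iota_one[unfolded defs] by simp
    show "\<iota> (bracket_fact F (Suc n)) = \<iota> (bracket F (Suc n)) \<otimes>\<^bsub>B\<^esub> \<iota> (bracket_fact F n)" for n
      unfolding bracket_fact_Suc by (rule mult)
    show "a = \<zero>\<^bsub>A\<^esub>" if "a \<in> carrier A" "f \<odot>\<^bsub>A\<^esub> a = \<zero>\<^bsub>A\<^esub>" for a
      by (rule tor_vanishes_torsionfree[OF A' fB f_reg flat'(1) that])
    show "\<exists>b\<in>carrier A. a = f \<odot>\<^bsub>A\<^esub> b"
      if "a \<in> carrier A" "b \<in> carrier A" "\<Phi> (\<iota> (bracket_fact F k)) \<odot>\<^bsub>A\<^esub> a = f \<odot>\<^bsub>A\<^esub> b" for k a b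
      by (rule flat_reduction_regular[OF A' fB flat'(2) \<Phi>c[OF closed] nz that])
  qed (use \<phi> x y in auto)
qed

theorem theorem4p3p20:
  fixes F :: "'a::comm_ring_1 fps fps" and p :: nat
  assumes fgl: "formal_group_law F"
    and nzd: "\<And>n. n > 0 \<Longrightarrow> non_zero_divisor pseries_ring (nseries F n)"
    and p: "prime p"
  shows
    "((\<exists>h. h \<in> mod_iso pseries_ring (self_module pseries_ring) (cohomology (FOmega_divided F) 0)) \<and>
      (\<forall>i>0. carrier (cohomology (FOmega_divided F) i) = {\<zero>\<^bsub>cohomology (FOmega_divided F) i\<^esub>}))
   \<and>
     (let Q = mod_elem pseries_ring (bracket F p);
          C = FOmega F Q (mod_elem_map pseries_ring (bracket F p))
      in \<exists>h. (\<forall>i. h i \<in> mod_iso Q (cmod C i) (cohomology C i)) \<and>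
             (\<forall>n. h 0 (xpow Q \<one>\<^bsub>Q\<^esub> n) = cohom_class C 0 (xpow Q \<one>\<^bsub>Q\<^esub> (n * p))) \<and>
             (\<forall>n. h 1 (xpow Q \<one>\<^bsub>Q\<^esub> n) = cohom_class C 1 (xpow Q \<one>\<^bsub>Q\<^esub> (n * p + (p - 1)))))
   \<and>
     (let I = bracket_ideal F p;
          B = adic_completion pseries_ring I;
          \<iota> = completion_map pseries_ring I;
          f = \<iota> (bracket F p);
          qis = (\<lambda>\<psi>. \<exists>u. quasi_iso B (FOmega F B \<psi>) (eta B f (FOmega F B \<iota>)) u \<and>
             (\<forall>n. u 0 (xpow B \<one>\<^bsub>B\<^esub> n) = xpow B \<one>\<^bsub>B\<^esub> (n * p)) \<and>
             (\<forall>n. u 1 (xpow B \<one>\<^bsub>B\<^esub> n) = xpow B f (n * p + (p - 1))))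
      in qis (\<iota> \<circ> frob F p) \<and> (\<forall>\<Phi>\<in>frob_extensions F p I. qis (\<Phi> \<circ> \<iota>)))
   \<and>
     (let I = p_bracket_ideal F p;
          B = adic_completion pseries_ring I;
          \<iota> = completion_map pseries_ring I;
          f = \<iota> (bracket F p)
      in \<forall>\<Phi>\<in>frob_extensions F p I.
         (\<forall>n. non_zero_divisor (mod_elem B f) (mod_elem_map B f (\<Phi> (\<iota> (bracket_fact F n))))) \<longrightarrow>
         (\<forall>(A :: (nat \<Rightarrow> 'a fps set, 'c) module) \<phi> x.
            algebra B A \<and> completely_flat B f A \<and> semilinear_multiplicative B \<Phi> A \<phi> \<and>
            x \<in> carrier A \<and> \<phi> x = x [^]\<^bsub>A\<^esub> p \<and> (\<exists>y\<in>carrier A. \<phi> x = f \<odot>\<^bsub>A\<^esub> y) \<longrightarrow>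
            (\<forall>n::nat. \<exists>y\<in>carrier A. x [^]\<^bsub>A\<^esub> n = \<iota> (bracket_fact F n) \<odot>\<^bsub>A\<^esub> y)))"
proof -
  have regb: "regular (bracket F n)" if "0 < n" for n
    by (rule regular_bracket[OF fgl nzd[OF that]])
  have regf: "regular (bracket_fact F n)" for n
    by (rule regular_bracket_fact, rule regb)
  have regp: "regular (bracket F p)" by (rule regb[OF prime_gt_0_nat[OF p]])
  note 1 = divided_cohomology[OF fgl regf]
  note 2 = reduction_cohomology[OF fgl p]
  note 3 = decalage_quasi_iso[OF fgl p regp]
  note 4 = divided_powers_in_flat_algebra[OF fgl p regp]
  have 5: "\<Phi> \<circ> completion_map pseries_ring (bracket_ideal F p)
      = completion_map pseries_ring (bracket_ideal F p) \<circ> frob F p"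
    if "\<Phi> \<in> frob_extensions F p (bracket_ideal F p)" for \<Phi>
    using that by (simp add: frob_extensions_def)
  show ?thesis
    unfolding Let_def
    (* \<open>y\<close> is instantiated by hand, as the hypothesis \<open>y \<in> carrier A\<close> also matches \<open>x \<in> carrier A\<close> *)
    by (intro conjI, rule 1(1), erule regb, intro allI impI, rule 1(2), erule regb, assumption,
        rule 2, rule 3[OF HOL.refl], intro ballI, rule 3[OF 5], assumption,
        intro ballI allI impI, elim conjE bexE,
        rule_tac y = y in 4, assumption, erule spec, assumption+)
qed

end
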